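(* Let $\psi:\mathbb{N}\to\mathbb{R}^+$ be a function satisfying $\psi(n)\to\infty$ as $n\to\infty$. Let $$E_{\sup}(\Lambda,\psi)=\Bigl\{x\in\Lambda:\ \limsup_{n\to\infty}\frac{\log a_n(x)}{\psi(n)}=1\Bigr\},\qquad E(\Lambda,\psi)=\Bigl\{x\in\Lambda:\ \lim_{n\to\infty}\frac{\log a_n(x)}{\psi(n)}=1\Bigr\}.$$ (i) If $\psi(n)/\log n\to\alpha$ as $n\to\infty$ for some $0\le\alpha<\infty$, then $$\dim_{\rm H}E_{\sup}(\Lambda,\psi)=\dim_{\rm H}E(\Lambda,\psi)=\begin{cases}0, & 0\le\alpha<1;\\ \dfrac{\alpha-1}{2\alpha}, & \alpha\ge1.\end{cases}$$ (ii) If $\psi(n)/\log n\to\infty$ as $n\to\infty$, then $$\dim_{\rm H}E_{\sup}(\Lambda,\psi)=\frac{1}{A+1},$$ where $A\in[1,\infty]$ is given by $\log A:=\liminf_{n\to\infty}\frac{\log\psi(n)}{n}$; and either $E(\Lambda,\psi)=\emptyset$ or $$\dim_{\rm H}E(\Lambda,\psi)=\frac{1}{C+1},$$ where $C\in[1,\infty]$ is given by $C:=1+\limsup_{n\to\infty}\frac{\psi(n+1)}{\psi(1)+\cdots+\psi(n)}$.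
   Context: $\mathbb{N}=\{1,2,3,\dots\}$ and $\mathbb{R}^+$ denotes the positive reals. For irrational $x\in(0,1)$, $x=[a_1(x),a_2(x),a_3(x),\dots]$ denotes the (regular) continued fraction expansion of $x$, i.e. $x=1/(a_1(x)+1/(a_2(x)+1/(a_3(x)+\cdots)))$, with partial quotients $a_n(x)$ positive integers. $\Lambda$ is the set of (irrational) $x\in(0,1)$ such that $a_n(x)\le a_{n+1}(x)$ for all $n\ge1$. $\dim_{\rm H}$ denotes Hausdorff dimension. Conventions: $\log\infty=\infty$ and $1/(\infty+1)=0$. *)

theory Defs
  imports "HOL-Analysis.Analysis"
begin

section \<open>Hausdorff dimension\<close>

text \<open>
  The \<open>s\<close>-th power of the diameter, with the usual conventions for \<open>s = 0\<close>: every nonempty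
  set contributes \<open>1\<close> and the empty set contributes \<open>0\<close>.  (The library has \<open>0 powr 0 = 0\<close>, so
  without the case distinction singletons would have \<open>0\<close>-dimensional measure \<open>0\<close>.)
\<close>

definition diam_pow :: "real \<Rightarrow> 'a::metric_space set \<Rightarrow> ennreal" where
  "diam_pow s U = (if U = {} then 0 else if s = 0 then 1 else ennreal (diameter U powr s))"

text \<open>
  Boundedness of the covering sets is required explicitly because \<^const>\<open>diameter\<close> is
  only meaningful for bounded sets.
\<close>

definition hausdorff_premeasure :: "real \<Rightarrow> real \<Rightarrow> 'a::metric_space set \<Rightarrow> ennreal" where
  "hausdorff_premeasure \<delta> s E =
     (INF U \<in> {U :: nat \<Rightarrow> 'a set. E \<subseteq> (\<Union>i. U i) \<and> (\<forall>i. bounded (U i) \<and> diameter (U i) \<le> \<delta>)}.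
        \<Sum>i. diam_pow s (U i))"

definition hausdorff_measure :: "real \<Rightarrow> 'a::metric_space set \<Rightarrow> ennreal" where
  "hausdorff_measure s E = (SUP \<delta> \<in> {0<..}. hausdorff_premeasure \<delta> s E)"

definition hausdorff_dim :: "'a::metric_space set \<Rightarrow> ereal" where
  "hausdorff_dim E = (INF s \<in> {s. 0 \<le> s \<and> hausdorff_measure s E = 0}. ereal s)"


section \<open>Regular continued fractions\<close>

definition gauss_map :: "real \<Rightarrow> real" where
  "gauss_map x = frac (1 / x)"

text \<open>
  \<open>partial_quotient x n\<close> is $a_n(x)$ for \<open>n \<ge> 1\<close>, computed by the continued fraction
  algorithm; the value at \<open>n = 0\<close> is irrelevant.  The theorem \<open>partial_quotient_unique\<close> below
  shows that this is the unique sequence of positive integers with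
  $x = 1/(a_1 + 1/(a_2 + \cdots))$.
\<close>

definition partial_quotient :: "real \<Rightarrow> nat \<Rightarrow> nat" where
  "partial_quotient x n = nat \<lfloor>1 / (gauss_map ^^ (n - 1)) x\<rfloor>"

text \<open>\<open>cf_convergent n a\<close> is $1/(a_1 + 1/(a_2 + \cdots + 1/a_n))$.\<close>

primrec cf_convergent :: "nat \<Rightarrow> (nat \<Rightarrow> nat) \<Rightarrow> real" where
  "cf_convergent 0 a = 0"
| "cf_convergent (Suc n) a = 1 / (real (a 1) + cf_convergent n (\<lambda>k. a (Suc k)))"

definition is_cf_expansion :: "(nat \<Rightarrow> nat) \<Rightarrow> real \<Rightarrow> bool" where
  "is_cf_expansion a x \<longleftrightarrow> (\<forall>n\<ge>1. a n \<ge> 1) \<and> (\<lambda>n. cf_convergent n a) \<longlonglongrightarrow> x"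

lemma gauss_map_irrational:
  assumes "0 < x" "x \<notin> \<rat>"
  shows "gauss_map x \<in> {0<..<1}" "gauss_map x \<notin> \<rat>"
proof -
  have "1 / x \<notin> \<rat>"
  proof
    assume "1 / x \<in> \<rat>"
    hence "inverse (1 / x) \<in> \<rat>" by (rule Rats_inverse)
    thus False using assms(2) by (simp only: inverse_divide div_by_1)
  qed
  show *: "gauss_map x \<notin> \<rat>"
  proof
    assume "gauss_map x \<in> \<rat>"
    hence "gauss_map x + of_int \<lfloor>1 / x\<rfloor> \<in> \<rat>" by (intro Rats_add Rats_of_int)
    thus False using \<open>1 / x \<notin> \<rat>\<close> by (simp add: gauss_map_def frac_def)
  qed
  hence "gauss_map x \<noteq> 0" by (metis Rats_0)
  thus "gauss_map x \<in> {0<..<1}"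
    using frac_ge_0[of "1 / x"] frac_lt_1[of "1 / x"] by (simp add: gauss_map_def)
qed

lemma partial_quotient_1:
  assumes "x \<in> {0<..<1}"
  shows "partial_quotient x 1 \<ge> 1" "1 / x = real (partial_quotient x 1) + gauss_map x"
proof -
  have "1 / x \<ge> 1" using assms by simp
  hence "\<lfloor>1 / x\<rfloor> \<ge> 1" by linarith
  moreover from this have "real (nat \<lfloor>1 / x\<rfloor>) = of_int \<lfloor>1 / x\<rfloor>"
    by (intro of_nat_nat) linarith
  ultimately show "partial_quotient x 1 \<ge> 1" "1 / x = real (partial_quotient x 1) + gauss_map x"
    by (simp_all add: partial_quotient_def gauss_map_def frac_def del: one_le_floor)
qed

lemma partial_quotient_Suc:
  assumes "n \<ge> 1"
  shows "partial_quotient x (Suc n) = partial_quotient (gauss_map x) n"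
  using assms by (cases n) (simp_all add: partial_quotient_def funpow_swap1)

lemma partial_quotient_pos:
  assumes "x \<in> {0<..<1}" "x \<notin> \<rat>" "n \<ge> 1"
  shows "partial_quotient x n \<ge> 1"
  using assms(3,1,2)
proof (induction n arbitrary: x rule: dec_induct)
  case base
  thus ?case using partial_quotient_1(1) by blast
next
  case (step n)
  thus ?case using gauss_map_irrational[of x] by (simp add: partial_quotient_Suc)
qed

lemma cf_convergent_cong:
  assumes "\<And>k. k \<ge> 1 \<Longrightarrow> a k = b k"
  shows "cf_convergent n a = cf_convergent n b"
  using assms
proof (induction n arbitrary: a b)
  case (Suc n)
  have "cf_convergent n (\<lambda>k. a (Suc k)) = cf_convergent n (\<lambda>k. b (Suc k))"
    using Suc.prems by (intro Suc.IH) simp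
  thus ?case using Suc.prems[of 1] by simp
qed simp

lemma cf_convergent_bounds:
  assumes "\<And>k. k \<ge> 1 \<Longrightarrow> a k \<ge> 1"
  shows "cf_convergent n a \<in> {0..1}"
  using assms
proof (induction n arbitrary: a)
  case (Suc n)
  have "cf_convergent n (\<lambda>k. a (Suc k)) \<in> {0..1}"
    using Suc.prems by (intro Suc.IH) simp
  moreover have "real (a 1) \<ge> 1" using Suc.prems[of 1] by simp
  ultimately show ?case by (simp add: divide_simps)
qed simp

lemma cf_convergent_partial_quotient_Suc:
  "cf_convergent (Suc n) (partial_quotient x) =
     1 / (real (partial_quotient x 1) + cf_convergent n (partial_quotient (gauss_map x)))"
  using cf_convergent_cong[of "\<lambda>k. partial_quotient x (Suc k)" "partial_quotient (gauss_map x)" n]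
  by (simp add: partial_quotient_Suc)

lemma cf_error_step:
  assumes "x \<in> {0<..<1}" "x \<notin> \<rat>"
  shows "\<bar>x - cf_convergent (Suc n) (partial_quotient x)\<bar> =
           x * cf_convergent (Suc n) (partial_quotient x) *
           \<bar>gauss_map x - cf_convergent n (partial_quotient (gauss_map x))\<bar>"
proof -
  let ?a = "real (partial_quotient x 1)" and ?t = "gauss_map x"
  let ?c = "cf_convergent n (partial_quotient ?t)"
  have t: "?t \<in> {0<..<1}" "?t \<notin> \<rat>" using gauss_map_irrational[of x] assms by auto
  have c: "?c \<ge> 0" using cf_convergent_bounds partial_quotient_pos t by force
  have a: "?a \<ge> 1" and x: "1 / x = ?a + ?t" using partial_quotient_1[of x] assms by auto
  have x': "x = 1 / (?a + ?t)" unfolding x[symmetric] by simp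
  have "x - 1 / (?a + ?c) = - (x * (1 / (?a + ?c)) * (?t - ?c))"
    using a c t by (subst (1 2) x') (simp add: divide_simps)
  moreover have "x * (1 / (?a + ?c)) \<ge> 0" using a c assms by simp
  ultimately have "\<bar>x - 1 / (?a + ?c)\<bar> = x * (1 / (?a + ?c)) * \<bar>?t - ?c\<bar>"
    by (simp only: abs_minus_cancel abs_mult[of "x * (1 / (?a + ?c))"] abs_of_nonneg)
  thus ?thesis unfolding cf_convergent_partial_quotient_Suc .
qed

lemma gauss_map_mult_le:
  assumes "x \<in> {0<..<1}"
  shows "x * gauss_map x \<le> 1 / 2"
proof (cases "x \<le> 1 / 2")
  case True
  have "gauss_map x \<le> 1" using frac_lt_1[of "1 / x"] by (simp add: gauss_map_def)
  hence "x * gauss_map x \<le> x * 1" using assms by (intro mult_left_mono) auto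
  thus ?thesis using True by simp
next
  case False
  have "1 = x * (1 / x)" using assms by simp
  also have "\<dots> = x * (real (partial_quotient x 1) + gauss_map x)"
    using partial_quotient_1(2)[OF assms] by simp
  also have "\<dots> = x * real (partial_quotient x 1) + x * gauss_map x"
    by (simp add: distrib_left)
  finally have "1 = x * real (partial_quotient x 1) + x * gauss_map x" .
  moreover have "x * real (partial_quotient x 1) \<ge> x * 1"
    using partial_quotient_1(1)[OF assms] assms by (intro mult_left_mono) auto
  ultimately show ?thesis using False by linarith
qed

lemma cf_error_bound:
  assumes "x \<in> {0<..<1}" "x \<notin> \<rat>"
  shows "\<bar>x - cf_convergent n (partial_quotient x)\<bar> \<le> (1 / 2) ^ (n div 2)"
  using assms
proof (induction n arbitrary: x rule: induct_nat_012)
  case 0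
  thus ?case by simp
next
  case 1
  have "cf_convergent 1 (partial_quotient x) \<in> {0..1}"
    using cf_convergent_bounds partial_quotient_pos[OF 1] by blast
  thus ?case using 1 by (simp add: abs_le_iff del: cf_convergent.simps)
next
  case (ge2 n)
  let ?t = "gauss_map x"
  let ?c1 = "cf_convergent (Suc (Suc n)) (partial_quotient x)"
  let ?c2 = "cf_convergent (Suc n) (partial_quotient ?t)"
  let ?e = "\<bar>gauss_map ?t - cf_convergent n (partial_quotient (gauss_map ?t))\<bar>"
  have t: "?t \<in> {0<..<1}" "?t \<notin> \<rat>" using gauss_map_irrational[of x] ge2.prems by auto
  have u: "gauss_map ?t \<in> {0<..<1}" "gauss_map ?t \<notin> \<rat>" using gauss_map_irrational[of ?t] t by auto
  have c1: "?c1 \<in> {0..1}" using cf_convergent_bounds partial_quotient_pos[OF ge2.prems] by blast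
  have c2: "?c2 \<in> {0..1}" using cf_convergent_bounds partial_quotient_pos[OF t] by blast
  have e: "?e \<le> (1 / 2) ^ (n div 2)" using ge2.IH(1) u by blast
  have "\<bar>x - ?c1\<bar> = (x * ?t) * ((?c1 * ?c2) * ?e)"
    unfolding cf_error_step[OF ge2.prems, of "Suc n"] cf_error_step[OF t, of n] by (simp only: mult_ac)
  also have "\<dots> \<le> (1 / 2) * (1 * (1 / 2) ^ (n div 2))"
    using gauss_map_mult_le[OF ge2.prems(1)] c1 c2 e ge2.prems t
    by (intro mult_mono) (auto intro: mult_le_one simp del: cf_convergent.simps)
  finally show ?case by simp
qed

theorem partial_quotient_is_cf_expansion:
  assumes "x \<in> {0<..<1}" "x \<notin> \<rat>"
  shows "is_cf_expansion (partial_quotient x) x"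
proof -
  have "filterlim (\<lambda>n::nat. n div 2) sequentially sequentially"
    unfolding filterlim_at_top eventually_sequentially
  proof
    fix m :: nat
    have "\<forall>n\<ge>2 * m. m \<le> n div 2" by auto
    thus "\<exists>N. \<forall>n\<ge>N. m \<le> n div 2" by blast
  qed
  moreover have "(\<lambda>n. (1 / 2 :: real) ^ n) \<longlonglongrightarrow> 0"
    by (rule LIMSEQ_realpow_zero) simp_all
  ultimately have lim: "(\<lambda>n. (1 / 2 :: real) ^ (n div 2)) \<longlonglongrightarrow> 0"
    by (rule filterlim_compose[rotated])
  have "norm (cf_convergent n (partial_quotient x) - x) \<le> (1 / 2) ^ (n div 2)" for n
    unfolding real_norm_def using cf_error_bound[OF assms, of n]
    by (subst abs_minus_commute)
  hence "(\<lambda>n. cf_convergent n (partial_quotient x) - x) \<longlonglongrightarrow> 0"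
    by (intro Lim_null_comparison[OF _ lim] always_eventually allI)
  hence "(\<lambda>n. cf_convergent n (partial_quotient x)) \<longlonglongrightarrow> x"
    by (simp add: LIM_zero_iff)
  thus ?thesis using partial_quotient_pos[OF assms] by (simp add: is_cf_expansion_def)
qed

lemma is_cf_expansion_step:
  assumes "is_cf_expansion a x" "x \<in> {0<..<1}" "x \<notin> \<rat>"
  shows "a 1 = partial_quotient x 1" "is_cf_expansion (\<lambda>k. a (Suc k)) (gauss_map x)"
proof -
  let ?b = "\<lambda>k. a (Suc k)"
  have pos: "a k \<ge> 1" if "k \<ge> 1" for k using assms(1) that by (simp add: is_cf_expansion_def)
  have b: "cf_convergent n ?b \<in> {0..1}" for n by (rule cf_convergent_bounds) (rule pos, simp)
  have "(\<lambda>n. cf_convergent (Suc n) a) \<longlonglongrightarrow> x"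
    using assms(1) unfolding is_cf_expansion_def by (intro LIMSEQ_Suc) blast
  hence "(\<lambda>n. 1 / cf_convergent (Suc n) a - real (a 1)) \<longlonglongrightarrow> 1 / x - real (a 1)"
    using assms(2) by (intro tendsto_intros) auto
  moreover have "1 / cf_convergent (Suc n) a - real (a 1) = cf_convergent n ?b" for n
    by simp
  ultimately have lim: "(\<lambda>n. cf_convergent n ?b) \<longlonglongrightarrow> 1 / x - real (a 1)" by simp
  have "1 / x - real (a 1) \<in> {0..1}"
    by (rule closed_sequentially[OF closed_atLeastAtMost _ lim]) (rule b)
  moreover have "1 / x - real (a 1) \<noteq> 1"
  proof
    assume "1 / x - real (a 1) = 1"
    hence "1 / x = real (a 1 + 1)" by simp
    hence "x = 1 / real (a 1 + 1)" by (metis div_by_1 divide_divide_eq_right mult_1)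
    moreover have "1 / real (a 1 + 1) \<in> \<rat>" by (intro Rats_divide Rats_1 Rats_of_nat)
    ultimately show False using assms(3) by simp
  qed
  ultimately have "real (a 1) \<le> 1 / x" "1 / x < real (a 1) + 1"
    unfolding atLeastAtMost_iff by linarith+
  hence fl: "\<lfloor>1 / x\<rfloor> = int (a 1)" by (intro floor_unique) simp_all
  thus "a 1 = partial_quotient x 1" by (simp add: partial_quotient_def)
  have "1 / x - real (a 1) = gauss_map x" using fl by (simp add: gauss_map_def frac_def)
  thus "is_cf_expansion ?b (gauss_map x)" using lim pos by (simp add: is_cf_expansion_def)
qed

theorem partial_quotient_unique:
  assumes "x \<in> {0<..<1}" "x \<notin> \<rat>" "is_cf_expansion a x" "n \<ge> 1"
  shows "a n = partial_quotient x n"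
  using assms(4,1-3)
proof (induction n arbitrary: x a rule: dec_induct)
  case base
  thus ?case using is_cf_expansion_step(1) by blast
next
  case (step n)
  have "a (Suc n) = partial_quotient (gauss_map x) n"
    using gauss_map_irrational[of x] step.prems is_cf_expansion_step(2)[of a x]
    by (intro step.IH) auto
  thus ?case using step.hyps by (simp add: partial_quotient_Suc)
qed


section \<open>The exceptional sets\<close>

definition Lambda :: "real set" where
  "Lambda = {x. 0 < x \<and> x < 1 \<and> x \<notin> \<rat> \<and>
                (\<forall>n\<ge>1. partial_quotient x n \<le> partial_quotient x (n + 1))}"

text \<open>
  Functions on $\{1,2,3,\ldots\}$ are total functions on \<^typ>\<open>nat\<close> whose value at \<open>0\<close> is never
  relevant.
\<close>

definition E_sup :: "(nat \<Rightarrow> real) \<Rightarrow> real set" where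
  "E_sup \<psi> = {x \<in> Lambda. limsup (\<lambda>n. ereal (ln (real (partial_quotient x n)) / \<psi> n)) = 1}"

definition E_lim :: "(nat \<Rightarrow> real) \<Rightarrow> real set" where
  "E_lim \<psi> = {x \<in> Lambda. (\<lambda>n. ln (real (partial_quotient x n)) / \<psi> n) \<longlonglongrightarrow> 1}"

text \<open>The logarithm on $[1,\infty]$, with $\log \infty = \infty$; only arguments \<open>\<ge> 1\<close> are used.\<close>

definition ln_ereal :: "ereal \<Rightarrow> ereal" where
  "ln_ereal x = (if x = \<infinity> then \<infinity> else ereal (ln (real_of_ereal x)))"

end

theory Submission
  imports Defs "HOL-Real_Asymp.Real_Asymp"
begin

text \<open>
  Write \<open>a\<^sub>n\<close> for the partial quotients of \<open>x\<close>. Every dimension is obtained from an upper bound by explicit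
  covers and a lower bound by an explicit Cantor set.

  Upper bounds. The inverse branch of the Gauss map belonging to the partial quotient \<open>a\<close> contracts by
  \<open>a powr (-2)\<close>, so covers can be built one partial quotient at a time
  (\<open>hausdorff_premeasure_branches_le\<close>), and finitely many initial partial quotients do not matter. Two
  families of sets are needed. If the \<open>a\<^sub>n\<close> are nondecreasing, tend to infinity and are eventually at most
  \<open>n powr \<beta>\<close>, then there are few admissible words, and a generating function bounds the covering sum
  (\<open>premeasure_polynomial_growth_null\<close>): the set has \<open>s\<close>-dimensional measure zero as soon as
  \<open>\<beta> * (1 - 2 * s) < 1\<close>. This gives \<open>(\<alpha> - 1) / (2 * \<alpha>)\<close> under logarithmic growth. If the \<open>a\<^sub>n\<close> tend
  to infinity and infinitely often a partial quotient is at least the \<open>(b - 1)\<close>-st power of the product of its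
  predecessors, then the dimension is at most \<open>1 / (b + 1)\<close>
  (\<open>premeasure_large_quotient_infinitely_often_null\<close>). Under fast growth this applies to the limit set
  for \<open>b < C\<close>, by the definition of \<open>C\<close>, and to the upper limit set for \<open>b < A\<close>, because without such large partial
  quotients \<open>ln a\<^sub>n\<close> could not grow faster than \<open>b ^ n\<close>.

  Lower bounds. Let the \<open>n\<close>-th partial quotient run freely through a block of \<open>m n\<close> consecutive integers, the
  blocks being arranged in increasing order so that monotonicity is automatic. Mixed radix expansion
  with radices \<open>m n\<close> parametrises the resulting Cantor set by the unit interval, and the
  parametrisation has a Hoelder continuous inverse with an exponent that depends on the sizes of the
  blocks (\<open>hausdorff_dim_digit_blocks_ge\<close>). Under logarithmic growth the blocks reach from \<open>n powr \<alpha>\<close> to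
  \<open>(n + 1) powr \<alpha>\<close>. Under fast growth they have length \<open>c n\<close> and start at \<open>(n + 1) * c n\<close>, where \<open>c\<close> is a
  nondecreasing sequence of positive integers with \<open>ln (c n) / ln n\<close> tending to infinity; when
  \<open>ln (c (n + 1))\<close> is at most \<open>D\<close> times the sum of its predecessors, the dimension is at least \<open>1 / (D + 2)\<close>
  (\<open>hausdorff_dim_wide_blocks_ge\<close>). For the limit set \<open>c\<close> is the expansion of any of its points. For
  the upper limit set \<open>c\<close> is the integer part of \<open>exp \<circ> \<phi>\<close>, where \<open>\<phi>\<close> is the largest nondecreasing minorant of \<open>\<psi>\<close> that
  grows at most by a factor \<open>B > A\<close> in each step; it agrees with \<open>\<psi>\<close> infinitely often.
\<close>

section \<open>Hausdorff premeasures\<close>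

lemma hausdorff_premeasure_le_cover:
  assumes "E \<subseteq> (\<Union>i. U i)" "\<And>i. bounded (U i)" "\<And>i. diameter (U i) \<le> \<delta>"
  shows "hausdorff_premeasure \<delta> s E \<le> (\<Sum>i. diam_pow s (U i))"
  unfolding hausdorff_premeasure_def using assms by (intro INF_lower) auto

lemma hausdorff_premeasure_lessE:
  assumes "hausdorff_premeasure \<delta> s E < c"
  obtains U where "E \<subseteq> (\<Union>i. U i)" "\<And>i. bounded (U i)" "\<And>i. diameter (U i) \<le> \<delta>"
    "(\<Sum>i. diam_pow s (U i)) < c"
  using assms unfolding hausdorff_premeasure_def INF_less_iff by blast

lemma hausdorff_premeasure_mono:
  assumes "E \<subseteq> F"
  shows "hausdorff_premeasure \<delta> s E \<le> hausdorff_premeasure \<delta> s F"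
  unfolding hausdorff_premeasure_def by (rule INF_superset_mono) (use assms in auto)

lemma diam_pow_empty [simp]: "diam_pow s {} = 0"
  by (simp add: diam_pow_def)

lemma diam_pow_pos: "s > 0 \<Longrightarrow> diam_pow s U = ennreal (diameter U powr s)"
  by (simp add: diam_pow_def)

lemma hausdorff_premeasure_le_diameter:
  assumes "bounded E" "diameter E \<le> d" "d \<le> \<delta>" "0 < s"
  shows "hausdorff_premeasure \<delta> s E \<le> ennreal (d powr s)"
proof -
  have d: "0 \<le> diameter E" by (rule diameter_ge_0) fact
  have "hausdorff_premeasure \<delta> s E \<le> (\<Sum>i::nat. diam_pow s (if i = 0 then E else {}))"
    using assms d by (intro hausdorff_premeasure_le_cover) (auto split: if_splits)
  also have "\<dots> = (\<Sum>i\<in>{0::nat}. diam_pow s (if i = 0 then E else {}))"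
    by (rule suminf_finite) auto
  also have "\<dots> = ennreal (diameter E powr s)" using assms by (simp add: diam_pow_pos)
  also have "\<dots> \<le> ennreal (d powr s)" using assms d by (intro ennreal_leI powr_mono2) auto
  finally show ?thesis .
qed

lemma hausdorff_premeasure_empty [simp]:
  assumes "0 \<le> \<delta>"
  shows "hausdorff_premeasure \<delta> s {} = 0"
  using hausdorff_premeasure_le_cover[of "{}" "\<lambda>_. {}" \<delta> s] assms by simp

text \<open>
  The usual argument: cover the n-th set to within \<open>e / 2 ^ (n + 1)\<close> of its premeasure
  and enumerate all the covering sets by pairs.
\<close>

lemma hausdorff_premeasure_UN_le:
  fixes E :: "nat \<Rightarrow> 'a::metric_space set"
  shows "hausdorff_premeasure \<delta> s (\<Union>n. E n) \<le> (\<Sum>n. hausdorff_premeasure \<delta> s (E n))"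
proof (rule ennreal_le_epsilon)
  fix e :: real
  assume e: "0 < e" and fin: "(\<Sum>n. hausdorff_premeasure \<delta> s (E n)) < top"
  let ?r = "\<lambda>n. ennreal (e * (1 / 2) ^ Suc n)"
  have lt: "hausdorff_premeasure \<delta> s (E n) < hausdorff_premeasure \<delta> s (E n) + ?r n" for n
  proof -
    have "hausdorff_premeasure \<delta> s (E n) < top"
      using fin ennreal_suminf_lessD by blast
    thus ?thesis using e by (simp add: ennreal_lessI less_top)
  qed
  have "\<exists>U. E n \<subseteq> (\<Union>i. U i) \<and> (\<forall>i. bounded (U i)) \<and> (\<forall>i. diameter (U i) \<le> \<delta>) \<and>
      (\<Sum>i::nat. diam_pow s (U i)) \<le> hausdorff_premeasure \<delta> s (E n) + ?r n" for n
  proof -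
    obtain U where "E n \<subseteq> (\<Union>i. U i)" "\<And>i. bounded (U i)" "\<And>i. diameter (U i) \<le> \<delta>"
        "(\<Sum>i. diam_pow s (U i)) < hausdorff_premeasure \<delta> s (E n) + ?r n"
      using hausdorff_premeasure_lessE[OF lt[of n]] by metis
    thus ?thesis by (intro exI[of _ U]) (simp add: less_imp_le)
  qed
  then obtain U where U: "\<And>n. E n \<subseteq> (\<Union>i::nat. U n i)" "\<And>n i. bounded (U n i)"
      "\<And>n i. diameter (U n i) \<le> \<delta>"
      "\<And>n. (\<Sum>i. diam_pow s (U n i)) \<le> hausdorff_premeasure \<delta> s (E n) + ?r n"
    by metis
  let ?V = "\<lambda>k. case prod_decode k of (n, i) \<Rightarrow> U n i"
  have "(\<Union>n. E n) \<subseteq> (\<Union>k. ?V k)"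
  proof
    fix x assume "x \<in> (\<Union>n. E n)"
    then obtain n i where "x \<in> U n i" using U(1) by blast
    thus "x \<in> (\<Union>k. ?V k)" by (intro UN_I[of "prod_encode (n, i)"]) simp_all
  qed
  hence "hausdorff_premeasure \<delta> s (\<Union>n. E n) \<le> (\<Sum>k. diam_pow s (?V k))"
    by (rule hausdorff_premeasure_le_cover) (simp_all add: case_prod_beta U(2,3))
  also have "\<dots> = (\<Sum>n. \<Sum>i. diam_pow s (U n i))"
    using suminf_ennreal_2dimen[of "\<lambda>n. \<Sum>i. diam_pow s (U n i)" "\<lambda>(n, i). diam_pow s (U n i)"]
    by (simp add: comp_def case_prod_beta)
  also have "\<dots> \<le> (\<Sum>n. hausdorff_premeasure \<delta> s (E n) + ?r n)"
    using U(4) by (intro suminf_le) auto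
  also have "\<dots> = (\<Sum>n. hausdorff_premeasure \<delta> s (E n)) + (\<Sum>n. ?r n)"
    by (rule suminf_add[symmetric]) auto
  also have "(\<Sum>n. ?r n) = ennreal e"
  proof -
    have "(\<lambda>n. e * (1 / 2) ^ Suc n) sums (e * 1)"
      by (rule sums_mult[OF power_half_series])
    hence "(\<lambda>n. e * (1 / 2) ^ Suc n) sums e" by (simp only: mult_1_right)
    moreover have "0 \<le> e * (1 / 2) ^ Suc n" for n using e by simp
    ultimately show ?thesis by (rule suminf_ennreal_eq[rotated])
  qed
  finally show "hausdorff_premeasure \<delta> s (\<Union>n. E n) \<le> (\<Sum>n. hausdorff_premeasure \<delta> s (E n)) + ennreal e" .
qed

lemma hausdorff_premeasure_UN_null:
  fixes E :: "nat \<Rightarrow> 'a::metric_space set"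
  assumes "\<And>n. hausdorff_premeasure \<delta> s (E n) = 0"
  shows "hausdorff_premeasure \<delta> s (\<Union>n. E n) = 0"
  using hausdorff_premeasure_UN_le[of \<delta> s E] by (simp add: assms)

lemma hausdorff_premeasure_null_subset:
  assumes "E \<subseteq> F" "hausdorff_premeasure \<delta> s F = 0"
  shows "hausdorff_premeasure \<delta> s E = 0"
  using hausdorff_premeasure_mono[OF assms(1), of \<delta> s] assms(2) by simp

text \<open>
  A cover of \<open>E\<close> by sets \<open>U i\<close> is pushed forward to the sets \<open>f ` (U i
  \<inter> E)\<close>. The bound \<open>L \<le> 1\<close> keeps the image cover admissible for the
  same \<open>\<delta>\<close>.
\<close>

lemma hausdorff_premeasure_lipschitz_image:
  fixes f :: "'a::metric_space \<Rightarrow> 'b::metric_space"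
  assumes lip: "\<And>x y. x \<in> E \<Longrightarrow> y \<in> E \<Longrightarrow> dist (f x) (f y) \<le> L * dist x y"
    and L: "0 < L" "L \<le> 1" and s: "0 < s"
  shows "hausdorff_premeasure \<delta> s (f ` E) \<le> ennreal (L powr s) * hausdorff_premeasure \<delta> s E"
proof -
  have "hausdorff_premeasure \<delta> s (f ` E) \<le> ennreal (L powr s) * (\<Sum>i. diam_pow s (U i))"
    if U: "E \<subseteq> (\<Union>i. U i)" "\<And>i. bounded (U i)" "\<And>i. diameter (U i) \<le> \<delta>" for U :: "nat \<Rightarrow> 'a set"
  proof -
    let ?V = "\<lambda>i. f ` (U i \<inter> E)"
    have dist_le: "dist (f x) (f y) \<le> L * diameter (U i)" if "x \<in> U i \<inter> E" "y \<in> U i \<inter> E" for x y i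
    proof -
      have "dist (f x) (f y) \<le> L * dist x y" using lip that by blast
      also have "\<dots> \<le> L * diameter (U i)"
        using L U(2) that by (intro mult_left_mono diameter_bounded_bound) auto
      finally show ?thesis .
    qed
    have nn: "0 \<le> diameter (U i)" for i by (rule diameter_ge_0) (rule U)
    have bdd: "bounded (?V i)" for i
    proof (cases "U i \<inter> E = {}")
      case False
      then obtain z where "z \<in> U i \<inter> E" by blast
      thus ?thesis using dist_le[of z i] unfolding bounded_def by blast
    qed auto
    have diam: "diameter (?V i) \<le> L * diameter (U i)" for i
    proof (cases "?V i = {}")
      case False
      have "dist u v \<le> L * diameter (U i)" if "u \<in> ?V i" "v \<in> ?V i" for u v
        using that dist_le by blast
      thus ?thesis using False unfolding diameter_def[of "?V i"] by (auto intro!: cSUP_least)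
    qed (use nn[of i] L in simp)
    have "hausdorff_premeasure \<delta> s (f ` E) \<le> (\<Sum>i. diam_pow s (?V i))"
    proof (rule hausdorff_premeasure_le_cover)
      show "f ` E \<subseteq> (\<Union>i. ?V i)" using U(1) by blast
      show "diameter (?V i) \<le> \<delta>" for i
        using diam[of i] mult_right_mono[OF L(2) nn[of i]] U(3)[of i] by linarith
    qed (rule bdd)
    also have "\<dots> \<le> (\<Sum>i. ennreal (L powr s) * diam_pow s (U i))"
    proof (rule suminf_le)
      fix i
      have "diameter (?V i) powr s \<le> (L * diameter (U i)) powr s"
        using diam s diameter_ge_0[OF bdd] by (intro powr_mono2) auto
      also have "\<dots> = L powr s * diameter (U i) powr s" using L nn by (simp add: powr_mult)
      finally show "diam_pow s (?V i) \<le> ennreal (L powr s) * diam_pow s (U i)"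
        using s by (simp add: diam_pow_pos ennreal_mult[symmetric] ennreal_leI)
    qed auto
    finally show ?thesis by simp
  qed
  moreover have inv: "ennreal (L powr - s) * (ennreal (L powr s) * z) = z"
      "ennreal (L powr s) * (ennreal (L powr - s) * z) = z" for z
    using L by (simp_all add: mult.assoc[symmetric] ennreal_mult[symmetric] powr_add[symmetric])
  ultimately have "ennreal (L powr - s) * hausdorff_premeasure \<delta> s (f ` E) \<le> (\<Sum>i. diam_pow s (U i))"
    if "E \<subseteq> (\<Union>i. U i)" "\<And>i. bounded (U i)" "\<And>i. diameter (U i) \<le> \<delta>" for U :: "nat \<Rightarrow> 'a set"
    using mult_left_mono[of _ _ "ennreal (L powr - s)"] that by (metis zero_le)
  hence "ennreal (L powr - s) * hausdorff_premeasure \<delta> s (f ` E) \<le> hausdorff_premeasure \<delta> s E"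
    unfolding hausdorff_premeasure_def[of _ _ E] by (intro INF_greatest) auto
  hence "ennreal (L powr s) * (ennreal (L powr - s) * hausdorff_premeasure \<delta> s (f ` E))
      \<le> ennreal (L powr s) * hausdorff_premeasure \<delta> s E" by (rule mult_left_mono) simp
  thus ?thesis by (simp only: inv)
qed

text \<open>
  A cover whose \<open>s\<close>-sum is tiny consists of tiny sets, so covers at scale 1 already
  decide whether the Hausdorff measure vanishes. All upper bounds below can therefore work at the
  single scale 1, where the premeasure behaves well under the contracting inverse branches of the
  Gauss map.
\<close>

lemma hausdorff_measure_eq_0:
  assumes null: "hausdorff_premeasure 1 s E = 0" and s: "0 < s"
  shows "hausdorff_measure s E = 0"
proof -
  have le: "hausdorff_premeasure \<delta> s E \<le> ennreal e" if \<delta>: "0 < \<delta>" and e: "0 < e" for \<delta> e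
  proof -
    define r where "r = min e (\<delta> powr s)"
    have r: "0 < r" using \<delta> e by (simp add: r_def)
    have "hausdorff_premeasure 1 s E < ennreal r" using null r by simp
    then obtain U where U: "E \<subseteq> (\<Union>i. U i)" "\<And>i. bounded (U i)"
        "(\<Sum>i::nat. diam_pow s (U i)) < ennreal r"
      by (rule hausdorff_premeasure_lessE) blast
    have "diameter (U i) \<le> \<delta>" for i
    proof -
      have "diam_pow s (U i) \<le> (\<Sum>i. diam_pow s (U i))"
        using sum_le_suminf[of "\<lambda>i. diam_pow s (U i)" "{i}"] by simp
      hence "ennreal (diameter (U i) powr s) < ennreal r" using U(3) s by (simp add: diam_pow_pos)
      hence "diameter (U i) powr s < \<delta> powr s" using r by (simp add: r_def ennreal_less_iff)
      thus ?thesis using \<delta> s powr_less_cancel2[of s "diameter (U i)" \<delta>]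
        diameter_ge_0[OF U(2)[of i]] by (cases "diameter (U i) = 0") auto
    qed
    hence "hausdorff_premeasure \<delta> s E \<le> (\<Sum>i. diam_pow s (U i))"
      using U(1,2) by (intro hausdorff_premeasure_le_cover)
    also have "\<dots> \<le> ennreal r" using U(3) by (rule less_imp_le)
    also have "\<dots> \<le> ennreal e" by (simp add: r_def ennreal_leI)
    finally show ?thesis .
  qed
  have "hausdorff_premeasure \<delta> s E \<le> 0" if "0 < \<delta>" for \<delta>
    by (rule ennreal_le_epsilon) (use le that in simp)
  hence "(SUP \<delta>\<in>{0<..}. hausdorff_premeasure \<delta> s E) \<le> 0" by (intro SUP_least) simp
  thus ?thesis unfolding hausdorff_measure_def by simp
qed

lemma hausdorff_dim_nonneg: "0 \<le> hausdorff_dim E"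
  unfolding hausdorff_dim_def by (rule INF_greatest) auto

lemma hausdorff_dim_le:
  assumes "hausdorff_premeasure 1 s E = 0" "0 < s"
  shows "hausdorff_dim E \<le> ereal s"
  unfolding hausdorff_dim_def using assms hausdorff_measure_eq_0[OF assms]
  by (intro INF_lower) auto

lemma hausdorff_dim_le_limit:
  assumes d: "0 \<le> d" and null: "\<And>s. d < s \<Longrightarrow> s < d + r \<Longrightarrow> hausdorff_premeasure 1 s E = 0" and r: "0 < r"
  shows "hausdorff_dim E \<le> ereal d"
proof (rule ereal_le_epsilon2)
  fix e :: real assume e: "0 < e"
  define t where "t = min (e / 2) (r / 2)"
  have t: "0 < t" "t < r" "t \<le> e" using e r by (auto simp: t_def)
  have "hausdorff_dim E \<le> ereal (d + t)" using d t by (intro hausdorff_dim_le null) auto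
  also have "\<dots> \<le> ereal d + ereal e" using t by simp
  finally show "hausdorff_dim E \<le> ereal d + ereal e" .
qed

lemma hausdorff_dim_mono:
  assumes "E \<subseteq> F"
  shows "hausdorff_dim E \<le> hausdorff_dim F"
proof -
  have "hausdorff_measure s E \<le> hausdorff_measure s F" for s
    unfolding hausdorff_measure_def by (intro SUP_mono) (use hausdorff_premeasure_mono[OF assms] in blast)
  hence "hausdorff_measure s F = 0 \<Longrightarrow> hausdorff_measure s E = 0" for s by (metis le_zero_eq)
  thus ?thesis unfolding hausdorff_dim_def by (intro INF_superset_mono) auto
qed

text \<open>
  This replaces the construction of a measure on \<open>E\<close> in the mass distribution principle.
  The map \<open>h\<close> parametrises a subset of \<open>E\<close> by the unit interval, and its
  inverse is \<open>s\<close>-Hoelder. A cover of \<open>E\<close> by sets \<open>U i\<close> pulls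
  back to a cover of the unit interval by intervals of length \<open>C * diameter (U i) powr
  s\<close>, and these lengths add up to at least 1. Each preimage is first enclosed in an interval,
  so that the argument applies to an arbitrary map \<open>h\<close>.
\<close>

lemma hausdorff_dim_ge:
  fixes h :: "real \<Rightarrow> 'a::metric_space"
  assumes h: "\<And>t. t \<in> {0..<1} \<Longrightarrow> h t \<in> E"
    and holder: "\<And>t u. t \<in> {0..<1} \<Longrightarrow> u \<in> {0..<1} \<Longrightarrow> \<bar>t - u\<bar> \<le> C * dist (h t) (h u) powr s"
    and s: "0 < s" and C: "0 < C"
  shows "ereal s \<le> hausdorff_dim E"
  unfolding hausdorff_dim_def
proof (rule INF_greatest, clarify)
  fix s' assume s': "0 \<le> s'" "hausdorff_measure s' E = 0"
  show "ereal s \<le> ereal s'"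
  proof (rule ccontr)
    assume "\<not> ereal s \<le> ereal s'"
    hence less: "s' < s" by simp
    have "hausdorff_premeasure 1 s' E \<le> hausdorff_measure s' E"
      unfolding hausdorff_measure_def by (rule SUP_upper) auto
    hence "hausdorff_premeasure 1 s' E < ennreal (1 / C)" using s' C by simp
    then obtain U where U: "E \<subseteq> (\<Union>i. U i)" "\<And>i. bounded (U i)" "\<And>i. diameter (U i) \<le> 1"
        "(\<Sum>i::nat. diam_pow s' (U i)) < ennreal (1 / C)"
      by (rule hausdorff_premeasure_lessE) blast
    define T where "T i = {t \<in> {0..<1}. h t \<in> U i}" for i
    define d where "d i = C * diameter (U i) powr s" for i
    define J where "J i = (if T i = {} then {} else {Inf (T i)..Inf (T i) + d i})" for i
    have nn: "0 \<le> diameter (U i)" for i by (rule diameter_ge_0) (rule U)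
    have d: "0 \<le> d i" for i using C by (simp add: d_def)
    have T_dist: "t - u \<le> d i" if "t \<in> T i" "u \<in> T i" for t u i
    proof -
      have "t - u \<le> C * dist (h t) (h u) powr s"
        using that holder[of t u] by (auto simp: T_def)
      also have "\<dots> \<le> d i" unfolding d_def
        using C s that U(2) by (intro mult_left_mono powr_mono2 diameter_bounded_bound) (auto simp: T_def)
      finally show ?thesis .
    qed
    have TJ: "T i \<subseteq> J i" for i
    proof
      fix t assume t: "t \<in> T i"
      have "bdd_below (T i)" by (rule bdd_belowI[of _ 0]) (auto simp: T_def)
      hence "Inf (T i) \<le> t" using t by (rule cInf_lower[rotated])
      moreover have "t - d i \<le> Inf (T i)" using t T_dist[of t i] by (intro cInf_greatest) force+
      ultimately show "t \<in> J i" using t by (auto simp: J_def)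
    qed
    have "{0..<1} \<subseteq> (\<Union>i. T i)" using h U(1) unfolding T_def by blast
    hence sub: "{0..<1} \<subseteq> (\<Union>i. J i)" using TJ by blast
    have meas: "J i \<in> sets lborel" for i by (simp add: J_def)
    have le: "emeasure lborel (J i) \<le> ennreal C * diam_pow s' (U i)" for i
    proof (cases "T i = {}")
      case False
      hence "U i \<noteq> {}" by (auto simp: T_def)
      have "emeasure lborel (J i) = ennreal (d i)" using False d by (simp add: J_def)
      also have "\<dots> \<le> ennreal C * diam_pow s' (U i)"
      proof (cases "s' = 0")
        case True
        have "diameter (U i) powr s \<le> 1 powr s" using U(3) nn s by (intro powr_mono2) auto
        hence "d i \<le> C" using C by (simp add: d_def)
        thus ?thesis using True \<open>U i \<noteq> {}\<close> by (simp add: diam_pow_def ennreal_leI)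
      next
        case False
        have "diameter (U i) powr s \<le> diameter (U i) powr s'"
          using U(3) nn less by (intro powr_mono') auto
        hence "d i \<le> C * diameter (U i) powr s'" using C by (simp add: d_def)
        thus ?thesis using False \<open>U i \<noteq> {}\<close> C by (simp add: diam_pow_def ennreal_mult[symmetric] ennreal_leI)
      qed
      finally show ?thesis .
    qed (simp add: J_def)
    have "emeasure lborel {0..<1::real} \<le> emeasure lborel (\<Union>i. J i)"
      using sub meas by (intro emeasure_mono) auto
    also have "\<dots> \<le> (\<Sum>i. emeasure lborel (J i))"
      using meas by (intro emeasure_subadditive_countably) auto
    also have "\<dots> \<le> (\<Sum>i. ennreal C * diam_pow s' (U i))" using le by (intro suminf_le) auto
    also have "\<dots> = ennreal C * (\<Sum>i. diam_pow s' (U i))" by simp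
    also have "\<dots> < ennreal C * ennreal (1 / C)"
      using U(4) C by (intro ennreal_mult_strict_left_mono) auto
    also have "\<dots> = 1" using C by (simp add: ennreal_mult[symmetric])
    finally show False by simp
  qed
qed

section \<open>Inverse branches of the Gauss map\<close>

definition irrational_unit :: "real set" where
  "irrational_unit = {x. 0 < x \<and> x < 1 \<and> x \<notin> \<rat>}"

lemma gauss_map_irrational_unit:
  "x \<in> irrational_unit \<Longrightarrow> gauss_map x \<in> irrational_unit"
  using gauss_map_irrational[of x] by (simp add: irrational_unit_def)

lemma funpow_gauss_map_irrational_unit:
  "x \<in> irrational_unit \<Longrightarrow> (gauss_map ^^ m) x \<in> irrational_unit"
  by (induction m) (simp_all add: gauss_map_irrational_unit)

lemma partial_quotient_funpow:
  assumes "1 \<le> n"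
  shows "partial_quotient ((gauss_map ^^ m) x) n = partial_quotient x (n + m)"
proof -
  have "n + m - 1 = (n - 1) + m" using assms by simp
  thus ?thesis by (simp only: partial_quotient_def funpow_add comp_apply)
qed

lemma partial_quotient_ge_1:
  "x \<in> irrational_unit \<Longrightarrow> 1 \<le> n \<Longrightarrow> 1 \<le> partial_quotient x n"
  by (rule partial_quotient_pos) (auto simp: irrational_unit_def)

lemma irrational_unit_step:
  assumes "x \<in> irrational_unit"
  shows "x = 1 / (real (partial_quotient x 1) + gauss_map x)"
proof -
  have "1 / x = real (partial_quotient x 1) + gauss_map x"
    using partial_quotient_1(2)[of x] assms by (simp add: irrational_unit_def)
  thus ?thesis by (metis div_by_1 divide_divide_eq_right mult_1)
qed

text \<open>
  The inverse branch \<open>y \<mapsto> 1 / (a + y)\<close> contracts by the factor \<open>a powr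
  (-2)\<close>. This is behind the covers as well as the convergence of continued fractions with
  prescribed partial quotients.
\<close>

lemma inverse_branch_dist:
  fixes a y z :: real
  assumes "0 < a" "0 \<le> y" "0 \<le> z"
  shows "dist (1 / (a + y)) (1 / (a + z)) \<le> a powr (-2) * dist y z"
proof -
  have "1 / (a + y) - 1 / (a + z) = (z - y) / ((a + y) * (a + z))"
    using assms by (simp add: field_simps)
  hence "dist (1 / (a + y)) (1 / (a + z)) = dist y z / ((a + y) * (a + z))"
    using assms by (simp add: dist_real_def abs_minus_commute)
  also have "\<dots> \<le> dist y z / (a * a)"
    using assms by (intro divide_left_mono mult_mono mult_pos_pos) auto
  also have "\<dots> = a powr (-2) * dist y z"
    using assms by (simp add: powr_minus power2_eq_square divide_simps)
  finally show ?thesis .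
qed

text \<open>
  One step of the covering argument: \<open>E\<close> is split according to the first partial
  quotient, and each piece is the image of a set \<open>F a\<close> under an inverse branch. Iterating
  this inequality replaces sums over words of partial quotients by inductions on their length.
\<close>

lemma hausdorff_premeasure_branches_le:
  assumes s: "0 < s" and K: "1 \<le> K"
    and E: "\<And>x. x \<in> E \<Longrightarrow> x \<in> irrational_unit \<and> K \<le> partial_quotient x 1 \<and>
              gauss_map x \<in> F (partial_quotient x 1)"
  shows "hausdorff_premeasure 1 s E \<le>
    (\<Sum>i. ennreal (real (K + i) powr (-2 * s)) * hausdorff_premeasure 1 s (F (K + i)))"
proof -
  let ?B = "\<lambda>i. (\<lambda>y. 1 / (real (K + i) + y)) ` (F (K + i) \<inter> irrational_unit)"
  have "E \<subseteq> (\<Union>i. ?B i)"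
  proof
    fix x assume "x \<in> E"
    note x = E[OF this]
    then obtain i where i: "partial_quotient x 1 = K + i" using le_Suc_ex by blast
    have "x = 1 / (real (K + i) + gauss_map x)"
      using irrational_unit_step[of x] x i by simp
    moreover have "gauss_map x \<in> F (K + i) \<inter> irrational_unit"
      using x i gauss_map_irrational_unit by auto
    ultimately have "x \<in> ?B i" by (rule image_eqI)
    thus "x \<in> (\<Union>i. ?B i)" by blast
  qed
  hence "hausdorff_premeasure 1 s E \<le> hausdorff_premeasure 1 s (\<Union>i. ?B i)"
    by (rule hausdorff_premeasure_mono)
  also have "\<dots> \<le> (\<Sum>i. hausdorff_premeasure 1 s (?B i))" by (rule hausdorff_premeasure_UN_le)
  also have "\<dots> \<le> (\<Sum>i. ennreal (real (K + i) powr (-2 * s)) * hausdorff_premeasure 1 s (F (K + i)))"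
  proof (rule suminf_le)
    fix i
    have a: "1 \<le> real (K + i)" using K by simp
    have "hausdorff_premeasure 1 s (?B i) \<le>
        ennreal ((real (K + i) powr (-2)) powr s) * hausdorff_premeasure 1 s (F (K + i) \<inter> irrational_unit)"
    proof (rule hausdorff_premeasure_lipschitz_image)
      fix y z assume "y \<in> F (K + i) \<inter> irrational_unit" "z \<in> F (K + i) \<inter> irrational_unit"
      thus "dist (1 / (real (K + i) + y)) (1 / (real (K + i) + z)) \<le> real (K + i) powr - 2 * dist y z"
        using a by (intro inverse_branch_dist) (auto simp: irrational_unit_def)
    qed (use s a powr_mono[of "-2" 0 "real (K + i)"] in auto)
    also have "\<dots> \<le> ennreal (real (K + i) powr (-2 * s)) * hausdorff_premeasure 1 s (F (K + i))"
      by (intro mult_mono hausdorff_premeasure_mono) (auto simp: powr_powr)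
    finally show "hausdorff_premeasure 1 s (?B i) \<le>
        ennreal (real (K + i) powr (-2 * s)) * hausdorff_premeasure 1 s (F (K + i))" .
  qed auto
  finally show ?thesis .
qed

text \<open>
  Null sets pull back to null sets, so finitely many initial partial quotients may be ignored.
  Conditions that hold only from some index on can thus be treated as if they held everywhere.
\<close>

lemma hausdorff_premeasure_gauss_vimage_null:
  assumes s: "0 < s" and null: "hausdorff_premeasure 1 s F = 0"
  shows "hausdorff_premeasure 1 s {x \<in> irrational_unit. (gauss_map ^^ m) x \<in> F} = 0"
proof (induction m)
  case 0
  show ?case by (rule hausdorff_premeasure_null_subset[OF _ null]) auto
next
  case (Suc m)
  let ?F = "{x \<in> irrational_unit. (gauss_map ^^ m) x \<in> F}"
  have "hausdorff_premeasure 1 s {x \<in> irrational_unit. (gauss_map ^^ Suc m) x \<in> F} \<le>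
      (\<Sum>i. ennreal (real (1 + i) powr (-2 * s)) * hausdorff_premeasure 1 s ?F)"
    using s by (intro hausdorff_premeasure_branches_le[where F = "\<lambda>_. ?F"])
      (auto simp: funpow_swap1 gauss_map_irrational_unit partial_quotient_ge_1 simp del: One_nat_def)
  thus ?case by (simp add: Suc.IH)
qed

section \<open>Slowly growing monotone expansions\<close>

text \<open>
  The monotonicity condition concerns all indices, and the bound \<open>M\<close> only the first
  \<open>n\<close> of them. The lower bound \<open>K\<close> is a parameter because after removing a
  first partial quotient \<open>a\<close> the remaining ones are at least \<open>a\<close>.
\<close>

definition monotone_bounded_prefix :: "nat \<Rightarrow> nat \<Rightarrow> nat \<Rightarrow> real set" where
  "monotone_bounded_prefix M n K = {x \<in> irrational_unit.
     (\<forall>i\<ge>1. K \<le> partial_quotient x i \<and> partial_quotient x i \<le> partial_quotient x (i + 1)) \<and>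
     (\<forall>i\<in>{1..n}. partial_quotient x i \<le> M)}"

lemma partial_quotient_gauss_map:
  "1 \<le> n \<Longrightarrow> partial_quotient (gauss_map x) n = partial_quotient x (n + 1)"
  by (simp add: partial_quotient_Suc)

lemma monotone_bounded_prefix_step:
  assumes x: "x \<in> monotone_bounded_prefix M (Suc n) K"
  shows "x \<in> irrational_unit" "K \<le> partial_quotient x 1" "partial_quotient x 1 \<le> M"
    "gauss_map x \<in> monotone_bounded_prefix M n (partial_quotient x 1)"
proof -
  from x show "x \<in> irrational_unit" "K \<le> partial_quotient x 1" "partial_quotient x 1 \<le> M"
    by (auto simp: monotone_bounded_prefix_def)
  have le: "partial_quotient x 1 \<le> partial_quotient x i" if "1 \<le> i" for i
    using that
  proof (induction i rule: dec_induct)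
    case (step i)
    thus ?case using x by (force simp: monotone_bounded_prefix_def)
  qed simp
  show "gauss_map x \<in> monotone_bounded_prefix M n (partial_quotient x 1)"
    using x le by (auto simp: monotone_bounded_prefix_def gauss_map_irrational_unit
        partial_quotient_gauss_map simp del: One_nat_def)
qed

text \<open>
  The covering sum over nondecreasing words \<open>K \<le> a\<^sub>1 \<le> \<dots> \<le> a\<^sub>n
  \<le> M\<close> with weights \<open>u a = a powr (-2 * s)\<close> is a complete homogeneous
  symmetric polynomial in the \<open>u a\<close>. Its generating function, evaluated at 2, is the
  product on the right, which gives the factor \<open>(1 / 2) ^ n\<close>. For the value 2 to lie
  within the radius of convergence, the weights must be small, hence the condition on
  \<open>K0\<close>.
\<close>

lemma premeasure_monotone_bounded_prefix_le:
  assumes s: "0 < s" and K0: "1 \<le> K0" "\<And>k. K0 \<le> k \<Longrightarrow> 2 * real k powr (-2 * s) \<le> 1 / 2" and K: "K0 \<le> K"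
  shows "hausdorff_premeasure 1 s (monotone_bounded_prefix M n K) \<le>
    ennreal ((1 / 2) ^ n * (\<Prod>k=K..M. 1 / (1 - 2 * real k powr (-2 * s))))"
  using K
proof (induction n arbitrary: K)
  case 0
  have "hausdorff_premeasure 1 s (monotone_bounded_prefix M 0 K) \<le> ennreal (1 powr s)"
  proof (rule hausdorff_premeasure_le_diameter)
    have sub: "monotone_bounded_prefix M 0 K \<subseteq> {0..1}"
      by (auto simp: monotone_bounded_prefix_def irrational_unit_def)
    thus "bounded (monotone_bounded_prefix M 0 K)" by (rule bounded_subset[rotated]) simp
    have "diameter (monotone_bounded_prefix M 0 K) \<le> diameter {0..1::real}"
      using sub by (intro diameter_subset) auto
    thus "diameter (monotone_bounded_prefix M 0 K) \<le> 1" by simp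
  qed (use s in auto)
  also have "\<dots> \<le> ennreal ((1 / 2) ^ 0 * (\<Prod>k=K..M. 1 / (1 - 2 * real k powr (-2 * s))))"
  proof (intro ennreal_leI)
    have "1 \<le> (\<Prod>k=K..M. 1 / (1 - 2 * real k powr (-2 * s)))"
    proof (rule prod_ge_1)
      fix k assume "k \<in> {K..M}"
      hence "2 * real k powr (-2 * s) \<le> 1 / 2" using K0(2)[of k] 0 by simp
      thus "1 \<le> 1 / (1 - 2 * real k powr (-2 * s))" by (simp add: divide_simps)
    qed
    thus "1 powr s \<le> (1 / 2) ^ 0 * (\<Prod>k=K..M. 1 / (1 - 2 * real k powr (-2 * s)))" by simp
  qed
  finally show ?case .
next
  case (Suc n)
  define u where "u k = real k powr (-2 * s)" for k
  define P where "P K = (\<Prod>k=K..M. 1 / (1 - 2 * u k))" for K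
  have u: "0 \<le> u k" "2 * u k \<le> 1 / 2" if "K \<le> k" for k
    using K0(2)[of k] that Suc.prems by (auto simp: u_def)
  have P0: "0 \<le> P k" if "K \<le> k" for k
    unfolding P_def
  proof (rule prod_nonneg)
    fix j assume "j \<in> {k..M}"
    thus "0 \<le> 1 / (1 - 2 * u j)" using u(2)[of j] that by simp
  qed
  \<comment> \<open>With this identity the sum over the first partial quotient telescopes.\<close>
  have tele: "2 * u k * P k = P k - P (k + 1)" if "k \<in> {K..M}" for k
  proof -
    have "P k = 1 / (1 - 2 * u k) * P (k + 1)"
      using that by (simp add: P_def prod.atLeast_Suc_atMost)
    hence "P (k + 1) = (1 - 2 * u k) * P k" using u(2)[of k] that by simp
    thus ?thesis by (simp add: algebra_simps)
  qed
  let ?F = "\<lambda>k. if k \<le> M then monotone_bounded_prefix M n k else {}"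
  have "hausdorff_premeasure 1 s (monotone_bounded_prefix M (Suc n) K) \<le>
      (\<Sum>i. ennreal (real (K + i) powr (-2 * s)) * hausdorff_premeasure 1 s (?F (K + i)))"
    using s K0 Suc.prems monotone_bounded_prefix_step
    by (intro hausdorff_premeasure_branches_le) auto
  also have "\<dots> = (\<Sum>i\<in>{..<Suc M - K}. ennreal (u (K + i)) * hausdorff_premeasure 1 s (?F (K + i)))"
    unfolding u_def by (rule suminf_finite) auto
  also have "\<dots> = (\<Sum>k\<in>{K..M}. ennreal (u k) * hausdorff_premeasure 1 s (?F k))"
    by (rule sum.reindex_bij_witness[of _ "\<lambda>k. k - K" "\<lambda>i. K + i"]) auto
  also have "\<dots> \<le> (\<Sum>k\<in>{K..M}. ennreal (u k) * ennreal ((1 / 2) ^ n * P k))"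
    using Suc.IH Suc.prems by (intro sum_mono mult_left_mono) (auto simp: P_def u_def)
  also have "\<dots> = (\<Sum>k\<in>{K..M}. ennreal (u k * ((1 / 2) ^ n * P k)))"
    using u P0 by (intro sum.cong refl ennreal_mult[symmetric]) auto
  also have "\<dots> = ennreal (\<Sum>k\<in>{K..M}. u k * ((1 / 2) ^ n * P k))"
    using u P0 by (intro sum_ennreal) auto
  also have "(\<Sum>k\<in>{K..M}. u k * ((1 / 2) ^ n * P k)) = (1 / 2) ^ Suc n * (\<Sum>k\<in>{K..M}. 2 * u k * P k)"
    by (simp add: sum_distrib_left mult_ac)
  also have "(\<Sum>k\<in>{K..M}. 2 * u k * P k) = (\<Sum>k\<in>{K..M}. P k - P (k + 1))"
    using tele by (rule sum.cong[OF refl])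
  also have "\<dots> = (if K \<le> M then P K - P (M + 1) else 0)" by (rule sum_natinterval_diff)
  also have "ennreal ((1 / 2) ^ Suc n * \<dots>) \<le> ennreal ((1 / 2) ^ Suc n * P K)"
    using P0[of K] P0[of "M + 1"] by (intro ennreal_leI mult_left_mono) auto
  finally show ?case by (simp add: P_def u_def)
qed

lemma sum_powr_le:
  fixes p :: real
  assumes p: "0 < p" "p \<le> 1"
  shows "(\<Sum>k=1..M. real k powr (p - 1)) \<le> real M powr p / p"
proof (induction M)
  case (Suc M)
  have "real (Suc M) powr (p - 1) \<le> (real (Suc M) powr p - real M powr p) / p"
  proof (cases "M = 0")
    case False
    have "\<exists>z. real M < z \<and> z < real (Suc M) \<and>
        real (Suc M) powr p - real M powr p = (real (Suc M) - real M) * (p * z powr (p - 1))"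
      using False by (intro MVT2) (auto intro!: derivative_eq_intros)
    then obtain z where z: "real M < z" "z < real (Suc M)"
        "real (Suc M) powr p - real M powr p = p * z powr (p - 1)" by auto
    have "real (Suc M) powr (p - 1) \<le> z powr (p - 1)"
      using z p False by (intro powr_mono2') auto
    thus ?thesis using z(3) p by simp
  qed (use p in simp)
  thus ?case using Suc.IH by (simp add: diff_divide_distrib)
qed simp

lemma inverse_one_minus_le_exp:
  fixes v :: real
  assumes "0 \<le> v" "v \<le> 1 / 2"
  shows "1 / (1 - v) \<le> exp (2 * v)"
proof -
  have "1 \<le> (1 - v) * (1 + 2 * v)" 
  proof -
    have "(1 - v) * (1 + 2 * v) = 1 + v * (1 - 2 * v)" by (simp add: algebra_simps)
    thus ?thesis using assms by simp
  qed
  hence "1 / (1 - v) \<le> 1 + 2 * v" using assms by (simp add: divide_simps mult.commute)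
  also have "\<dots> \<le> exp (2 * v)" by (rule exp_ge_add_one_self)
  finally show ?thesis .
qed

lemma premeasure_monotone_bounded_prefix_le_exp:
  assumes s: "0 < s" "s < 1 / 2"
    and K0: "1 \<le> K" "\<And>k. K \<le> k \<Longrightarrow> 2 * real k powr (-2 * s) \<le> 1 / 2"
  shows "hausdorff_premeasure 1 s (monotone_bounded_prefix M n K) \<le>
    ennreal ((1 / 2) ^ n * exp (4 / (1 - 2 * s) * real M powr (1 - 2 * s)))"
proof -
  have "(\<Prod>k=K..M. 1 / (1 - 2 * real k powr (-2 * s))) \<le> (\<Prod>k=K..M. exp (2 * (2 * real k powr (-2 * s))))"
  proof (rule prod_mono)
    fix k assume "k \<in> {K..M}"
    hence "2 * real k powr (-2 * s) \<le> 1 / 2" using K0(2) by simp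
    thus "0 \<le> 1 / (1 - 2 * real k powr (-2 * s)) \<and> 1 / (1 - 2 * real k powr (-2 * s)) \<le>
        exp (2 * (2 * real k powr (-2 * s)))"
      using inverse_one_minus_le_exp[of "2 * real k powr (-2 * s)"] by simp
  qed
  also have "\<dots> = exp (4 * (\<Sum>k=K..M. real k powr (-2 * s)))"
    by (simp add: exp_sum sum_distrib_left)
  also have "\<dots> \<le> exp (4 * (real M powr (1 - 2 * s) / (1 - 2 * s)))"
  proof -
    have "(\<Sum>k=K..M. real k powr (-2 * s)) \<le> (\<Sum>k=1..M. real k powr ((1 - 2 * s) - 1))"
      using K0(1) by (simp add: sum_mono2)
    also have "\<dots> \<le> real M powr (1 - 2 * s) / (1 - 2 * s)" using s by (intro sum_powr_le) auto
    finally show ?thesis by simp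
  qed
  finally have "(1 / 2) ^ n * (\<Prod>k=K..M. 1 / (1 - 2 * real k powr (-2 * s))) \<le>
      (1 / 2) ^ n * exp (4 / (1 - 2 * s) * real M powr (1 - 2 * s))" by simp
  with premeasure_monotone_bounded_prefix_le[OF s(1) K0 order_refl] show ?thesis
    by (rule order_trans[OF _ ennreal_leI])
qed

lemma half_power_exp_tendsto_0:
  fixes c q :: real
  assumes q: "0 < q" "q < 1" and c: "0 < c"
  shows "(\<lambda>n. (1 / 2) ^ n * exp (c * real n powr q)) \<longlonglongrightarrow> 0"
proof -
  have "(\<lambda>n::nat. exp (c * real n powr q - ln 2 * real n)) \<longlonglongrightarrow> 0"
    using q c by real_asymp
  also have "(\<lambda>n::nat. exp (c * real n powr q - ln 2 * real n)) = (\<lambda>n. (1 / 2) ^ n * exp (c * real n powr q))"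
  proof
    fix n :: nat
    have "exp (ln 2 * real n) = (2::real) ^ n" by (metis exp_ln exp_of_nat2_mult zero_less_numeral)
    thus "exp (c * real n powr q - ln 2 * real n) = (1 / 2) ^ n * exp (c * real n powr q)"
      by (simp add: exp_diff power_divide field_simps)
  qed
  finally show ?thesis .
qed

lemma ennreal_eq_0_by_limit:
  fixes z :: ennreal
  assumes "\<And>n. z \<le> ennreal (f n)" "f \<longlonglongrightarrow> 0"
  shows "z = 0"
proof -
  have "(\<lambda>n. ennreal (f n)) \<longlonglongrightarrow> ennreal 0" using assms(2) by (rule tendsto_ennrealI)
  hence "z \<le> ennreal 0" by (rule LIMSEQ_le_const) (use assms(1) in auto)
  thus ?thesis by simp
qed

text \<open>
  With \<open>M\<close> of order \<open>n powr \<beta>\<close>, the product over \<open>k \<le>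
  M\<close> in the bound above is at most the exponential of a multiple of \<open>n powr (\<beta> * (1
  - 2 * s))\<close>. The exponent is sublinear, so \<open>(1 / 2) ^ n\<close> wins. Divergence of the
  partial quotients serves to get beyond the threshold \<open>K\<close> after finitely many Gauss
  steps.
\<close>

lemma premeasure_polynomial_growth_null:
  assumes s: "0 < s" "s < 1 / 2" and \<beta>: "0 < \<beta>" "\<beta> * (1 - 2 * s) < 1"
  shows "hausdorff_premeasure 1 s {x \<in> irrational_unit.
    (\<forall>i\<ge>1. partial_quotient x i \<le> partial_quotient x (i + 1)) \<and>
    filterlim (partial_quotient x) at_top sequentially \<and>
    (\<forall>\<^sub>F n in sequentially. real (partial_quotient x n) \<le> real n powr \<beta>)} = 0"
    (is "hausdorff_premeasure 1 s ?E = 0")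
proof -
  have "(\<lambda>k::nat. 2 * real k powr (-2 * s)) \<longlonglongrightarrow> 0" using s by real_asymp
  hence "\<forall>\<^sub>F k in sequentially. 2 * real k powr (-2 * s) < 1 / 2" by (rule order_tendstoD) simp
  then obtain K' where K': "\<And>k. K' \<le> k \<Longrightarrow> 2 * real k powr (-2 * s) < 1 / 2"
    unfolding eventually_sequentially by blast
  define K where "K = max 1 K'"
  have K: "1 \<le> K" "\<And>k. K \<le> k \<Longrightarrow> 2 * real k powr (-2 * s) \<le> 1 / 2"
    using K' by (auto simp: K_def intro: less_imp_le)
  \<comment> \<open>After dropping \<open>m\<close> partial quotients the bound \<open>(i + m) powr \<beta>\<close> on the \<open>i\<close>-th one is only a
    multiple of \<open>i powr \<beta>\<close>, whence the constant in \<open>R\<close>.\<close>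
  define R where "R C = {x \<in> irrational_unit.
     (\<forall>i\<ge>1. K \<le> partial_quotient x i \<and> partial_quotient x i \<le> partial_quotient x (i + 1)) \<and>
     (\<forall>i\<ge>1. real (partial_quotient x i) \<le> real (Suc C) * real i powr \<beta>)}" for C
  have R_null: "hausdorff_premeasure 1 s (R C) = 0" for C
  proof (rule ennreal_eq_0_by_limit)
    define p where "p = 1 - 2 * s"
    have p: "0 < p" "p \<le> 1" using s by (auto simp: p_def)
    let ?c = "4 / p * real (Suc C) powr p"
    show "(\<lambda>n. (1 / 2) ^ n * exp (?c * real n powr (\<beta> * p))) \<longlonglongrightarrow> 0"
      using \<beta> p by (intro half_power_exp_tendsto_0) (auto simp: p_def)
    fix n
    define M where "M = nat \<lfloor>real (Suc C) * real n powr \<beta>\<rfloor>"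
    have "R C \<subseteq> monotone_bounded_prefix M n K"
    proof
      fix x assume x: "x \<in> R C"
      have "partial_quotient x i \<le> M" if "i \<in> {1..n}" for i
      proof -
        have "real (partial_quotient x i) \<le> real (Suc C) * real i powr \<beta>" using x that by (simp add: R_def)
        also have "\<dots> \<le> real (Suc C) * real n powr \<beta>"
          using that \<beta> by (intro mult_left_mono powr_mono2) auto
        finally show ?thesis unfolding M_def by (simp only: le_nat_floor)
      qed
      thus "x \<in> monotone_bounded_prefix M n K" using x by (simp add: R_def monotone_bounded_prefix_def)
    qed
    hence "hausdorff_premeasure 1 s (R C) \<le> hausdorff_premeasure 1 s (monotone_bounded_prefix M n K)"
      by (rule hausdorff_premeasure_mono)
    also have "\<dots> \<le> ennreal ((1 / 2) ^ n * exp (4 / p * real M powr p))"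
      using premeasure_monotone_bounded_prefix_le_exp[OF s K] by (simp add: p_def)
    also have "\<dots> \<le> ennreal ((1 / 2) ^ n * exp (?c * real n powr (\<beta> * p)))"
    proof -
      have "real M \<le> real (Suc C) * real n powr \<beta>" by (simp add: M_def)
      hence "real M powr p \<le> (real (Suc C) * real n powr \<beta>) powr p"
        using p by (intro powr_mono2) auto
      also have "\<dots> = real (Suc C) powr p * real n powr (\<beta> * p)"
        by (subst powr_mult) (auto simp: powr_powr)
      finally have "4 / p * real M powr p \<le> 4 / p * (real (Suc C) powr p * real n powr (\<beta> * p))"
        using p by (intro mult_left_mono) auto
      thus ?thesis by (intro ennreal_leI mult_left_mono) (simp_all add: mult.assoc)
    qed
    finally show "hausdorff_premeasure 1 s (R C) \<le> ennreal ((1 / 2) ^ n * exp (?c * real n powr (\<beta> * p)))" .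
  qed
  have "?E \<subseteq> (\<Union>m. {x \<in> irrational_unit. (gauss_map ^^ m) x \<in> (\<Union>C. R C)})"
  proof
    fix x assume x: "x \<in> ?E"
    have "\<forall>\<^sub>F n in sequentially. K \<le> partial_quotient x n"
      using x by (simp add: filterlim_at_top)
    moreover have "\<forall>\<^sub>F n in sequentially. real (partial_quotient x n) \<le> real n powr \<beta>" using x by simp
    ultimately obtain m where m: "\<And>n. m \<le> n \<Longrightarrow> K \<le> partial_quotient x n"
        "\<And>n. m \<le> n \<Longrightarrow> real (partial_quotient x n) \<le> real n powr \<beta>"
      unfolding eventually_sequentially by (metis nle_le order_trans)
    define C where "C = nat \<lceil>(1 + real m) powr \<beta>\<rceil>"
    have "(gauss_map ^^ m) x \<in> R C"
      unfolding R_def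
    proof (intro CollectI conjI allI impI)
      show "(gauss_map ^^ m) x \<in> irrational_unit"
        using x by (intro funpow_gauss_map_irrational_unit) simp
      fix i :: nat assume i: "1 \<le> i"
      show "K \<le> partial_quotient ((gauss_map ^^ m) x) i" using i m(1) by (simp add: partial_quotient_funpow)
      show "partial_quotient ((gauss_map ^^ m) x) i \<le> partial_quotient ((gauss_map ^^ m) x) (i + 1)"
        using i x by (simp add: partial_quotient_funpow)
      have "real (i + m) \<le> (1 + real m) * real i"
      proof -
        have "real m * 1 \<le> real m * real i" using i by (intro mult_left_mono) auto
        thus ?thesis by (simp add: algebra_simps)
      qed
      hence "real (i + m) powr \<beta> \<le> ((1 + real m) * real i) powr \<beta>" using \<beta> by (intro powr_mono2) auto
      also have "\<dots> = (1 + real m) powr \<beta> * real i powr \<beta>" by (rule powr_mult)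
      also have "\<dots> \<le> real (Suc C) * real i powr \<beta>"
        unfolding C_def by (intro mult_right_mono powr_ge_zero) linarith
      finally show "real (partial_quotient ((gauss_map ^^ m) x) i) \<le> real (Suc C) * real i powr \<beta>"
        using m(2)[of "i + m"] i by (simp add: partial_quotient_funpow)
    qed
    thus "x \<in> (\<Union>m. {x \<in> irrational_unit. (gauss_map ^^ m) x \<in> (\<Union>C. R C)})" using x by blast
  qed
  thus ?thesis
    by (rule hausdorff_premeasure_null_subset)
       (intro hausdorff_premeasure_UN_null hausdorff_premeasure_gauss_vimage_null s R_null)
qed

section \<open>Expansions with a large partial quotient infinitely often\<close>

text \<open>
  The factor \<open>q\<close> stands for the product of the partial quotients that have already been
  split off; it makes the family of sets stable under the Gauss map.
\<close>

definition large_quotient_after :: "nat \<Rightarrow> real \<Rightarrow> nat \<Rightarrow> real \<Rightarrow> real set" where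
  "large_quotient_after K b k q = {x \<in> irrational_unit. (\<forall>i\<ge>1. K \<le> partial_quotient x i) \<and>
     (q * (\<Prod>i=1..k. real (partial_quotient x i))) powr (b - 1) \<le> real (partial_quotient x (k + 1))}"

lemma prod_partial_quotient_Suc:
  "(\<Prod>i=1..Suc k. real (partial_quotient x i)) =
     real (partial_quotient x 1) * (\<Prod>i=1..k. real (partial_quotient (gauss_map x) i))"
proof -
  have "(\<Prod>i=1..Suc k. real (partial_quotient x i)) =
      real (partial_quotient x 1) * (\<Prod>i=Suc 1..Suc k. real (partial_quotient x i))"
    by (rule prod.atLeast_Suc_atMost) simp
  also have "(\<Prod>i=Suc 1..Suc k. real (partial_quotient x i)) = (\<Prod>i=1..k. real (partial_quotient x (Suc i)))"
    by (rule prod.shift_bounds_cl_Suc_ivl)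
  also have "\<dots> = (\<Prod>i=1..k. real (partial_quotient (gauss_map x) i))"
    by (intro prod.cong refl) (simp add: partial_quotient_Suc)
  finally show ?thesis .
qed

lemma large_quotient_after_step:
  assumes "x \<in> large_quotient_after K b (Suc k) q"
  shows "x \<in> irrational_unit \<and> K \<le> partial_quotient x 1 \<and>
    gauss_map x \<in> large_quotient_after K b k (q * real (partial_quotient x 1))"
  using assms unfolding large_quotient_after_def prod_partial_quotient_Suc
  by (auto simp: gauss_map_irrational_unit partial_quotient_gauss_map mult.assoc)

text \<open>
  If the first \<open>k\<close> partial quotients have product \<open>Q\<close> and the next one is at
  least \<open>Q powr (b - 1)\<close>, then the point lies in an interval of length at most \<open>Q
  powr (-2) * Q powr (-(b - 1))\<close>, that is, \<open>Q powr (-(b + 1))\<close>. The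
  \<open>s\<close>-th powers of these lengths sum to the \<open>k\<close>-th power of the sum of
  \<open>a powr (-(b + 1) * s)\<close> over \<open>a \<ge> K\<close>, and that sum is assumed to be at
  most \<open>1 / 2\<close>.
\<close>

lemma premeasure_large_quotient_after_le:
  assumes s: "0 < s" and b: "1 \<le> b" and K: "1 \<le> K"
    and sum: "(\<Sum>i. ennreal (real (K + i) powr (-(b + 1) * s))) \<le> ennreal (1 / 2)" and q: "1 \<le> q"
  shows "hausdorff_premeasure 1 s (large_quotient_after K b k q) \<le>
     ennreal (q powr (-(b - 1) * s) * (1 / 2) ^ k)"
  using q
proof (induction k arbitrary: q)
  case 0
  define d where "d = q powr (-(b - 1))"
  have d: "d \<le> 1" using 0 b powr_mono[of "-(b - 1)" 0 q] by (simp add: d_def)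
  have sub: "large_quotient_after K b 0 q \<subseteq> {0..d}"
  proof
    fix x assume "x \<in> large_quotient_after K b 0 q"
    hence x: "x \<in> irrational_unit" "q powr (b - 1) \<le> real (partial_quotient x 1)"
      by (auto simp: large_quotient_after_def)
    have "0 \<le> gauss_map x" using gauss_map_irrational_unit[OF x(1)] by (simp add: irrational_unit_def)
    hence "1 / (real (partial_quotient x 1) + gauss_map x) \<le> 1 / q powr (b - 1)"
      using x(2) 0 by (intro divide_left_mono mult_pos_pos) (auto intro: less_le_trans[of 0 "q powr (b-1)"])
    hence "x \<le> d" using irrational_unit_step[OF x(1)] 
      by (simp only: d_def powr_minus divide_inverse mult_1_left)
    thus "x \<in> {0..d}" using x(1) by (simp add: irrational_unit_def)
  qed
  have "hausdorff_premeasure 1 s (large_quotient_after K b 0 q) \<le> ennreal (d powr s)"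
  proof (rule hausdorff_premeasure_le_diameter)
    show "bounded (large_quotient_after K b 0 q)" by (rule bounded_subset[OF _ sub]) simp
    have "diameter (large_quotient_after K b 0 q) \<le> diameter {0..d}"
      using sub by (intro diameter_subset) auto
    thus "diameter (large_quotient_after K b 0 q) \<le> d" by (simp add: d_def)
  qed (use s d in auto)
  thus ?case by (simp add: d_def powr_powr)
next
  case (Suc k)
  let ?h = "q powr (-(b - 1) * s) * (1 / 2) ^ k"
  have "hausdorff_premeasure 1 s (large_quotient_after K b (Suc k) q) \<le>
    (\<Sum>i. ennreal (real (K + i) powr (-2 * s)) *
         hausdorff_premeasure 1 s (large_quotient_after K b k (q * real (K + i))))"
    using s K large_quotient_after_step
    by (intro hausdorff_premeasure_branches_le[where F = "\<lambda>a. large_quotient_after K b k (q * real a)"]) auto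
  also have "\<dots> \<le> (\<Sum>i. ennreal ?h * ennreal (real (K + i) powr (-(b + 1) * s)))"
  proof (rule suminf_le)
    fix i
    have a: "1 \<le> real (K + i)" using K by simp
    hence "1 * 1 \<le> q * real (K + i)" using Suc.prems by (intro mult_mono) auto
    hence "hausdorff_premeasure 1 s (large_quotient_after K b k (q * real (K + i))) \<le>
        ennreal ((q * real (K + i)) powr (-(b - 1) * s) * (1 / 2) ^ k)" by (intro Suc.IH) simp
    hence "ennreal (real (K + i) powr (-2 * s)) *
         hausdorff_premeasure 1 s (large_quotient_after K b k (q * real (K + i))) \<le>
       ennreal (real (K + i) powr (-2 * s)) * ennreal ((q * real (K + i)) powr (-(b - 1) * s) * (1 / 2) ^ k)"
      by (rule mult_left_mono) simp
    also have "\<dots> = ennreal (real (K + i) powr (-2 * s) * ((q * real (K + i)) powr (-(b - 1) * s) * (1 / 2) ^ k))"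
      by (rule ennreal_mult[symmetric]) auto
    also have "real (K + i) powr (-2 * s) * ((q * real (K + i)) powr (-(b - 1) * s) * (1 / 2) ^ k) =
        ?h * (real (K + i) powr (-2 * s) * real (K + i) powr (-(b - 1) * s))"
      using a Suc.prems by (subst powr_mult) auto
    also have "real (K + i) powr (-2 * s) * real (K + i) powr (-(b - 1) * s) = real (K + i) powr (-(b + 1) * s)"
      unfolding powr_add[symmetric] by (simp add: algebra_simps)
    also have "ennreal (?h * real (K + i) powr (-(b + 1) * s)) = ennreal ?h * ennreal (real (K + i) powr (-(b + 1) * s))"
      by (rule ennreal_mult) auto
    finally show "ennreal (real (K + i) powr (-2 * s)) *
         hausdorff_premeasure 1 s (large_quotient_after K b k (q * real (K + i))) \<le>
       ennreal ?h * ennreal (real (K + i) powr (-(b + 1) * s))" .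
  qed auto
  also have "\<dots> = ennreal ?h * (\<Sum>i. ennreal (real (K + i) powr (-(b + 1) * s)))" by simp
  also have "\<dots> \<le> ennreal ?h * ennreal (1 / 2)" using sum by (rule mult_left_mono) simp
  also have "\<dots> = ennreal (?h * (1 / 2))" by (rule ennreal_mult[symmetric]) auto
  finally show ?case by (simp add: mult_ac)
qed

text \<open>
  A Borel-Cantelli argument: the bounds of the preceding lemma are summable over \<open>k\<close>, and
  \<open>s\<close> above \<open>1 / (b + 1)\<close> makes the series of \<open>a powr (-(b + 1) *
  s)\<close> converge, so that its tail is small beyond some \<open>K\<close>. For \<open>b =
  1\<close> the largeness condition is void, and the statement says that the numbers whose partial
  quotients tend to infinity have dimension at most \<open>1 / 2\<close>.
\<close>

lemma premeasure_large_quotient_infinitely_often_null: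
  assumes b: "1 \<le> b" and s: "1 / (b + 1) < s"
  shows "hausdorff_premeasure 1 s {x \<in> irrational_unit.
     filterlim (partial_quotient x) at_top sequentially \<and>
     (\<exists>\<^sub>F k in sequentially.
        (\<Prod>i=1..k. real (partial_quotient x i)) powr (b - 1) \<le> real (partial_quotient x (k + 1)))} = 0"
    (is "hausdorff_premeasure 1 s ?E = 0")
proof -
  have "0 < 1 / (b + 1)" using b by simp
  hence s0: "0 < s" using s by linarith
  have p: "1 < (b + 1) * s" using s b by (simp add: divide_simps mult.commute)
  let ?f = "\<lambda>i. real i powr (-(b + 1) * s)"
  have "summable ?f" using p by (subst summable_real_powr_iff) (simp add: algebra_simps)
  then obtain N where N: "\<And>n. N \<le> n \<Longrightarrow> norm (\<Sum>i. ?f (i + n)) < 1 / 2"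
    using suminf_exist_split[of "1 / 2" ?f] by auto
  define K where "K = max 1 N"
  have K: "1 \<le> K" by (simp add: K_def)
  have sum: "(\<Sum>i. ennreal (real (K + i) powr (-(b + 1) * s))) \<le> ennreal (1 / 2)"
  proof -
    have "summable (\<lambda>i. ?f (i + K))" using \<open>summable ?f\<close> by (rule summable_ignore_initial_segment)
    hence "(\<Sum>i. ennreal (?f (i + K))) = ennreal (\<Sum>i. ?f (i + K))"
      by (intro suminf_ennreal2) auto
    also have "\<dots> \<le> ennreal (1 / 2)" using N[of K] by (intro ennreal_leI) (simp add: K_def)
    finally show ?thesis by (simp add: add.commute)
  qed
  define R where "R = {x \<in> irrational_unit. (\<forall>i\<ge>1. K \<le> partial_quotient x i) \<and>
     (\<exists>\<^sub>F k in sequentially.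
        (\<Prod>i=1..k. real (partial_quotient x i)) powr (b - 1) \<le> real (partial_quotient x (k + 1)))}"
  have R_null: "hausdorff_premeasure 1 s R = 0"
  proof (rule ennreal_eq_0_by_limit)
    show "(\<lambda>n. 2 * (1 / 2) ^ n :: real) \<longlonglongrightarrow> 0"
      by (intro tendsto_mult_right_zero LIMSEQ_realpow_zero) auto
    fix n
    have "R \<subseteq> (\<Union>k. large_quotient_after K b (n + k) 1)"
    proof
      fix x assume x: "x \<in> R"
      then obtain j where "n \<le> j" 
        "(\<Prod>i=1..j. real (partial_quotient x i)) powr (b - 1) \<le> real (partial_quotient x (j + 1))"
        unfolding R_def frequently_sequentially by blast
      hence "x \<in> large_quotient_after K b (n + (j - n)) 1" using x by (simp add: R_def large_quotient_after_def)
      thus "x \<in> (\<Union>k. large_quotient_after K b (n + k) 1)" by blast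
    qed
    hence "hausdorff_premeasure 1 s R \<le> hausdorff_premeasure 1 s (\<Union>k. large_quotient_after K b (n + k) 1)"
      by (rule hausdorff_premeasure_mono)
    also have "\<dots> \<le> (\<Sum>k. hausdorff_premeasure 1 s (large_quotient_after K b (n + k) 1))"
      by (rule hausdorff_premeasure_UN_le)
    also have "\<dots> \<le> (\<Sum>k. ennreal ((1 / 2) ^ (n + k)))"
      using premeasure_large_quotient_after_le[OF s0 b K sum order_refl] by (intro suminf_le) auto
    also have "\<dots> = ennreal (2 * (1 / 2) ^ n)"
    proof (rule suminf_ennreal_eq)
      have "(\<lambda>k. (1 / 2) ^ n * (1 / 2) ^ k :: real) sums ((1 / 2) ^ n * (1 / (1 - 1 / 2)))"
        by (intro sums_mult geometric_sums) simp
      thus "(\<lambda>k. (1 / 2) ^ (n + k) :: real) sums (2 * (1 / 2) ^ n)" by (simp add: power_add mult.commute)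
    qed simp
    finally show "hausdorff_premeasure 1 s R \<le> ennreal (2 * (1 / 2) ^ n)" .
  qed
  have "?E \<subseteq> (\<Union>m. {x \<in> irrational_unit. (gauss_map ^^ m) x \<in> R})"
  proof
    fix x assume x: "x \<in> ?E"
    have "\<forall>\<^sub>F n in sequentially. K \<le> partial_quotient x n"
      using x by (simp add: filterlim_at_top)
    then obtain m where m: "\<And>n. m \<le> n \<Longrightarrow> K \<le> partial_quotient x n"
      unfolding eventually_sequentially by blast
    have pq: "1 \<le> partial_quotient x i" if "1 \<le> i" for i using x that by (intro partial_quotient_ge_1) auto
    have "(gauss_map ^^ m) x \<in> R"
      unfolding R_def frequently_sequentially
    proof (intro CollectI conjI allI impI)
      show "(gauss_map ^^ m) x \<in> irrational_unit"
        using x by (intro funpow_gauss_map_irrational_unit) simp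
      show "K \<le> partial_quotient ((gauss_map ^^ m) x) i" if "1 \<le> i" for i
        using that m by (simp add: partial_quotient_funpow)
      fix n
      obtain j where j: "n + m \<le> j" 
        "(\<Prod>i=1..j. real (partial_quotient x i)) powr (b - 1) \<le> real (partial_quotient x (j + 1))"
        using x unfolding frequently_sequentially by blast
      \<comment> \<open>Dropping partial quotients only decreases the product, so the condition survives the shift.\<close>
      have "(\<Prod>i=1..j - m. real (partial_quotient ((gauss_map ^^ m) x) i)) =
          (\<Prod>i=1..j - m. real (partial_quotient x (i + m)))"
        by (intro prod.cong refl) (simp add: partial_quotient_funpow)
      also have "\<dots> = (\<Prod>i=1 + m..(j - m) + m. real (partial_quotient x i))"
        by (rule prod.shift_bounds_cl_nat_ivl[symmetric])
      also have "\<dots> \<le> (\<Prod>i=1..j. real (partial_quotient x i))"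
      proof (rule prod_mono2)
        fix i assume "i \<in> {1..j} - {1 + m..(j - m) + m}"
        thus "1 \<le> real (partial_quotient x i)" using pq[of i] by simp
      next
        show "0 \<le> real (partial_quotient x i)" for i by simp
      qed (use j in auto)
      finally have "(\<Prod>i=1..j - m. real (partial_quotient ((gauss_map ^^ m) x) i)) powr (b - 1)
          \<le> (\<Prod>i=1..j. real (partial_quotient x i)) powr (b - 1)"
        using b by (intro powr_mono2 prod_nonneg) auto
      also have "\<dots> \<le> real (partial_quotient ((gauss_map ^^ m) x) (j - m + 1))"
        using j by (simp add: partial_quotient_funpow)
      finally show "\<exists>k\<ge>n. (\<Prod>i=1..k. real (partial_quotient ((gauss_map ^^ m) x) i)) powr (b - 1)
          \<le> real (partial_quotient ((gauss_map ^^ m) x) (k + 1))"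
        using j(1) by (intro exI[of _ "j - m"]) simp
    qed
    thus "x \<in> (\<Union>m. {x \<in> irrational_unit. (gauss_map ^^ m) x \<in> R})" using x by blast
  qed
  thus ?thesis
    by (rule hausdorff_premeasure_null_subset)
       (intro hausdorff_premeasure_UN_null hausdorff_premeasure_gauss_vimage_null s0 R_null)
qed

section \<open>Existence of numbers with prescribed partial quotients\<close>

lemma cf_convergent_Suc_diff:
  assumes "\<And>n. 1 \<le> n \<Longrightarrow> 2 \<le> a n"
  shows "\<bar>cf_convergent (Suc n) a - cf_convergent n a\<bar> \<le> (1 / 4) ^ n"
  using assms
proof (induction n arbitrary: a)
  case 0
  have "2 \<le> real (a 1)" using 0[of 1] by simp
  thus ?case by simp
next
  case (Suc n)
  let ?b = "\<lambda>k. a (Suc k)"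
  have a: "2 \<le> real (a 1)" using Suc.prems[of 1] by simp
  have b: "2 \<le> ?b k" if "1 \<le> k" for k using Suc.prems that by simp
  have nn: "0 \<le> cf_convergent k ?b" for k
    using cf_convergent_bounds[of ?b k] b by fastforce
  have "\<bar>cf_convergent (Suc (Suc n)) a - cf_convergent (Suc n) a\<bar> \<le>
      real (a 1) powr (-2) * \<bar>cf_convergent (Suc n) ?b - cf_convergent n ?b\<bar>"
    using inverse_branch_dist[OF _ nn nn, of "real (a 1)" "Suc n" n] a
    unfolding dist_real_def cf_convergent.simps(2)[of _ a] by simp
  also have "\<dots> \<le> 2 powr (-2) * (1 / 4) ^ n"
    using a by (intro mult_mono Suc.IH b powr_mono2') auto
  also have "\<dots> = (1 / 4) ^ Suc n" by (simp add: powr_minus)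
  finally show ?case .
qed

lemma convergent_cf_convergent:
  assumes "\<And>n. 1 \<le> n \<Longrightarrow> 2 \<le> a n"
  shows "convergent (\<lambda>n. cf_convergent n a)"
proof -
  have "summable (\<lambda>n. cf_convergent (Suc n) a - cf_convergent n a)"
    by (rule summable_comparison_test'[where g = "\<lambda>n. (1 / 4) ^ n" and N = 0])
       (use cf_convergent_Suc_diff[OF assms] in \<open>auto intro: summable_geometric simp del: cf_convergent.simps\<close>)
  thus ?thesis
    unfolding summable_iff_convergent sum_lessThan_telescope[of "\<lambda>n. cf_convergent n a"] by simp
qed

lemma lim_cf_convergent:
  assumes "\<And>n. 1 \<le> n \<Longrightarrow> 2 \<le> a n"
  shows "lim (\<lambda>n. cf_convergent n a) = 1 / (real (a 1) + lim (\<lambda>n. cf_convergent n (\<lambda>k. a (Suc k))))"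
    and "0 < lim (\<lambda>n. cf_convergent n a)" "lim (\<lambda>n. cf_convergent n a) < 1"
proof -
  let ?b = "\<lambda>k. a (Suc k)"
  have a: "2 \<le> real (a 1)" using assms[of 1] by simp
  have b: "2 \<le> ?b k" if "1 \<le> k" for k using assms that by simp
  have lim_b: "(\<lambda>n. cf_convergent n ?b) \<longlonglongrightarrow> lim (\<lambda>n. cf_convergent n ?b)"
    using convergent_cf_convergent[of ?b] b convergent_LIMSEQ_iff by blast
  have nn: "0 \<le> cf_convergent k ?b" for k
    using cf_convergent_bounds[of ?b k] b by fastforce
  have nn_b: "0 \<le> lim (\<lambda>n. cf_convergent n ?b)"
    using lim_b by (rule LIMSEQ_le_const) (use nn in auto)
  have "(\<lambda>n. cf_convergent (Suc n) a) \<longlonglongrightarrow> 1 / (real (a 1) + lim (\<lambda>n. cf_convergent n ?b))"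
    unfolding cf_convergent.simps(2) using a nn_b by (intro tendsto_intros lim_b) auto
  hence "(\<lambda>n. cf_convergent n a) \<longlonglongrightarrow> 1 / (real (a 1) + lim (\<lambda>n. cf_convergent n ?b))"
    by (rule LIMSEQ_imp_Suc)
  thus eq: "lim (\<lambda>n. cf_convergent n a) = 1 / (real (a 1) + lim (\<lambda>n. cf_convergent n ?b))"
    by (rule limI)
  show "0 < lim (\<lambda>n. cf_convergent n a)" "lim (\<lambda>n. cf_convergent n a) < 1"
    unfolding eq using a nn_b by simp_all
qed

text \<open>
  Infinite descent: one Gauss step turns \<open>p / q\<close> with \<open>0 < p < q\<close> into a
  fraction with denominator \<open>p\<close>, and the shifted sequence of partial quotients satisfies
  the same hypotheses.
\<close>

lemma lim_cf_convergent_irrational: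
  assumes "\<And>n. 1 \<le> n \<Longrightarrow> 2 \<le> a n"
  shows "lim (\<lambda>n. cf_convergent n a) \<notin> \<rat>"
proof -
  have "lim (\<lambda>n. cf_convergent n a) \<noteq> real_of_int p / real q" if "\<And>n. 1 \<le> n \<Longrightarrow> 2 \<le> a n" "0 < q" for p q a
    using that
  proof (induction q arbitrary: p a rule: less_induct)
    case (less q)
    let ?b = "\<lambda>k. a (Suc k)"
    show ?case
    proof
      assume eq: "lim (\<lambda>n. cf_convergent n a) = real_of_int p / real q"
      have lim: "lim (\<lambda>n. cf_convergent n a) = 1 / (real (a 1) + lim (\<lambda>n. cf_convergent n ?b))"
          "0 < lim (\<lambda>n. cf_convergent n a)" "lim (\<lambda>n. cf_convergent n a) < 1"
        using lim_cf_convergent[of a] less.prems(1) by blast+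
      have b: "2 \<le> ?b k" if "1 \<le> k" for k using less.prems(1) that by simp
      have "0 < real_of_int p / real q" using lim(2) eq by simp
      hence p: "0 < p" using less.prems(2) by (simp add: zero_less_divide_iff)
      have "real_of_int p / real q < 1" using lim(3) eq by simp
      hence pq: "nat p < q" using p less.prems(2) by (simp add: divide_simps)
      have "lim (\<lambda>n. cf_convergent n ?b) = 1 / lim (\<lambda>n. cf_convergent n a) - real (a 1)"
        unfolding lim(1) by simp
      also have "\<dots> = real q / real_of_int p - real (a 1)" unfolding eq by simp
      also have "\<dots> = real_of_int (int q - int (a 1) * p) / real (nat p)" using p by (simp add: field_simps)
      finally have "lim (\<lambda>n. cf_convergent n ?b) = real_of_int (int q - int (a 1) * p) / real (nat p)" .
      moreover have "lim (\<lambda>n. cf_convergent n ?b) \<noteq> real_of_int (int q - int (a 1) * p) / real (nat p)"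
        by (rule less.IH[OF pq b]) (use p in auto)
      ultimately show False by contradiction
    qed
  qed
  note ne = this
  show ?thesis
  proof
    assume "lim (\<lambda>n. cf_convergent n a) \<in> \<rat>"
    then obtain p q where "0 < q" "lim (\<lambda>n. cf_convergent n a) = real_of_int p / real_of_int q"
      by (rule Rats_cases')
    thus False using ne[of a "nat q" p] assms by simp
  qed
qed

text \<open>
  Requiring partial quotients of at least 2 makes all inverse branches contract by a factor 4, which
  gives the convergence at once; the constructions below use only such sequences.
\<close>

lemma exists_prescribed_partial_quotients:
  assumes "\<And>n. 1 \<le> n \<Longrightarrow> 2 \<le> a n"
  shows "\<exists>x\<in>irrational_unit. \<forall>n\<ge>1. partial_quotient x n = a n"
proof -
  define x where "x = lim (\<lambda>n. cf_convergent n a)"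
  have x: "x \<in> {0<..<1}" "x \<notin> \<rat>"
    using lim_cf_convergent(2,3)[OF assms] lim_cf_convergent_irrational[OF assms] by (auto simp: x_def)
  have "(\<lambda>n. cf_convergent n a) \<longlonglongrightarrow> x"
    using convergent_cf_convergent[OF assms] unfolding x_def convergent_LIMSEQ_iff .
  moreover have "1 \<le> a n" if "1 \<le> n" for n using assms[OF that] by simp
  ultimately have "is_cf_expansion a x" by (simp add: is_cf_expansion_def)
  hence "\<forall>n\<ge>1. partial_quotient x n = a n" using partial_quotient_unique[OF x] by metis
  thus ?thesis using x by (auto simp: irrational_unit_def)
qed

section \<open>Cantor sets of continued fractions\<close>

lemma gauss_map_le_half:
  assumes "x \<in> irrational_unit" "2 \<le> partial_quotient x 2"
  shows "0 < gauss_map x" "gauss_map x \<le> 1 / 2"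
proof -
  note g = gauss_map_irrational_unit[OF assms(1)]
  show "0 < gauss_map x" using g by (simp add: irrational_unit_def)
  have "0 < gauss_map (gauss_map x)" using gauss_map_irrational_unit[OF g] by (simp add: irrational_unit_def)
  moreover have "2 \<le> real (partial_quotient (gauss_map x) 1)"
    using assms(2) by (simp add: partial_quotient_gauss_map numeral_2_eq_2)
  ultimately have "1 / (real (partial_quotient (gauss_map x) 1) + gauss_map (gauss_map x)) \<le> 1 / 2"
    by (intro divide_left_mono) auto
  thus "gauss_map x \<le> 1 / 2" using irrational_unit_step[OF g] by simp
qed

lemma abs_diff_eq_mult_inverses:
  fixes A B :: real
  assumes "0 < A" "0 < B" "x = 1 / A" "y = 1 / B"
  shows "\<bar>B - A\<bar> = A * B * \<bar>x - y\<bar>"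
proof -
  have "A * B * (x - y) = B - A" using assms by (simp add: field_simps)
  moreover have "0 \<le> A * B" using assms by simp
  ultimately show ?thesis by (metis abs_mult abs_of_nonneg)
qed

text \<open>
  Two numbers whose partial quotients first differ at position \<open>n + 1\<close>, by
  \<open>j\<close> say, have \<open>n\<close>-th Gauss iterates whose reciprocals differ by at least
  \<open>j - 1 / 2\<close>, because the fractional parts are at most \<open>1 / 2\<close>. Each of the
  common \<open>n\<close> inverse branches and the final reciprocal shrinks this distance by a factor
  of at most \<open>(u i)\<^sup>2\<close>.
\<close>

lemma partial_quotient_separation:
  assumes "x \<in> irrational_unit" "y \<in> irrational_unit"
    and "\<And>i. 1 \<le> i \<Longrightarrow> 2 \<le> partial_quotient x i" "\<And>i. 1 \<le> i \<Longrightarrow> 2 \<le> partial_quotient y i"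
    and "\<And>i. 1 \<le> i \<Longrightarrow> partial_quotient x i + 1 \<le> u i" "\<And>i. 1 \<le> i \<Longrightarrow> partial_quotient y i + 1 \<le> u i"
    and "\<And>i. i \<in> {1..n} \<Longrightarrow> partial_quotient x i = partial_quotient y i"
    and "partial_quotient x (Suc n) \<noteq> partial_quotient y (Suc n)"
  shows "\<bar>real (partial_quotient x (Suc n)) - real (partial_quotient y (Suc n))\<bar>
     \<le> 2 * (\<Prod>i=1..Suc n. real (u i))\<^sup>2 * \<bar>x - y\<bar>"
  using assms
proof (induction n arbitrary: x y u)
  case 0
  let ?a = "real (partial_quotient x 1)" and ?c = "real (partial_quotient y 1)"
  let ?\<xi> = "gauss_map x" and ?\<eta> = "gauss_map y"
  have \<xi>: "0 < ?\<xi>" "?\<xi> \<le> 1 / 2" and \<eta>: "0 < ?\<eta>" "?\<eta> \<le> 1 / 2"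
    using gauss_map_le_half[of x] gauss_map_le_half[of y] 0(1-4) by auto
  have ac: "2 \<le> ?a" "2 \<le> ?c" "?a + 1 \<le> real (u 1)" "?c + 1 \<le> real (u 1)"
    using 0(3-6)[of 1] by linarith+
  have "partial_quotient x 1 \<noteq> partial_quotient y 1" using 0(8) by simp
  hence "1 \<le> \<bar>?a - ?c\<bar>" by linarith
  moreover have "\<bar>?a - ?c\<bar> - 1 / 2 \<le> \<bar>(?c + ?\<eta>) - (?a + ?\<xi>)\<bar>" using \<xi> \<eta> by linarith
  moreover have "A \<le> 2 * B" if "1 \<le> A" "A - 1 / 2 \<le> B" for A B :: real using that by linarith
  ultimately have "\<bar>?a - ?c\<bar> \<le> 2 * \<bar>(?c + ?\<eta>) - (?a + ?\<xi>)\<bar>" by blast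
  also have "\<bar>(?c + ?\<eta>) - (?a + ?\<xi>)\<bar> = (?a + ?\<xi>) * (?c + ?\<eta>) * \<bar>x - y\<bar>"
    using ac \<xi> \<eta> irrational_unit_step[OF 0(1)] irrational_unit_step[OF 0(2)]
    by (intro abs_diff_eq_mult_inverses) auto
  also have "(?a + ?\<xi>) * (?c + ?\<eta>) * \<bar>x - y\<bar> \<le> real (u 1) * real (u 1) * \<bar>x - y\<bar>"
    using ac \<xi> \<eta> by (intro mult_right_mono mult_mono) auto
  finally show ?case by (simp add: power2_eq_square mult.assoc)
next
  case (Suc n)
  let ?a = "real (partial_quotient x 1)"
  let ?\<xi> = "gauss_map x" and ?\<eta> = "gauss_map y"
  have \<xi>: "0 < ?\<xi>" "?\<xi> \<le> 1 / 2" and \<eta>: "0 < ?\<eta>" "?\<eta> \<le> 1 / 2"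
    using gauss_map_le_half[of x] gauss_map_le_half[of y] Suc(2-5) by auto
  have ac: "2 \<le> ?a" "?a + 1 \<le> real (u 1)"
    using Suc(4,6)[of 1] by linarith+
  have eq1: "partial_quotient y 1 = partial_quotient x 1" using Suc(8)[of 1] by simp
  have "\<bar>(?a + ?\<eta>) - (?a + ?\<xi>)\<bar> = (?a + ?\<xi>) * (?a + ?\<eta>) * \<bar>x - y\<bar>"
    using ac \<xi> \<eta> eq1 irrational_unit_step[OF Suc(2)] irrational_unit_step[OF Suc(3)]
    by (intro abs_diff_eq_mult_inverses) auto
  also have "\<dots> \<le> real (u 1) * real (u 1) * \<bar>x - y\<bar>"
    using ac \<xi> \<eta> by (intro mult_right_mono mult_mono) auto
  finally have le: "\<bar>?\<xi> - ?\<eta>\<bar> \<le> (real (u 1))\<^sup>2 * \<bar>x - y\<bar>" by (simp add: power2_eq_square abs_minus_commute)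
  have shift: "partial_quotient ?\<xi> i = partial_quotient x (Suc i)"
      "partial_quotient ?\<eta> i = partial_quotient y (Suc i)" if "1 \<le> i" for i
    using that by (simp_all add: partial_quotient_Suc)
  have "\<bar>real (partial_quotient ?\<xi> (Suc n)) - real (partial_quotient ?\<eta> (Suc n))\<bar>
     \<le> 2 * (\<Prod>i=1..Suc n. real (u (Suc i)))\<^sup>2 * \<bar>?\<xi> - ?\<eta>\<bar>"
    using Suc(2-9) by (intro Suc.IH) (simp_all add: gauss_map_irrational_unit shift)
  also have "\<dots> \<le> 2 * (\<Prod>i=1..Suc n. real (u (Suc i)))\<^sup>2 * ((real (u 1))\<^sup>2 * \<bar>x - y\<bar>)"
    by (intro mult_left_mono le) simp
  also have "\<dots> = 2 * (real (u 1) * (\<Prod>i=1..Suc n. real (u (Suc i))))\<^sup>2 * \<bar>x - y\<bar>"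
    by (simp only: power_mult_distrib mult_ac)
  also have "real (u 1) * (\<Prod>i=1..Suc n. real (u (Suc i))) = (\<Prod>i=1..Suc (Suc n). real (u i))"
    by (simp only: prod.atLeast_Suc_atMost[of 1 "Suc (Suc n)"] prod.shift_bounds_cl_Suc_ivl)
  finally show ?case by (simp add: shift del: prod.cl_ivl_Suc)
qed

lemma floor_mixed_radix:
  fixes t :: real and m :: "nat \<Rightarrow> nat"
  assumes "1 \<le> m (Suc n)"
  shows "\<lfloor>t * (\<Prod>i=1..n. real (m i))\<rfloor> = \<lfloor>t * (\<Prod>i=1..Suc n. real (m i))\<rfloor> div int (m (Suc n))"
proof -
  have "t * (\<Prod>i=1..n. real (m i)) = t * (\<Prod>i=1..Suc n. real (m i)) / real_of_int (int (m (Suc n)))"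
    using assms by simp
  thus ?thesis by (simp only: floor_divide_real_eq_div of_nat_0_le_iff)
qed

text \<open>
  Expand \<open>t\<close> in the unit interval in the mixed radix system with radices \<open>m 1, m 2,
  \<dots>\<close> and let \<open>h t\<close> be the number with partial quotients \<open>l n\<close>
  plus the \<open>n\<close>-th digit. If \<open>t\<close> and \<open>v\<close> first differ in the
  digit number \<open>n + 1\<close>, by \<open>j\<close>, then \<open>\<bar>t - v\<bar>\<close> is at
  most both \<open>1 / (m 1 * \<dots> * m n)\<close> and \<open>2 * j / (m 1 * \<dots> * m (n +
  1))\<close>, while \<open>h t\<close> and \<open>h v\<close> are separated by a multiple of \<open>j
  / (u 1 * \<dots> * u (n + 1))\<^sup>2\<close>. The hypothesis on sizes is what the geometric mean of
  the two upper bounds, with weights \<open>1 - s\<close> and \<open>s\<close>, needs for the Hoelder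
  estimate.
\<close>

theorem hausdorff_dim_digit_blocks_ge:
  fixes l m u :: "nat \<Rightarrow> nat" and s C :: real
  assumes l: "\<And>n. 1 \<le> n \<Longrightarrow> 2 \<le> l n" and m: "\<And>n. 1 \<le> n \<Longrightarrow> 1 \<le> m n"
    and u: "\<And>n. 1 \<le> n \<Longrightarrow> l n + m n \<le> u n" and mono: "\<And>n. 1 \<le> n \<Longrightarrow> l n + m n \<le> l (n + 1) + 1"
    and s: "0 < s" "s \<le> 1" and C: "0 < C"
    and size: "\<And>n. ((\<Prod>i=1..Suc n. real (u i))\<^sup>2 / real (m (Suc n))) powr s \<le> C * (\<Prod>i=1..n. real (m i))"
  shows "ereal s \<le> hausdorff_dim {x \<in> Lambda. \<forall>n\<ge>1. l n \<le> partial_quotient x n \<and> partial_quotient x n < l n + m n}"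
proof -
  define M where "M n = (\<Prod>i=1..n. real (m i))" for n
  define N where "N t n = \<lfloor>t * M n\<rfloor>" for t n
  \<comment> \<open>\<open>N t n\<close> collects the first \<open>n\<close> digits of \<open>t\<close> into one integer, and \<open>d t n\<close> is the last of them.\<close>
  define d where "d t n = nat (N t n mod int (m n))" for t n
  have M_pos: "1 \<le> M n" for n unfolding M_def using m by (intro prod_ge_1) auto
  have M_Suc: "M (Suc n) = M n * real (m (Suc n))" for n by (simp add: M_def)
  have N_div: "N t n = N t (Suc n) div int (m (Suc n))" for t n
    unfolding N_def M_def by (rule floor_mixed_radix) (use m[of "Suc n"] in simp)
  have d_less: "d t n < m n" if "1 \<le> n" for t n
    using m[OF that] by (simp add: d_def nat_less_iff)
  have "\<exists>x\<in>irrational_unit. \<forall>n\<ge>1. partial_quotient x n = l n + d t n" for t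
    using l by (intro exists_prescribed_partial_quotients) (simp add: trans_le_add1)
  then obtain h where h: "\<And>t. h t \<in> irrational_unit"
      "\<And>t n. 1 \<le> n \<Longrightarrow> partial_quotient (h t) n = l n + d t n" by metis
  \<comment> \<open>The hypothesis on sizes forces the radices to multiply up to infinity.\<close>
  have M_unbounded: "\<exists>n. r \<le> M n" for r
  proof -
    have "(3 powr s) ^ Suc n \<le> C * M n" for n
    proof -
      have u3: "3 \<le> real (u i)" if "1 \<le> i" for i using l[OF that] m[OF that] u[OF that] by linarith
      have "(3::real) ^ Suc n = (\<Prod>i=1..Suc n. 3)" by simp
      also have "\<dots> \<le> (\<Prod>i=1..Suc n. real (u i))" using u3 by (intro prod_mono) auto
      finally have U: "3 ^ Suc n \<le> (\<Prod>i=1..Suc n. real (u i))" (is "_ \<le> ?U") .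
      have mu: "real (m (Suc n)) \<le> ?U"
      proof -
        have "1 \<le> (\<Prod>i=1..n. real (u i))" using u3 by (intro prod_ge_1) force
        moreover have "real (m (Suc n)) \<le> real (u (Suc n))" using u[of "Suc n"] by simp
        ultimately have "1 * real (m (Suc n)) \<le> (\<Prod>i=1..n. real (u i)) * real (u (Suc n))"
          by (intro mult_mono) auto
        thus ?thesis by simp
      qed
      have "0 < ?U" using U by (rule less_le_trans[rotated]) simp
      hence "?U * real (m (Suc n)) \<le> ?U * ?U" using mu by (intro mult_left_mono) auto
      hence "?U \<le> ?U\<^sup>2 / real (m (Suc n))" using m[of "Suc n"] by (simp add: power2_eq_square pos_le_divide_eq)
      hence "(3 ^ Suc n) powr s \<le> (?U\<^sup>2 / real (m (Suc n))) powr s"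
        using U s by (intro powr_mono2) auto
      also have "\<dots> \<le> C * M n" using size by (simp add: M_def)
      also have "(3 ^ Suc n) powr s = (3 powr s) ^ Suc n"
        by (simp only: powr_power powr_realpow[symmetric] powr_powr mult.commute)
      finally show ?thesis .
    qed
    moreover have "1 < 3 powr s" using s powr_less_mono[of 0 s 3] by simp
    then obtain n where "C * r < (3 powr s) ^ n" using real_arch_pow by blast
    moreover have "(3 powr s) ^ n \<le> (3 powr s) ^ Suc n"
      using \<open>1 < 3 powr s\<close> by (intro power_increasing) auto
    ultimately have "C * r \<le> C * M n" by (smt (verit))
    thus ?thesis using C by auto
  qed
  show ?thesis
  proof (rule hausdorff_dim_ge[where h = h and C = "4 powr s * C"])
    show "0 < s" by fact
    show "0 < 4 powr s * C" using C by simp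
  next
    fix t :: real
    show "h t \<in> {x \<in> Lambda. \<forall>n\<ge>1. l n \<le> partial_quotient x n \<and> partial_quotient x n < l n + m n}"
    proof -
      have "l n + d t n \<le> l (n + 1) + d t (n + 1)" if "1 \<le> n" for n
        using d_less[OF that, of t] mono[OF that] by linarith
      thus ?thesis using h d_less by (auto simp: Lambda_def irrational_unit_def)
    qed
  next
    fix t v :: real
    assume t: "t \<in> {0..<1}" and v: "v \<in> {0..<1}"
    show "\<bar>t - v\<bar> \<le> 4 powr s * C * dist (h t) (h v) powr s"
    proof (cases "t = v")
      case False
      have "\<exists>n. N t n \<noteq> N v n"
      proof -
        obtain n where "1 / \<bar>t - v\<bar> \<le> M n" using M_unbounded by blast
        hence "1 \<le> \<bar>t * M n - v * M n\<bar>"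
          using False M_pos[of n] by (simp add: left_diff_distrib[symmetric] abs_mult divide_simps mult.commute)
        hence "N t n \<noteq> N v n" unfolding N_def by linarith
        thus ?thesis by blast
      qed
      define k where "k = (LEAST n. N t n \<noteq> N v n)"
      have k: "N t k \<noteq> N v k" unfolding k_def by (rule LeastI_ex) fact
      have less: "N t i = N v i" if "i < k" for i using that unfolding k_def by (blast dest: not_less_Least)
      have "N t 0 = N v 0" using t v floor_eq_iff[of t 0] floor_eq_iff[of v 0] by (simp add: N_def M_def)
      hence "k \<noteq> 0" using k by metis
      then obtain n where n: "k = Suc n" using not0_implies_Suc by blast
      define j where "j = \<bar>N t k - N v k\<bar>"
      have j: "1 \<le> j" using k by (simp add: j_def)
      have d_eq: "d t i = d v i" if "i < k" for i using less[OF that] by (simp add: d_def)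
      have d_k: "int (d t k) - int (d v k) = N t k - N v k"
      proof -
        have "N t k div int (m k) = N v k div int (m k)"
          using N_div[of t n] N_div[of v n] less[of n] n by simp
        moreover have "int (d w k) = N w k - N w k div int (m k) * int (m k)" for w
          using m[of k] n by (simp add: d_def minus_div_mult_eq_mod)
        ultimately show ?thesis by simp
      qed
      let ?\<delta> = "dist (h t) (h v)"
      let ?W = "(\<Prod>i=1..Suc n. real (u i))\<^sup>2"
      have pq: "2 \<le> partial_quotient (h w) i" "partial_quotient (h w) i + 1 \<le> u i" if "1 \<le> i" for w i
        using l[OF that] u[OF that] d_less[OF that, of w] h(2)[OF that] by simp_all
      have "\<bar>real (partial_quotient (h t) (Suc n)) - real (partial_quotient (h v) (Suc n))\<bar>
          \<le> 2 * ?W * \<bar>h t - h v\<bar>"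
      proof (rule partial_quotient_separation)
        show "partial_quotient (h t) i = partial_quotient (h v) i" if "i \<in> {1..n}" for i
          using that h(2) d_eq[of i] n by simp
        show "partial_quotient (h t) (Suc n) \<noteq> partial_quotient (h v) (Suc n)"
          using h(2)[of "Suc n"] d_k k n by auto
      qed (rule h pq; assumption)+
      also have "\<bar>real (partial_quotient (h t) (Suc n)) - real (partial_quotient (h v) (Suc n))\<bar> = real_of_int j"
        using h(2)[of "Suc n"] d_k n unfolding j_def by (simp flip: of_int_diff)
      finally have jW: "real_of_int j \<le> 2 * ?W * ?\<delta>" by (simp add: dist_real_def)
      have near: "\<bar>t - v\<bar> \<le> 1 / M n"
      proof -
        have "\<bar>t * M n - v * M n\<bar> \<le> 1" using less[of n] n unfolding N_def by linarith
        thus ?thesis using M_pos[of n] by (simp add: left_diff_distrib[symmetric] abs_mult divide_simps mult.commute)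
      qed
      have "\<bar>t * M k - v * M k\<bar> \<le> real_of_int j + 1" unfolding j_def N_def by linarith
      also have "\<dots> \<le> 2 * real_of_int j" using j by simp
      also have "\<dots> \<le> 4 * ?W * ?\<delta>" using jW by linarith
      finally have "\<bar>t - v\<bar> * (M n * real (m k)) \<le> 4 * ?W * ?\<delta>"
        using M_pos[of k] M_pos[of n] by (simp add: left_diff_distrib[symmetric] abs_mult M_Suc n)
      hence far: "\<bar>t - v\<bar> \<le> (4 * ?\<delta>) * (?W / real (m k)) * (1 / M n)"
        using M_pos[of n] m[of k] n by (simp add: field_simps)
      have pos: "0 < \<bar>t - v\<bar>" using False by simp
      \<comment> \<open>The first factor is bounded by \<open>near\<close> and the second by \<open>far\<close>.\<close>
      have "\<bar>t - v\<bar> = \<bar>t - v\<bar> powr (1 - s) * \<bar>t - v\<bar> powr s"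
        using pos by (simp flip: powr_add)
      also have "\<dots> \<le> (1 / M n) powr (1 - s) * ((4 * ?\<delta>) * (?W / real (m k)) * (1 / M n)) powr s"
        using near far s M_pos[of n] pos by (intro mult_mono powr_mono2) auto
      also have "((4 * ?\<delta>) * (?W / real (m k)) * (1 / M n)) powr s =
          (4 powr s * ?\<delta> powr s) * (?W / real (m k)) powr s * (1 / M n) powr s"
        by (simp only: powr_mult)
      also have "(1 / M n) powr (1 - s) * \<dots> =
          (4 powr s * ?\<delta> powr s) * (?W / real (m k)) powr s * ((1 / M n) powr (1 - s) * (1 / M n) powr s)"
        by (simp only: mult_ac)
      also have "(1 / M n) powr (1 - s) * (1 / M n) powr s = 1 / M n"
        using M_pos[of n] by (simp flip: powr_add)
      also have "(4 powr s * ?\<delta> powr s) * (?W / real (m k)) powr s * (1 / M n) \<le>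
          (4 powr s * ?\<delta> powr s) * (C * M n) * (1 / M n)"
        using size[of n] M_pos[of n] by (intro mult_right_mono mult_left_mono) (auto simp: M_def n)
      also have "\<dots> = 4 powr s * C * ?\<delta> powr s" using M_pos[of n] by simp
      finally show ?thesis .
    qed simp
  qed
qed

section \<open>Eventual and frequent inequalities\<close>

lemma eventually_le_imp_le_add_const:
  fixes f g :: "nat \<Rightarrow> real"
  assumes "\<forall>\<^sub>F n in sequentially. f n \<le> g n"
  shows "\<exists>K. \<forall>n. f n \<le> K + g n"
proof -
  obtain N where N: "\<And>n. N \<le> n \<Longrightarrow> f n \<le> g n" using assms unfolding eventually_sequentially by blast
  have "f n \<le> (\<Sum>i<N. \<bar>f i - g i\<bar>) + g n" for n
  proof (cases "n < N")
    case True
    hence "\<bar>f n - g n\<bar> \<le> (\<Sum>i<N. \<bar>f i - g i\<bar>)" by (intro member_le_sum) auto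
    thus ?thesis by linarith
  next
    case False
    moreover have "0 \<le> (\<Sum>i<N. \<bar>f i - g i\<bar>)" by (intro sum_nonneg) auto
    ultimately show ?thesis using N[of n] by linarith
  qed
  thus ?thesis by blast
qed

lemma sum_le_add_const:
  fixes f g :: "nat \<Rightarrow> real"
  assumes "\<forall>\<^sub>F n in sequentially. f n \<le> g n"
  shows "\<exists>K. \<forall>n. (\<Sum>i=1..n. f i) \<le> K + (\<Sum>i=1..n. g i)"
proof -
  obtain N where N: "\<And>n. N \<le> n \<Longrightarrow> f n \<le> g n" using assms unfolding eventually_sequentially by blast
  let ?K = "\<Sum>i=1..N. \<bar>f i - g i\<bar>"
  have "(\<Sum>i=1..n. f i) \<le> ?K + (\<Sum>i=1..n. g i)" for n
  proof -
    have "(\<Sum>i=1..n. f i - g i) \<le> (\<Sum>i\<in>{1..n} \<inter> {..N}. f i - g i)"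
    proof -
      have "(\<Sum>i=1..n. f i - g i) = (\<Sum>i\<in>{1..n} \<inter> {..N}. f i - g i) + (\<Sum>i\<in>{1..n} - {..N}. f i - g i)"
        by (rule sum.Int_Diff) simp
      moreover have "(\<Sum>i\<in>{1..n} - {..N}. f i - g i) \<le> 0" using N by (intro sum_nonpos) auto
      ultimately show ?thesis by linarith
    qed
    also have "\<dots> \<le> (\<Sum>i\<in>{1..n} \<inter> {..N}. \<bar>f i - g i\<bar>)" by (intro sum_mono) auto
    also have "\<dots> \<le> ?K" by (intro sum_mono2) auto
    finally show ?thesis by (simp add: sum_subtractf)
  qed
  thus ?thesis by blast
qed

lemma eventually_sum_le:
  fixes f g :: "nat \<Rightarrow> real"
  assumes le: "\<forall>\<^sub>F n in sequentially. f n \<le> q * g n" and lim: "filterlim (\<lambda>n. \<Sum>i=1..n. g i) at_top sequentially"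
    and q: "q < q'"
  shows "\<forall>\<^sub>F n in sequentially. (\<Sum>i=1..n. f i) \<le> q' * (\<Sum>i=1..n. g i)"
proof -
  obtain K where K: "\<And>n. (\<Sum>i=1..n. f i) \<le> K + (\<Sum>i=1..n. q * g i)" using sum_le_add_const[OF le] by blast
  have "\<forall>\<^sub>F n in sequentially. K / (q' - q) \<le> (\<Sum>i=1..n. g i)" using lim by (simp add: filterlim_at_top)
  thus ?thesis
  proof eventually_elim
    case (elim n)
    hence "K \<le> (q' - q) * (\<Sum>i=1..n. g i)" using q by (simp add: pos_divide_le_eq mult.commute)
    thus ?case using K[of n] by (simp add: sum_distrib_left[symmetric] algebra_simps)
  qed
qed

lemma filterlim_sum_at_top:
  fixes g :: "nat \<Rightarrow> real"
  assumes "filterlim g at_top sequentially"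
  shows "filterlim (\<lambda>n. \<Sum>i=1..n. g i) at_top sequentially"
proof -
  have "\<forall>\<^sub>F n in sequentially. 1 \<le> g n" using assms by (simp add: filterlim_at_top)
  from sum_le_add_const[OF this] obtain K where K: "\<And>n. (\<Sum>i=1..n. 1) \<le> K + (\<Sum>i=1..n. g i)" by blast
  have "filterlim (\<lambda>n. real n - K) at_top sequentially" by real_asymp
  thus ?thesis
    by (rule filterlim_at_top_mono) (use K in \<open>simp add: algebra_simps\<close>)
qed

lemma frequently_conj_eventually:
  "\<exists>\<^sub>F x in F. P x \<Longrightarrow> \<forall>\<^sub>F x in F. Q x \<Longrightarrow> \<exists>\<^sub>F x in F. P x \<and> Q x"
  using frequently_eventually_conj[of P F Q] by (simp add: conj_commute)

lemma frequently_less_Limsup: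
  fixes X :: "'a \<Rightarrow> 'b::complete_linorder"
  assumes "y < Limsup F X"
  shows "\<exists>\<^sub>F x in F. y < X x"
proof (rule ccontr)
  assume "\<not> ?thesis"
  hence "\<forall>\<^sub>F x in F. X x \<le> y" by (simp add: not_frequently not_less)
  hence "Limsup F X \<le> y" by (rule Limsup_bounded)
  thus False using assms by simp
qed

lemma frequently_Liminf_less:
  fixes X :: "'a \<Rightarrow> 'b::complete_linorder"
  assumes "Liminf F X < y"
  shows "\<exists>\<^sub>F x in F. X x < y"
proof (rule ccontr)
  assume "\<not> ?thesis"
  hence "\<forall>\<^sub>F x in F. y \<le> X x" by (simp add: not_frequently not_less)
  hence "y \<le> Liminf F X" by (rule Liminf_bounded)
  thus False using assms by simp
qed

lemma le_Limsup_of_frequently: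
  fixes X :: "'a \<Rightarrow> 'b::{complete_linorder, dense_linorder}"
  assumes freq: "\<And>r. r < y \<Longrightarrow> \<exists>\<^sub>F x in F. r < X x"
  shows "y \<le> Limsup F X"
proof (rule ccontr)
  assume "\<not> ?thesis"
  hence "Limsup F X < y" by simp
  then obtain r where r: "Limsup F X < r" "r < y" using dense by blast
  have "\<forall>\<^sub>F x in F. X x < r" using r(1) by (rule Limsup_lessD)
  hence "\<forall>\<^sub>F x in F. \<not> r < X x" by eventually_elim simp
  thus False using freq[OF r(2)] by (simp add: frequently_def)
qed

lemma frequently_True_sequentially: "\<forall>n. P n \<Longrightarrow> \<exists>\<^sub>F n::nat in sequentially. P n"
  by (simp add: frequently_sequentially) blast

section \<open>Blocks of partial quotients on a logarithmic scale\<close>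

lemma hausdorff_dim_digit_blocks_ge_ln:
  fixes l m u :: "nat \<Rightarrow> nat" and s :: real
  assumes l: "\<And>n. 1 \<le> n \<Longrightarrow> 2 \<le> l n" and m: "\<And>n. 1 \<le> n \<Longrightarrow> 1 \<le> m n"
    and u: "\<And>n. 1 \<le> n \<Longrightarrow> l n + m n \<le> u n" and mono: "\<And>n. 1 \<le> n \<Longrightarrow> l n + m n \<le> l (n + 1) + 1"
    and s: "0 < s" "s \<le> 1"
    and size: "\<forall>\<^sub>F n in sequentially. s * (2 * (\<Sum>i=1..Suc n. ln (real (u i))) - ln (real (m (Suc n))))
       \<le> K + (\<Sum>i=1..n. ln (real (m i)))"
  shows "ereal s \<le> hausdorff_dim {x \<in> Lambda. \<forall>n\<ge>1. l n \<le> partial_quotient x n \<and> partial_quotient x n < l n + m n}"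
proof -
  obtain K' where K': "\<And>n. s * (2 * (\<Sum>i=1..Suc n. ln (real (u i))) - ln (real (m (Suc n))))
       \<le> K' + (K + (\<Sum>i=1..n. ln (real (m i))))" using eventually_le_imp_le_add_const[OF size] by blast
  have u_pos: "0 < real (u i)" if "1 \<le> i" for i using u[OF that] m[OF that] by simp
  have m_pos: "0 < real (m i)" if "1 \<le> i" for i using m[OF that] by simp
  show ?thesis
  proof (rule hausdorff_dim_digit_blocks_ge[where C = "exp (K' + K)"])
    fix n
    let ?U = "\<Prod>i=1..Suc n. real (u i)"
    have U: "0 < ?U" using u_pos by (intro prod_pos) auto
    have mn: "0 < real (m (Suc n))" using m_pos[of "Suc n"] by simp
    have "ln ?U = (\<Sum>i=1..Suc n. ln (real (u i)))" using u_pos by (intro ln_prod) (auto intro: less_imp_neq[symmetric])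
    hence lnU: "ln (?U\<^sup>2 / real (m (Suc n))) = 2 * (\<Sum>i=1..Suc n. ln (real (u i))) - ln (real (m (Suc n)))"
    proof -
      have "ln (y\<^sup>2 / z) = 2 * ln y - ln z" if "0 < y" "0 < z" for y z :: real
        using that by (simp add: ln_div ln_realpow)
      from this[OF U mn] show ?thesis using \<open>ln ?U = _\<close> by (simp only:)
    qed
    have "(?U\<^sup>2 / real (m (Suc n))) powr s = exp (s * ln (?U\<^sup>2 / real (m (Suc n))))"
    proof -
      have "?U\<^sup>2 / real (m (Suc n)) \<noteq> 0"
        using U mn by (metis divide_eq_0_iff power_not_zero less_irrefl)
      thus ?thesis by (simp only: powr_def if_False)
    qed
    also have "\<dots> \<le> exp (K' + K + (\<Sum>i=1..n. ln (real (m i))))"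
      using K'[of n] unfolding lnU by (simp only: exp_le_cancel_iff add.assoc)
    also have "\<dots> = exp (K' + K) * (\<Prod>i=1..n. real (m i))"
      using m_pos by (simp add: exp_add exp_sum)
    finally show "(?U\<^sup>2 / real (m (Suc n))) powr s \<le> exp (K' + K) * (\<Prod>i=1..n. real (m i))" .
  qed (use assms in auto)
qed

lemma sum_Suc_shift:
  fixes f :: "nat \<Rightarrow> real"
  shows "(\<Sum>i=1..Suc n. f i) = f 1 + (\<Sum>i=1..n. f (Suc i))"
  by (simp only: sum.atLeast_Suc_atMost[of 1 "Suc n"] sum.shift_bounds_cl_Suc_ivl)

text \<open>
  Around a given pattern \<open>c\<close> there is room for \<open>c n\<close> choices of the
  \<open>n\<close>-th partial quotient: the blocks from \<open>(n + 1) * c n\<close> to \<open>(n + 2)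
  * c n\<close> follow each other in order because \<open>c\<close> is nondecreasing. Since \<open>ln
  (c n)\<close> dominates \<open>ln n\<close>, the factors \<open>n + 2\<close> are negligible. The
  size condition then compares \<open>2 * S + ln (c (n + 1))\<close> with \<open>S\<close>, the sum of
  \<open>ln (c i)\<close> over \<open>i \<le> n\<close>, and \<open>ln (c (n + 1)) \<le> D * S\<close>
  leads to the exponent \<open>1 / (D + 2)\<close>. The gap between \<open>D\<close> and
  \<open>D'\<close> absorbs the error terms.
\<close>

lemma hausdorff_dim_wide_blocks_ge:
  fixes c :: "nat \<Rightarrow> nat" and D D' :: real
  assumes c: "\<And>n. 1 \<le> n \<Longrightarrow> 1 \<le> c n" and mono: "\<And>n. 1 \<le> n \<Longrightarrow> c n \<le> c (n + 1)"
    and ln: "filterlim (\<lambda>n. ln (real (c n)) / ln (real n)) at_top sequentially"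
    and D: "0 \<le> D" "\<forall>\<^sub>F n in sequentially. ln (real (c (n + 1))) \<le> D * (\<Sum>i=1..n. ln (real (c i)))" and D': "D < D'"
  shows "ereal (1 / (D' + 2)) \<le> hausdorff_dim {x \<in> Lambda. \<forall>n\<ge>1.
     (n + 1) * c n \<le> partial_quotient x n \<and> partial_quotient x n < (n + 2) * c n}"
proof -
  define s where "s = 1 / (D' + 2)"
  have s: "0 < s" "s \<le> 1" "s * (D' + 2) = 1" using D(1) D' by (auto simp: s_def divide_simps)
  have "\<forall>\<^sub>F n in sequentially. 2 * ln (real (n + 3)) \<le> (D' - D) * ln (real (c n))"
  proof -
    have "\<forall>\<^sub>F n in sequentially. 4 / (D' - D) \<le> ln (real (c n)) / ln (real n)"
      using ln by (simp add: filterlim_at_top)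
    moreover have "\<forall>\<^sub>F n::nat in sequentially. 2 * ln (real (n + 3)) \<le> 4 * ln (real n)" by real_asymp
    moreover have "\<forall>\<^sub>F n::nat in sequentially. 0 < ln (real n)" by real_asymp
    ultimately show ?thesis
    proof eventually_elim
      case (elim n)
      hence "4 / (D' - D) * ln (real n) \<le> ln (real (c n))" by (simp add: pos_le_divide_eq)
      hence "4 * ln (real n) \<le> (D' - D) * ln (real (c n))" using D' by (simp add: field_simps)
      thus ?case using elim by linarith
    qed
  qed
  from sum_le_add_const[OF this] obtain K where K: "\<And>n. (\<Sum>i=1..n. 2 * ln (real (i + 3))) \<le> K + (\<Sum>i=1..n. (D' - D) * ln (real (c i)))" by blast
  have "ereal s \<le> hausdorff_dim {x \<in> Lambda. \<forall>n\<ge>1.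
     (n + 1) * c n \<le> partial_quotient x n \<and> partial_quotient x n < (n + 1) * c n + c n}"
  proof (rule hausdorff_dim_digit_blocks_ge_ln[where u = "\<lambda>n. (n + 2) * c n" and K = "s * (2 * ln 3 + K)"])
    fix n :: nat assume n: "1 \<le> n"
    show "2 \<le> (n + 1) * c n" using mult_le_mono[of 2 "n + 1" 1 "c n"] c[OF n] n by simp
    show "1 \<le> c n" by (rule c[OF n])
    show "(n + 1) * c n + c n \<le> (n + 2) * c n" by simp
    have "(n + 2) * c n \<le> (n + 2) * c (n + 1)" using mono[OF n] by (rule mult_le_mono2)
    thus "(n + 1) * c n + c n \<le> (n + 1 + 1) * c (n + 1) + 1" by simp
  next
    show "\<forall>\<^sub>F n in sequentially. s * (2 * (\<Sum>i=1..Suc n. ln (real ((i + 2) * c i))) - ln (real (c (Suc n))))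
       \<le> s * (2 * ln 3 + K) + (\<Sum>i=1..n. ln (real (c i)))"
      using D(2)
    proof eventually_elim
      case (elim n)
      let ?S = "\<Sum>i=1..n. ln (real (c i))"
      have "(\<Sum>i=1..Suc n. ln (real ((i + 2) * c i))) = (\<Sum>i=1..Suc n. ln (real (i + 2)) + ln (real (c i)))"
      proof (intro sum.cong refl)
        fix i assume "i \<in> {1..Suc n}"
        hence "1 \<le> c i" using c by simp
        thus "ln (real ((i + 2) * c i)) = ln (real (i + 2)) + ln (real (c i))"
          by (simp only: of_nat_mult) (simp add: ln_mult)
      qed
      also have "\<dots> = (\<Sum>i=1..Suc n. ln (real (i + 2))) + (?S + ln (real (c (Suc n))))"
        by (simp add: sum.distrib)
      also have "(\<Sum>i=1..Suc n. ln (real (i + 2))) = ln 3 + (\<Sum>i=1..n. ln (real (i + 3)))"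
        by (subst sum_Suc_shift) (simp add: eval_nat_numeral)
      finally have "2 * (\<Sum>i=1..Suc n. ln (real ((i + 2) * c i))) - ln (real (c (Suc n))) =
          2 * ln 3 + (\<Sum>i=1..n. 2 * ln (real (i + 3))) + 2 * ?S + ln (real (c (Suc n)))"
        by (simp add: sum_distrib_left algebra_simps)
      also have "\<dots> \<le> 2 * ln 3 + (K + (D' - D) * ?S) + 2 * ?S + D * ?S"
        using K[of n] elim by (simp add: sum_distrib_left)
      also have "\<dots> = 2 * ln 3 + K + (D' + 2) * ?S" by (simp add: algebra_simps)
      finally have "s * (2 * (\<Sum>i=1..Suc n. ln (real ((i + 2) * c i))) - ln (real (c (Suc n)))) \<le>
          s * (2 * ln 3 + K + (D' + 2) * ?S)" using s by (intro mult_left_mono) auto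
      also have "\<dots> = s * (2 * ln 3 + K) + (s * (D' + 2)) * ?S" by (simp add: algebra_simps)
      finally show ?case unfolding s(3) by simp
    qed
  qed (use s in auto)
  also have "{x \<in> Lambda. \<forall>n\<ge>1. (n + 1) * c n \<le> partial_quotient x n \<and> partial_quotient x n < (n + 1) * c n + c n} =
      {x \<in> Lambda. \<forall>n\<ge>1. (n + 1) * c n \<le> partial_quotient x n \<and> partial_quotient x n < (n + 2) * c n}"
    by (simp add: add_ac)
  finally show ?thesis by (simp add: s_def)
qed

section \<open>Elementary properties of the exceptional sets\<close>

lemma Lambda_irrational_unit: "Lambda \<subseteq> irrational_unit"
  by (auto simp: Lambda_def irrational_unit_def)

lemma ln_partial_quotient_nonneg: "0 \<le> ln (real (partial_quotient x n))"
  by (cases "partial_quotient x n = 0") auto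

lemma E_lim_subset_E_sup: "E_lim \<psi> \<subseteq> E_sup \<psi>"
proof
  fix x assume x: "x \<in> E_lim \<psi>"
  hence "(\<lambda>n. ereal (ln (real (partial_quotient x n)) / \<psi> n)) \<longlonglongrightarrow> ereal 1"
    by (auto simp: E_lim_def intro: tendsto_ereal)
  hence "limsup (\<lambda>n. ereal (ln (real (partial_quotient x n)) / \<psi> n)) = ereal 1"
    by (intro lim_imp_Limsup) auto
  thus "x \<in> E_sup \<psi>" using x by (simp add: E_sup_def E_lim_def one_ereal_def)
qed

lemma E_sup_eventually_less:
  assumes "x \<in> E_sup \<psi>" "1 < r"
  shows "\<forall>\<^sub>F n in sequentially. ln (real (partial_quotient x n)) / \<psi> n < r"
proof -
  have "limsup (\<lambda>n. ereal (ln (real (partial_quotient x n)) / \<psi> n)) < ereal r"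
    using assms by (simp add: E_sup_def one_ereal_def)
  hence "\<forall>\<^sub>F n in sequentially. ereal (ln (real (partial_quotient x n)) / \<psi> n) < ereal r"
    by (rule Limsup_lessD)
  thus ?thesis by simp
qed

lemma E_sup_not_tendsto_0:
  assumes "x \<in> E_sup \<psi>"
  shows "\<not> (\<lambda>n. ln (real (partial_quotient x n)) / \<psi> n) \<longlonglongrightarrow> 0"
proof
  assume "(\<lambda>n. ln (real (partial_quotient x n)) / \<psi> n) \<longlonglongrightarrow> 0"
  hence "(\<lambda>n. ereal (ln (real (partial_quotient x n)) / \<psi> n)) \<longlonglongrightarrow> ereal 0" by (rule tendsto_ereal)
  hence "limsup (\<lambda>n. ereal (ln (real (partial_quotient x n)) / \<psi> n)) = ereal 0"
    by (intro lim_imp_Limsup) auto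
  thus False using assms by (simp add: E_sup_def one_ereal_def)
qed

lemma Lambda_mono:
  assumes "x \<in> Lambda" "1 \<le> i" "i \<le> j"
  shows "partial_quotient x i \<le> partial_quotient x j"
  using assms(3)
proof (induction j rule: dec_induct)
  case (step j)
  have "partial_quotient x j \<le> partial_quotient x (j + 1)" using assms step by (simp add: Lambda_def)
  thus ?case using step by simp
qed simp

text \<open>
  Monotone partial quotients either diverge or stay bounded, and bounded ones would make the quotient
  in the definition of the set tend to 0.
\<close>

lemma E_sup_partial_quotient_at_top:
  assumes x: "x \<in> E_sup \<psi>" and \<psi>: "filterlim \<psi> at_top sequentially"
  shows "filterlim (partial_quotient x) at_top sequentially"
proof (rule ccontr)
  have \<Lambda>: "x \<in> Lambda" using x by (simp add: E_sup_def)
  assume "\<not> filterlim (partial_quotient x) at_top sequentially"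
  then obtain B where B: "\<not> (\<forall>\<^sub>F n in sequentially. B \<le> partial_quotient x n)"
    unfolding filterlim_at_top by blast
  have le: "partial_quotient x n \<le> B" if "1 \<le> n" for n
  proof (rule ccontr)
    assume "\<not> partial_quotient x n \<le> B"
    hence "\<forall>k\<ge>n. B \<le> partial_quotient x k" using Lambda_mono[OF \<Lambda> that] by (meson nle_le order_trans)
    thus False using B unfolding eventually_sequentially by blast
  qed
  have "(\<lambda>n. ln (real B) / \<psi> n) \<longlonglongrightarrow> 0"
    by (intro real_tendsto_divide_at_top[OF tendsto_const \<psi>])
  moreover have "\<forall>\<^sub>F n in sequentially. 0 < \<psi> n" using \<psi> by (simp add: filterlim_at_top_dense)
  hence "\<forall>\<^sub>F n in sequentially. norm (ln (real (partial_quotient x n)) / \<psi> n) \<le> ln (real B) / \<psi> n"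
    using eventually_ge_at_top[of 1]
  proof eventually_elim
    case (elim n)
    have "1 \<le> partial_quotient x n" using partial_quotient_ge_1 \<Lambda> Lambda_irrational_unit elim by blast
    hence "ln (real (partial_quotient x n)) \<le> ln (real B)" using le[of n] elim by simp
    thus ?case using elim ln_partial_quotient_nonneg[of x n] by (simp add: divide_right_mono)
  qed
  ultimately have "(\<lambda>n. ln (real (partial_quotient x n)) / \<psi> n) \<longlonglongrightarrow> 0"
    by (rule Lim_null_comparison[rotated])
  thus False using E_sup_not_tendsto_0[OF x] by contradiction
qed

section \<open>Logarithmic growth\<close>

text \<open>
  Since \<open>\<psi> n\<close> behaves like \<open>\<alpha> * ln n\<close>, every point of the set
  satisfies \<open>a\<^sub>n \<le> n powr \<beta>\<close> eventually, for any \<open>\<beta> >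
  \<alpha>\<close>. The condition \<open>\<beta> * (1 - 2 * s) < 1\<close> for some such
  \<open>\<beta>\<close> is \<open>\<alpha> * (1 - 2 * s) < 1\<close>, which is automatic for
  \<open>\<alpha> < 1\<close> and amounts to \<open>s > (\<alpha> - 1) / (2 * \<alpha>)\<close>
  otherwise.
\<close>

lemma hausdorff_dim_E_sup_le_log_growth:
  assumes pos: "\<And>n. n \<ge> 1 \<Longrightarrow> \<psi> n > 0" and \<psi>: "filterlim \<psi> at_top sequentially"
    and \<alpha>: "0 \<le> \<alpha>" "(\<lambda>n. \<psi> n / ln (real n)) \<longlonglongrightarrow> \<alpha>"
  shows "hausdorff_dim (E_sup \<psi>) \<le> ereal (if \<alpha> < 1 then 0 else (\<alpha> - 1) / (2 * \<alpha>))"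
proof -
  define d where "d = (if \<alpha> < 1 then 0 else (\<alpha> - 1) / (2 * \<alpha>))"
  have d: "0 \<le> d" "d < 1 / 2" by (auto simp: d_def field_simps)
  have "hausdorff_dim (E_sup \<psi>) \<le> ereal d"
  proof (rule hausdorff_dim_le_limit[where r = "1 / 2 - d"])
    fix s assume s: "d < s" "s < d + (1 / 2 - d)"
    have s': "0 < s" "s < 1 / 2" using s d by auto
    have "\<alpha> * (1 - 2 * s) < 1"
    proof (cases "\<alpha> < 1")
      case True
      have "\<alpha> * (1 - 2 * s) \<le> \<alpha> * 1" using s' \<alpha> by (intro mult_left_mono) auto
      thus ?thesis using True by simp
    next
      case False
      hence "(\<alpha> - 1) / (2 * \<alpha>) < s" using s by (simp add: d_def)
      hence "\<alpha> - 1 < s * (2 * \<alpha>)" using False by (simp add: pos_divide_less_eq)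
      thus ?thesis by (simp add: algebra_simps)
    qed
    hence less: "\<alpha> < 1 / (1 - 2 * s)" using s' by (simp add: pos_less_divide_eq)
    then obtain \<beta> where \<beta>: "\<alpha> < \<beta>" "\<beta> < 1 / (1 - 2 * s)" using dense by blast
    obtain \<gamma> where \<gamma>: "\<alpha> < \<gamma>" "\<gamma> < \<beta>" using dense[OF \<beta>(1)] by blast
    have "\<beta> * (1 - 2 * s) < 1" using \<beta>(2) s' by (simp add: pos_less_divide_eq)
    hence null: "hausdorff_premeasure 1 s {x \<in> irrational_unit.
        (\<forall>i\<ge>1. partial_quotient x i \<le> partial_quotient x (i + 1)) \<and>
        filterlim (partial_quotient x) at_top sequentially \<and>
        (\<forall>\<^sub>F n in sequentially. real (partial_quotient x n) \<le> real n powr \<beta>)} = 0"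
      using s' \<beta> \<alpha> by (intro premeasure_polynomial_growth_null) auto
    have "real (partial_quotient x n) \<le> real n powr \<beta>"
      if "1 \<le> n" "0 < ln (real n)" "\<psi> n / ln (real n) < \<gamma>" "ln (real (partial_quotient x n)) / \<psi> n < \<beta> / \<gamma>" "x \<in> E_sup \<psi>" for x n
    proof -
      have pq: "1 \<le> partial_quotient x n"
        using that partial_quotient_ge_1[of x n] Lambda_irrational_unit by (auto simp: E_sup_def)
      have "ln (real (partial_quotient x n)) \<le> \<beta> / \<gamma> * \<psi> n"
        using that pos[of n] by (simp add: pos_divide_less_eq)
      also have "\<dots> \<le> \<beta> / \<gamma> * (\<gamma> * ln (real n))"
        using that \<gamma> \<alpha> by (intro mult_left_mono) (auto simp: pos_divide_less_eq)
      also have "\<dots> = \<beta> * ln (real n)" using \<gamma> \<alpha> by simp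
      finally have "exp (ln (real (partial_quotient x n))) \<le> exp (\<beta> * ln (real n))" by simp
      thus ?thesis using pq that(1) by (simp add: powr_def)
    qed note bound = this
    have ev: "\<forall>\<^sub>F n in sequentially. \<psi> n / ln (real n) < \<gamma>" using \<alpha>(2) \<gamma>(1) by (rule order_tendstoD)
    have ln_pos: "\<forall>\<^sub>F n::nat in sequentially. 0 < ln (real n)" by real_asymp
    have \<beta>\<gamma>: "1 < \<beta> / \<gamma>" using \<gamma> \<alpha> by simp
    have "\<forall>\<^sub>F n in sequentially. real (partial_quotient x n) \<le> real n powr \<beta>" if "x \<in> E_sup \<psi>" for x
      using ev ln_pos E_sup_eventually_less[OF that \<beta>\<gamma>] eventually_ge_at_top[of 1]
      by eventually_elim (rule bound[OF _ _ _ _ that])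
    hence "E_sup \<psi> \<subseteq> {x \<in> irrational_unit.
        (\<forall>i\<ge>1. partial_quotient x i \<le> partial_quotient x (i + 1)) \<and>
        filterlim (partial_quotient x) at_top sequentially \<and>
        (\<forall>\<^sub>F n in sequentially. real (partial_quotient x n) \<le> real n powr \<beta>)}"
      using E_sup_partial_quotient_at_top[OF _ \<psi>] Lambda_irrational_unit
      by (auto simp: E_sup_def Lambda_def)
    thus "hausdorff_premeasure 1 s (E_sup \<psi>) = 0" using null by (rule hausdorff_premeasure_null_subset)
  qed (use d in auto)
  thus ?thesis by (simp add: d_def)
qed

text \<open>
  Let the \<open>n\<close>-th partial quotient run over the integers between about \<open>n powr
  \<alpha>\<close> and \<open>(n + 1) powr \<alpha>\<close>. These blocks are in order, and they have
  about \<open>n powr (\<alpha> - 1)\<close> elements of size about \<open>n powr \<alpha>\<close>.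
  Each term \<open>2 * s * \<alpha> * ln n\<close> on the left of the size condition is therefore
  matched by a term \<open>(\<alpha> - 1) * ln n\<close> on the right.
\<close>

lemma hausdorff_dim_E_lim_ge_log_growth:
  assumes \<alpha>: "1 < \<alpha>" "(\<lambda>n. \<psi> n / ln (real n)) \<longlonglongrightarrow> \<alpha>"
    and s: "0 < s" "s < (\<alpha> - 1) / (2 * \<alpha>)"
  shows "ereal s \<le> hausdorff_dim (E_lim \<psi>)"
proof -
  define c where "c n = nat \<lceil>real n powr \<alpha>\<rceil>" for n
  define m where "m n = c (n + 1) - c n + 1" for n
  have c_le: "real n powr \<alpha> \<le> real (c n)" "real (c n) \<le> real n powr \<alpha> + 1" for n
  proof -
    have "0 \<le> real n powr \<alpha>" by simp
    thus "real n powr \<alpha> \<le> real (c n)" "real (c n) \<le> real n powr \<alpha> + 1" unfolding c_def by linarith+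
  qed
  have c_mono: "c n \<le> c (n + 1)" for n
    unfolding c_def using \<alpha> by (intro nat_mono ceiling_mono powr_mono2) auto
  have c_ge: "1 \<le> c n" if "1 \<le> n" for n
  proof -
    have "1 \<le> real n powr \<alpha>" using that \<alpha> by (intro ge_one_powr_ge_zero) auto
    thus ?thesis using c_le(1)[of n] by linarith
  qed
  have m_ge: "real n powr (\<alpha> - 1) \<le> real (m n)" if "1 \<le> n" for n
  proof -
    have "\<exists>z. real n < z \<and> z < real n + 1 \<and>
        (real n + 1) powr \<alpha> - real n powr \<alpha> = (real n + 1 - real n) * (\<alpha> * z powr (\<alpha> - 1))"
      using that by (intro MVT2) (auto intro!: derivative_eq_intros)
    then obtain z where z: "real n < z" "(real n + 1) powr \<alpha> - real n powr \<alpha> = \<alpha> * z powr (\<alpha> - 1)" by auto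
    have "1 * real n powr (\<alpha> - 1) \<le> \<alpha> * z powr (\<alpha> - 1)"
      using z \<alpha> by (intro mult_mono powr_mono2) auto
    also have "\<dots> \<le> real (m n)"
      using z(2) c_le(2)[of n] c_le(1)[of "n + 1"] c_mono[of n] by (simp add: m_def of_nat_diff add.commute)
    finally show ?thesis by simp
  qed
  have s2: "2 * s * \<alpha> < \<alpha> - 1" using s \<alpha> by (simp add: pos_less_divide_eq mult_ac)
  have s1: "s \<le> 1"
  proof -
    have "(\<alpha> - 1) / (2 * \<alpha>) \<le> 1" using \<alpha> by (simp add: divide_simps)
    thus ?thesis using s by linarith
  qed
  have "\<forall>\<^sub>F n in sequentially. 2 * s * ln (real (c (n + 2) + 2)) \<le> ln (real (m n))"
  proof -
    have "(\<lambda>n::nat. ln (real (n + 2) powr \<alpha> + 3) / ln (real n)) \<longlonglongrightarrow> \<alpha>" using \<alpha> by real_asymp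
    hence "(\<lambda>n. 2 * s * (ln (real (n + 2) powr \<alpha> + 3) / ln (real n))) \<longlonglongrightarrow> 2 * s * \<alpha>"
      by (intro tendsto_mult tendsto_const)
    hence "\<forall>\<^sub>F n in sequentially. 2 * s * (ln (real (n + 2) powr \<alpha> + 3) / ln (real n)) < \<alpha> - 1"
      using s2 by (rule order_tendstoD)
    moreover have "\<forall>\<^sub>F n::nat in sequentially. 0 < ln (real n)" by real_asymp
    ultimately show ?thesis using eventually_ge_at_top[of 1]
    proof eventually_elim
      case (elim n)
      have "ln (real (c (n + 2) + 2)) \<le> ln (real (n + 2) powr \<alpha> + 3)"
        using c_le(2)[of "n + 2"] by simp
      hence "2 * s * ln (real (c (n + 2) + 2)) \<le> 2 * s * ln (real (n + 2) powr \<alpha> + 3)"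
        using s by (intro mult_left_mono) auto
      also have "\<dots> \<le> (\<alpha> - 1) * ln (real n)" using elim by (simp add: pos_divide_less_eq)
      also have "\<dots> = ln (real n powr (\<alpha> - 1))" using elim by (simp add: ln_powr)
      also have "\<dots> \<le> ln (real (m n))" using m_ge[of n] elim by (intro ln_mono) auto
      finally show ?case .
    qed
  qed
  from sum_le_add_const[OF this] obtain K where K: "\<And>n. (\<Sum>i=1..n. 2 * s * ln (real (c (i + 2) + 2))) \<le> K + (\<Sum>i=1..n. ln (real (m i)))" by blast
  let ?F = "{x \<in> Lambda. \<forall>n\<ge>1. c n + 1 \<le> partial_quotient x n \<and> partial_quotient x n < (c n + 1) + m n}"
  have "ereal s \<le> hausdorff_dim ?F"
  proof (rule hausdorff_dim_digit_blocks_ge_ln[where u = "\<lambda>n. c (n + 1) + 2" and K = "2 * s * ln (real (c 2 + 2)) + K"])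
    fix n :: nat assume n: "1 \<le> n"
    show "2 \<le> c n + 1" using c_ge[OF n] by simp
    show "1 \<le> m n" by (simp add: m_def)
    show "c n + 1 + m n \<le> c (n + 1) + 2" "c n + 1 + m n \<le> c (n + 1) + 1 + 1"
      using c_mono[of n] by (simp_all add: m_def)
  next
    show "\<forall>\<^sub>F n in sequentially. s * (2 * (\<Sum>i=1..Suc n. ln (real (c (i + 1) + 2))) - ln (real (m (Suc n))))
       \<le> 2 * s * ln (real (c 2 + 2)) + K + (\<Sum>i=1..n. ln (real (m i)))"
    proof (intro always_eventually allI)
      fix n
      have shift: "(\<Sum>i=1..Suc n. ln (real (c (i + 1) + 2))) =
          ln (real (c 2 + 2)) + (\<Sum>i=1..n. ln (real (c (i + 2) + 2)))"
        by (subst sum_Suc_shift) (simp add: eval_nat_numeral)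
      have "0 \<le> ln (real (m (Suc n)))" by (simp add: m_def)
      hence "s * (2 * (\<Sum>i=1..Suc n. ln (real (c (i + 1) + 2))) - ln (real (m (Suc n)))) \<le>
         s * (2 * (\<Sum>i=1..Suc n. ln (real (c (i + 1) + 2))))" using s by (intro mult_left_mono) auto
      also have "\<dots> = 2 * s * ln (real (c 2 + 2)) + (\<Sum>i=1..n. 2 * s * ln (real (c (i + 2) + 2)))"
        unfolding shift by (simp add: sum_distrib_left algebra_simps)
      finally show "s * (2 * (\<Sum>i=1..Suc n. ln (real (c (i + 1) + 2))) - ln (real (m (Suc n))))
         \<le> 2 * s * ln (real (c 2 + 2)) + K + (\<Sum>i=1..n. ln (real (m i)))" using K[of n] by linarith
    qed
  qed (use s s1 in auto)
  also have "\<dots> \<le> hausdorff_dim (E_lim \<psi>)"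
  proof (rule hausdorff_dim_mono, rule subsetI)
    fix x assume x: "x \<in> ?F"
    have "(\<lambda>n. ln (real (partial_quotient x n)) / ln (real n)) \<longlonglongrightarrow> \<alpha>"
    proof (rule tendsto_sandwich)
      show "(\<lambda>n::nat. ln (real n powr \<alpha>) / ln (real n)) \<longlonglongrightarrow> \<alpha>" using \<alpha> by real_asymp
      show "(\<lambda>n::nat. ln (real (n + 1) powr \<alpha> + 3) / ln (real n)) \<longlonglongrightarrow> \<alpha>" using \<alpha> by real_asymp
      have ln_pos: "\<forall>\<^sub>F n::nat in sequentially. 0 < ln (real n)" by real_asymp
      have pq: "real n powr \<alpha> \<le> real (partial_quotient x n)"
          "real (partial_quotient x n) \<le> real (n + 1) powr \<alpha> + 3" if "1 \<le> n" for n
      proof -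
        have "c n + 1 \<le> partial_quotient x n" "partial_quotient x n < (c n + 1) + m n" using x that by auto
        moreover have "c n + 1 + m n = c (n + 1) + 2" using c_mono[of n] by (simp add: m_def)
        ultimately show "real n powr \<alpha> \<le> real (partial_quotient x n)"
          "real (partial_quotient x n) \<le> real (n + 1) powr \<alpha> + 3"
          using c_le(1)[of n] c_le(2)[of "n + 1"] by linarith+
      qed
      show "\<forall>\<^sub>F n in sequentially. ln (real n powr \<alpha>) / ln (real n) \<le> ln (real (partial_quotient x n)) / ln (real n)"
        using ln_pos eventually_ge_at_top[of 1]
      proof eventually_elim
        case (elim n)
        thus ?case using pq(1)[of n] by (intro divide_right_mono ln_mono) auto
      qed
      show "\<forall>\<^sub>F n in sequentially. ln (real (partial_quotient x n)) / ln (real n) \<le> ln (real (n + 1) powr \<alpha> + 3) / ln (real n)"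
        using ln_pos eventually_ge_at_top[of 1]
      proof eventually_elim
        case (elim n)
        have "0 < real n powr \<alpha>" using elim by simp
        hence "0 < real (partial_quotient x n)" using pq(1)[of n] elim by linarith
        thus ?case using pq(2)[of n] elim by (intro divide_right_mono ln_mono) auto
      qed
    qed
    hence "(\<lambda>n. (ln (real (partial_quotient x n)) / ln (real n)) / (\<psi> n / ln (real n))) \<longlonglongrightarrow> \<alpha> / \<alpha>"
      using \<alpha> by (intro tendsto_divide) auto
    moreover have "\<forall>\<^sub>F n in sequentially. (ln (real (partial_quotient x n)) / ln (real n)) / (\<psi> n / ln (real n)) =
        ln (real (partial_quotient x n)) / \<psi> n"
    proof -
      have "\<forall>\<^sub>F n::nat in sequentially. 0 < ln (real n)" by real_asymp
      thus ?thesis by eventually_elim simp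
    qed
    ultimately have "(\<lambda>n. ln (real (partial_quotient x n)) / \<psi> n) \<longlonglongrightarrow> \<alpha> / \<alpha>"
      by (rule Lim_transform_eventually)
    thus "x \<in> E_lim \<psi>" using x \<alpha> by (simp add: E_lim_def)
  qed
  finally show ?thesis .
qed

section \<open>Reduction of the fast growth case to exponents\<close>

lemma hausdorff_dim_le_of_exponents:
  fixes A :: ereal
  assumes A: "1 \<le> A"
    and le: "\<And>b. 1 \<le> b \<Longrightarrow> b = 1 \<or> ereal b < A \<Longrightarrow> hausdorff_dim E \<le> ereal (1 / (b + 1))"
  shows "hausdorff_dim E \<le> 1 / (A + 1)"
proof -
  have half: "hausdorff_dim E \<le> ereal (1 / 2)" using le[of 1] by simp
  have "hausdorff_dim E \<le> ereal y" if y: "1 / (A + 1) < ereal y" "y < 1 / 2" for y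
  proof -
    have y0: "0 < y"
    proof -
      have "0 \<le> 1 / (A + 1)" using A by (cases A) auto
      hence "0 < ereal y" using y(1) by (rule le_less_trans)
      thus ?thesis by simp
    qed
    have "ereal (1 / y - 1) < A"
    proof (cases A)
      case (real a)
      hence "1 / (a + 1) < y" "1 \<le> a" using y(1) A by (auto simp: one_ereal_def)
      hence "1 < y * (a + 1)" by (simp add: pos_divide_less_eq)
      hence "1 / y < a + 1" using y0 by (simp add: pos_divide_less_eq mult.commute)
      thus ?thesis using real by simp
    qed (use A in auto)
    moreover have "1 \<le> 1 / y - 1" using y(2) y0 by (simp add: field_simps)
    ultimately have "hausdorff_dim E \<le> ereal (1 / (1 / y - 1 + 1))" by (intro le) auto
    thus ?thesis by simp
  qed note * = this
  show ?thesis
  proof (rule dense_ge)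
    fix z assume z: "1 / (A + 1) < z"
    show "hausdorff_dim E \<le> z"
    proof (cases "z < ereal (1 / 2)")
      case True
      have "0 \<le> 1 / (A + 1)" using A by (cases A) auto
      then obtain y where "z = ereal y" using z True by (cases z) auto
      thus ?thesis using * z True by simp
    next
      case False
      thus ?thesis using half by (meson leI order_trans)
    qed
  qed
qed

lemma hausdorff_dim_ge_of_exponents:
  fixes A :: ereal
  assumes A: "1 \<le> A"
    and ge: "\<And>D. 0 \<le> D \<Longrightarrow> A < ereal (D + 1) \<Longrightarrow> ereal (1 / (D + 2)) \<le> hausdorff_dim E"
  shows "1 / (A + 1) \<le> hausdorff_dim E"
proof (cases A)
  case (real a)
  have a: "1 \<le> a" using real A by simp
  have lim: "(\<lambda>n. ereal (1 / (a - 1 + 1 / real (Suc n) + 2))) \<longlonglongrightarrow> ereal (1 / (a - 1 + 0 + 2))"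
    using a by (intro tendsto_ereal tendsto_intros LIMSEQ_Suc[OF lim_1_over_n]) auto
  have "ereal (1 / (a - 1 + 1 / real (Suc n) + 2)) \<le> hausdorff_dim E" for n
    using a real by (intro ge) auto
  hence "ereal (1 / (a - 1 + 0 + 2)) \<le> hausdorff_dim E"
    using LIMSEQ_le_const2[OF lim] by blast
  moreover have "1 / (A + 1) = ereal (1 / (a - 1 + 0 + 2))" using real a by (simp add: one_ereal_def)
  ultimately show ?thesis by simp
qed (use A hausdorff_dim_nonneg in auto)

lemma hausdorff_dim_le_of_large_quotients:
  assumes b: "1 \<le> b" and E: "E \<subseteq> irrational_unit"
    and lim: "\<And>x. x \<in> E \<Longrightarrow> filterlim (partial_quotient x) at_top sequentially"
    and large: "\<And>x. x \<in> E \<Longrightarrow> \<exists>\<^sub>F k in sequentially.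
        (b - 1) * (\<Sum>i=1..k. ln (real (partial_quotient x i))) \<le> ln (real (partial_quotient x (k + 1)))"
  shows "hausdorff_dim E \<le> ereal (1 / (b + 1))"
proof (rule hausdorff_dim_le_limit[where r = 1])
  fix s assume s: "1 / (b + 1) < s"
  have "(\<Prod>i=1..k. real (partial_quotient x i)) powr (b - 1) \<le> real (partial_quotient x (k + 1))"
    if le: "(b - 1) * (\<Sum>i=1..k. ln (real (partial_quotient x i))) \<le> ln (real (partial_quotient x (k + 1)))"
      and x: "x \<in> E" for x k
  proof -
    have pq: "0 < real (partial_quotient x i)" if "1 \<le> i" for i
      using partial_quotient_ge_1[of x i] x E that by auto
    have P: "0 < (\<Prod>i=1..k. real (partial_quotient x i))" using pq by (intro prod_pos) auto
    have "ln (\<Prod>i=1..k. real (partial_quotient x i)) = (\<Sum>i=1..k. ln (real (partial_quotient x i)))"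
      using pq by (intro ln_prod) (auto intro: less_imp_neq[symmetric])
    hence "(\<Prod>i=1..k. real (partial_quotient x i)) powr (b - 1) \<le> exp (ln (real (partial_quotient x (k + 1))))"
      using le P by (simp add: powr_def)
    thus ?thesis using pq[of "k + 1"] by simp
  qed note bound = this
  have "\<exists>\<^sub>F k in sequentially.
      (\<Prod>i=1..k. real (partial_quotient x i)) powr (b - 1) \<le> real (partial_quotient x (k + 1))" if "x \<in> E" for x
    using large[OF that] by (rule frequently_elim1) (rule bound[OF _ that])
  hence "E \<subseteq> {x \<in> irrational_unit.
     filterlim (partial_quotient x) at_top sequentially \<and>
     (\<exists>\<^sub>F k in sequentially.
        (\<Prod>i=1..k. real (partial_quotient x i)) powr (b - 1) \<le> real (partial_quotient x (k + 1)))}"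
    using E lim by blast
  thus "hausdorff_premeasure 1 s E = 0"
    using premeasure_large_quotient_infinitely_often_null[OF b s] by (rule hausdorff_premeasure_null_subset)
qed (use b in auto)

section \<open>Fast growth: the set of limits\<close>

lemma E_lim_ln_bounds:
  assumes x: "x \<in> E_lim \<psi>" and pos: "\<And>n. n \<ge> 1 \<Longrightarrow> \<psi> n > 0" and q: "1 < q"
  shows "\<forall>\<^sub>F n in sequentially. ln (real (partial_quotient x n)) \<le> q * \<psi> n"
    and "\<forall>\<^sub>F n in sequentially. \<psi> n \<le> q * ln (real (partial_quotient x n))"
proof -
  have lim: "(\<lambda>n. ln (real (partial_quotient x n)) / \<psi> n) \<longlonglongrightarrow> 1" using x by (simp add: E_lim_def)
  have "\<forall>\<^sub>F n in sequentially. ln (real (partial_quotient x n)) / \<psi> n < q"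
    using lim q by (rule order_tendstoD)
  thus "\<forall>\<^sub>F n in sequentially. ln (real (partial_quotient x n)) \<le> q * \<psi> n"
    using eventually_ge_at_top[of 1]
  proof eventually_elim
    case (elim n)
    thus ?case using pos[of n] by (simp add: pos_divide_less_eq)
  qed
  have "1 / q < 1" using q by simp
  with lim have "\<forall>\<^sub>F n in sequentially. 1 / q < ln (real (partial_quotient x n)) / \<psi> n"
    by (rule order_tendstoD)
  thus "\<forall>\<^sub>F n in sequentially. \<psi> n \<le> q * ln (real (partial_quotient x n))"
    using eventually_ge_at_top[of 1]
  proof eventually_elim
    case (elim n)
    hence "1 / q * \<psi> n < ln (real (partial_quotient x n))" using pos[of n] by (simp only: pos_less_divide_eq)
    thus ?case using q by (simp add: field_simps)
  qed
qed

lemma filterlim_ln_partial_quotient_at_top: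
  assumes "filterlim (partial_quotient x) at_top sequentially"
  shows "filterlim (\<lambda>n. ln (real (partial_quotient x n))) at_top sequentially"
  by (rule filterlim_compose[OF ln_at_top filterlim_compose[OF filterlim_real_sequentially assms]])

text \<open>
  On this set \<open>ln a\<^sub>n\<close> is asymptotic to \<open>\<psi> n\<close>, and then so are
  the partial sums. Hence \<open>\<psi> (n + 1) > y * (\<psi> 1 + \<dots> + \<psi> n)\<close>, which
  for some \<open>y > b - 1\<close> holds infinitely often if \<open>b \<noteq> 1\<close>, yields the
  same comparison, with factor \<open>b - 1\<close>, between the logarithms of the partial quotients
  infinitely often.
\<close>

lemma hausdorff_dim_E_lim_le_fast_growth:
  assumes pos: "\<And>n. n \<ge> 1 \<Longrightarrow> \<psi> n > 0" and \<psi>: "filterlim \<psi> at_top sequentially"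
    and b: "1 \<le> b" and L: "b = 1 \<or> ereal (b - 1) < limsup (\<lambda>n. ereal (\<psi> (n + 1) / (\<Sum>k=1..n. \<psi> k)))"
  shows "hausdorff_dim (E_lim \<psi>) \<le> ereal (1 / (b + 1))"
proof (rule hausdorff_dim_le_of_large_quotients[OF b])
  show "E_lim \<psi> \<subseteq> irrational_unit" using Lambda_irrational_unit by (auto simp: E_lim_def)
  fix x assume x: "x \<in> E_lim \<psi>"
  have "x \<in> E_sup \<psi>" using x E_lim_subset_E_sup by blast
  thus "filterlim (partial_quotient x) at_top sequentially" using \<psi> by (rule E_sup_partial_quotient_at_top)
  let ?a = "\<lambda>n. ln (real (partial_quotient x n))"
  show "\<exists>\<^sub>F k in sequentially. (b - 1) * (\<Sum>i=1..k. ?a i) \<le> ?a (k + 1)"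
  proof (cases "b = 1")
    case True
    thus ?thesis using ln_partial_quotient_nonneg by (intro frequently_True_sequentially) simp
  next
    case False
    then obtain z where z: "ereal (b - 1) < z" "z < limsup (\<lambda>n. ereal (\<psi> (n + 1) / (\<Sum>k=1..n. \<psi> k)))"
      using L dense by blast
    then obtain y where y: "z = ereal y" by (cases z) auto
    have by': "b - 1 < y" using z y by simp
    \<comment> \<open>\<open>q\<close> is the loss in each of the two comparisons between \<open>ln a\<^sub>n\<close> and \<open>\<psi> n\<close>.\<close>
    obtain q where q: "1 < q" "q * q * (b - 1) < y"
    proof -
      have "((\<lambda>q. q * q * (b - 1)) \<longlongrightarrow> 1 * 1 * (b - 1)) (at_right 1)" by (intro tendsto_intros)
      hence "\<forall>\<^sub>F q in at_right 1. q * q * (b - 1) < y" using by' by (intro order_tendstoD) auto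
      moreover have "\<forall>\<^sub>F q::real in at_right 1. 1 < q" by (rule eventually_at_right_less)
      ultimately have "\<forall>\<^sub>F q in at_right (1::real). 1 < q \<and> q * q * (b - 1) < y" by eventually_elim simp
      thus thesis using that eventually_happens' trivial_limit_at_right_real by blast
    qed
    have q': "1 < sqrt q" "sqrt q < q" using q real_sqrt_less_mono[of q "q * q"] by auto
    have freq: "\<exists>\<^sub>F n in sequentially. ereal y < ereal (\<psi> (n + 1) / (\<Sum>k=1..n. \<psi> k))"
      using z(2) unfolding y by (rule frequently_less_Limsup)
    have e1: "\<forall>\<^sub>F n in sequentially. (\<Sum>i=1..n. ?a i) \<le> q * (\<Sum>i=1..n. \<psi> i)"
      using E_lim_ln_bounds(1)[OF x pos q'(1)] filterlim_sum_at_top[OF \<psi>] q'(2) by (rule eventually_sum_le)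
    have e2: "\<forall>\<^sub>F n in sequentially. \<psi> (Suc n) \<le> q * ?a (Suc n)"
      using E_lim_ln_bounds(2)[OF x pos q(1)] by (rule eventually_compose_filterlim[OF _ filterlim_Suc])
    have "\<forall>\<^sub>F n in sequentially. 1 \<le> (\<Sum>i=1..n. \<psi> i)"
      using filterlim_sum_at_top[OF \<psi>] by (simp add: filterlim_at_top)
    with e1 e2 have "\<forall>\<^sub>F n in sequentially. (\<Sum>i=1..n. ?a i) \<le> q * (\<Sum>i=1..n. \<psi> i) \<and>
        \<psi> (Suc n) \<le> q * ?a (Suc n) \<and> 1 \<le> (\<Sum>i=1..n. \<psi> i)" by eventually_elim simp
    with freq have "\<exists>\<^sub>F n in sequentially. ereal y < ereal (\<psi> (n + 1) / (\<Sum>k=1..n. \<psi> k)) \<and>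
        ((\<Sum>i=1..n. ?a i) \<le> q * (\<Sum>i=1..n. \<psi> i) \<and> \<psi> (Suc n) \<le> q * ?a (Suc n) \<and> 1 \<le> (\<Sum>i=1..n. \<psi> i))"
      by (rule frequently_conj_eventually)
    thus ?thesis
    proof (rule frequently_elim1)
      fix n
      assume n: "ereal y < ereal (\<psi> (n + 1) / (\<Sum>k=1..n. \<psi> k)) \<and>
        ((\<Sum>i=1..n. ?a i) \<le> q * (\<Sum>i=1..n. \<psi> i) \<and> \<psi> (Suc n) \<le> q * ?a (Suc n) \<and> 1 \<le> (\<Sum>i=1..n. \<psi> i))"
      let ?S = "\<Sum>i=1..n. \<psi> i"
      have S: "1 \<le> ?S" using n by blast
      have "q * ((b - 1) * (\<Sum>i=1..n. ?a i)) \<le> q * ((b - 1) * (q * ?S))"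
        using n q b by (intro mult_left_mono) auto
      also have "\<dots> = q * q * (b - 1) * ?S" by simp
      also have "\<dots> \<le> y * ?S" using q S by (intro mult_right_mono) auto
      also have "\<dots> \<le> \<psi> (n + 1)"
      proof -
        have "y < \<psi> (n + 1) / ?S" "0 < ?S" using n S by auto
        thus ?thesis by (simp only: pos_less_divide_eq less_imp_le)
      qed
      also have "\<dots> \<le> q * ?a (n + 1)" using n by simp
      finally show "(b - 1) * (\<Sum>i=1..n. ?a i) \<le> ?a (n + 1)" using q by simp
    qed
  qed
qed

lemma ln_wide_block_bounds:
  fixes a c n :: nat
  assumes "1 \<le> c" "(n + 1) * c \<le> a" "a < (n + 2) * c"
  shows "ln (real c) \<le> ln (real a)" "ln (real a) \<le> ln (real c) + ln (real n + 2)"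
proof -
  have "1 * c \<le> (n + 1) * c" by (intro mult_le_mono1) simp
  hence "c \<le> a" using assms(2) by simp
  thus "ln (real c) \<le> ln (real a)" using assms by simp
  have "real a \<le> real ((n + 2) * c)" using assms(3) by (simp only: of_nat_le_iff less_imp_le)
  also have "\<dots> = real c * (real n + 2)" by (simp add: algebra_simps)
  finally have "ln (real a) \<le> ln (real c * (real n + 2))" using \<open>c \<le> a\<close> assms(1) by (intro ln_mono) auto
  also have "\<dots> = ln (real c) + ln (real n + 2)" using assms(1) by (intro ln_mult_pos) auto
  finally show "ln (real a) \<le> ln (real c) + ln (real n + 2)" .
qed

lemma ln_shift_over_fast_tendsto_0:
  assumes fast: "filterlim (\<lambda>n. \<psi> n / ln (real n)) at_top sequentially"
  shows "(\<lambda>n. ln (real n + 2) / \<psi> n) \<longlonglongrightarrow> 0"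
proof -
  have "(\<lambda>n. (ln (real n + 2) / ln (real n)) / (\<psi> n / ln (real n))) \<longlonglongrightarrow> 0"
  proof (rule real_tendsto_divide_at_top[OF _ fast])
    show "(\<lambda>n::nat. ln (real n + 2) / ln (real n)) \<longlonglongrightarrow> 1" by real_asymp
  qed
  moreover have "\<forall>\<^sub>F n in sequentially. (ln (real n + 2) / ln (real n)) / (\<psi> n / ln (real n)) = ln (real n + 2) / \<psi> n"
  proof -
    have "\<forall>\<^sub>F n::nat in sequentially. 0 < ln (real n)" by real_asymp
    thus ?thesis by eventually_elim simp
  qed
  ultimately show ?thesis by (rule Lim_transform_eventually)
qed

lemma limsup_ratio_nonneg:
  fixes \<psi> :: "nat \<Rightarrow> real"
  assumes pos: "\<And>n. n \<ge> 1 \<Longrightarrow> \<psi> n > 0"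
  shows "0 \<le> limsup (\<lambda>n. ereal (\<psi> (n + 1) / (\<Sum>k=1..n. \<psi> k)))"
proof (rule le_Limsup)
  have "0 \<le> \<psi> (n + 1) / (\<Sum>k=1..n. \<psi> k)" for n
    using pos by (intro divide_nonneg_nonneg sum_nonneg) (auto intro: less_imp_le)
  thus "\<forall>\<^sub>F n in sequentially. 0 \<le> ereal (\<psi> (n + 1) / (\<Sum>k=1..n. \<psi> k))" by simp
qed simp

text \<open>
  The function \<open>\<psi>\<close> itself may be far from monotone, but a single point of the set
  supplies a nondecreasing sequence of integers with logarithms asymptotic to \<open>\<psi>\<close>.
  Blocks built around this sequence stay within the set.
\<close>

lemma hausdorff_dim_E_lim_ge_fast_growth:
  assumes pos: "\<And>n. n \<ge> 1 \<Longrightarrow> \<psi> n > 0" and \<psi>: "filterlim \<psi> at_top sequentially"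
    and fast: "filterlim (\<lambda>n. \<psi> n / ln (real n)) at_top sequentially"
    and x: "x \<in> E_lim \<psi>"
    and L: "limsup (\<lambda>n. ereal (\<psi> (n + 1) / (\<Sum>k=1..n. \<psi> k))) < ereal D" and D: "0 \<le> D"
  shows "ereal (1 / (D + 2)) \<le> hausdorff_dim (E_lim \<psi>)"
proof -
  define c where "c = partial_quotient x"
  have x\<Lambda>: "x \<in> Lambda" using x by (simp add: E_lim_def)
  have lim: "(\<lambda>n. ln (real (c n)) / \<psi> n) \<longlonglongrightarrow> 1" using x by (simp add: E_lim_def c_def)
  have c_ge: "1 \<le> c n" if "1 \<le> n" for n
    using partial_quotient_ge_1[of x n] that x\<Lambda> Lambda_irrational_unit by (auto simp: c_def)
  have c_mono: "c n \<le> c (n + 1)" if "1 \<le> n" for n using x\<Lambda> that by (simp add: Lambda_def c_def)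
  have c_lim: "filterlim c at_top sequentially"
    unfolding c_def using x E_lim_subset_E_sup \<psi> by (intro E_sup_partial_quotient_at_top) auto
  have sum_c: "filterlim (\<lambda>n. \<Sum>i=1..n. ln (real (c i))) at_top sequentially"
    unfolding c_def by (intro filterlim_sum_at_top filterlim_ln_partial_quotient_at_top c_lim[unfolded c_def])
  have c_fast: "filterlim (\<lambda>n. ln (real (c n)) / ln (real n)) at_top sequentially"
  proof -
    have "filterlim (\<lambda>n. (ln (real (c n)) / \<psi> n) * (\<psi> n / ln (real n))) at_top sequentially"
      by (rule filterlim_tendsto_pos_mult_at_top[OF lim _ fast]) simp
    moreover have "\<forall>\<^sub>F n in sequentially. (ln (real (c n)) / \<psi> n) * (\<psi> n / ln (real n)) = ln (real (c n)) / ln (real n)"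
      using eventually_ge_at_top[of 1]
    proof eventually_elim
      case (elim n)
      thus ?case using pos[of n] by simp
    qed
    ultimately show ?thesis using filterlim_cong[OF refl refl] by fast
  qed
  obtain z where z: "limsup (\<lambda>n. ereal (\<psi> (n + 1) / (\<Sum>k=1..n. \<psi> k))) < z" "z < ereal D"
    using L dense by blast
  have L0: "0 \<le> limsup (\<lambda>n. ereal (\<psi> (n + 1) / (\<Sum>k=1..n. \<psi> k)))"
    using pos by (rule limsup_ratio_nonneg)
  then obtain D0 where D0: "z = ereal D0" using z by (cases z) auto
  have D0': "0 < D0" "D0 < D" using z L0 D0 by (auto dest: le_less_trans)
  obtain D1 where D1: "D0 < D1" "D1 < D" using dense[OF D0'(2)] by blast
  define q where "q = sqrt (D1 / D0)"
  \<comment> \<open>Again \<open>q\<close> is lost twice: for \<open>ln (c (n + 1))\<close> and for the sum.\<close>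
  have q: "1 < q" "q * q * D0 = D1" using D1 D0' by (auto simp: q_def)
  have q': "1 < sqrt q" "sqrt q < q" using q real_sqrt_less_mono[of q "q * q"] by auto
  have e1: "\<forall>\<^sub>F n in sequentially. (\<Sum>i=1..n. \<psi> i) \<le> q * (\<Sum>i=1..n. ln (real (c i)))"
    using E_lim_ln_bounds(2)[OF x pos q'(1)] sum_c q'(2) unfolding c_def by (rule eventually_sum_le)
  have e2: "\<forall>\<^sub>F n in sequentially. ln (real (c (Suc n))) \<le> q * \<psi> (Suc n)"
    using E_lim_ln_bounds(1)[OF x pos q(1)] unfolding c_def by (rule eventually_compose_filterlim[OF _ filterlim_Suc])
  have e3: "\<forall>\<^sub>F n in sequentially. 1 \<le> (\<Sum>i=1..n. \<psi> i)"
    using filterlim_sum_at_top[OF \<psi>] by (simp add: filterlim_at_top)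
  have e4: "\<forall>\<^sub>F n in sequentially. ereal (\<psi> (n + 1) / (\<Sum>k=1..n. \<psi> k)) < ereal D0"
    using z D0 by (intro Limsup_lessD) simp
  have "\<forall>\<^sub>F n in sequentially. ln (real (c (n + 1))) \<le> D1 * (\<Sum>i=1..n. ln (real (c i)))"
    using e1 e2 e3 e4
  proof eventually_elim
    case (elim n)
    let ?S = "\<Sum>i=1..n. \<psi> i"
    have "ln (real (c (n + 1))) \<le> q * \<psi> (n + 1)" using elim(2) by simp
    also have "\<dots> \<le> q * (D0 * ?S)" using elim(3,4) q by (intro mult_left_mono) (auto simp: pos_divide_less_eq)
    also have "\<dots> \<le> q * (D0 * (q * (\<Sum>i=1..n. ln (real (c i)))))"
      using elim(1) q D0' by (intro mult_left_mono) auto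
    also have "\<dots> = (q * q * D0) * (\<Sum>i=1..n. ln (real (c i)))" by (simp only: mult_ac)
    finally show ?case unfolding q(2) .
  qed
  hence "ereal (1 / (D + 2)) \<le> hausdorff_dim {x \<in> Lambda. \<forall>n\<ge>1.
     (n + 1) * c n \<le> partial_quotient x n \<and> partial_quotient x n < (n + 2) * c n}"
    using c_ge c_mono c_fast D1 D0' by (intro hausdorff_dim_wide_blocks_ge[where D = D1]) auto
  also have "\<dots> \<le> hausdorff_dim (E_lim \<psi>)"
  proof (rule hausdorff_dim_mono, rule subsetI)
    fix y assume y: "y \<in> {x \<in> Lambda. \<forall>n\<ge>1.
     (n + 1) * c n \<le> partial_quotient x n \<and> partial_quotient x n < (n + 2) * c n}"
    have bds: "ln (real (c n)) \<le> ln (real (partial_quotient y n))"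
        "ln (real (partial_quotient y n)) \<le> ln (real (c n)) + ln (real n + 2)" if "1 \<le> n" for n
      using ln_wide_block_bounds[OF c_ge[OF that]] y that by auto
    have "(\<lambda>n. ln (real (partial_quotient y n)) / \<psi> n) \<longlonglongrightarrow> 1"
    proof (rule tendsto_sandwich)
      show "(\<lambda>n. ln (real (c n)) / \<psi> n) \<longlonglongrightarrow> 1" by (rule lim)
      have "(\<lambda>n. ln (real (c n)) / \<psi> n + ln (real n + 2) / \<psi> n) \<longlonglongrightarrow> 1 + 0"
        by (intro tendsto_add lim ln_shift_over_fast_tendsto_0 fast)
      thus "(\<lambda>n. (ln (real (c n)) + ln (real n + 2)) / \<psi> n) \<longlonglongrightarrow> 1" by (simp add: add_divide_distrib)
      show "\<forall>\<^sub>F n in sequentially. ln (real (c n)) / \<psi> n \<le> ln (real (partial_quotient y n)) / \<psi> n"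
        using eventually_ge_at_top[of 1]
      proof eventually_elim
        case (elim n)
        thus ?case using bds(1)[of n] pos[of n] by (intro divide_right_mono) auto
      qed
      show "\<forall>\<^sub>F n in sequentially. ln (real (partial_quotient y n)) / \<psi> n \<le> (ln (real (c n)) + ln (real n + 2)) / \<psi> n"
        using eventually_ge_at_top[of 1]
      proof eventually_elim
        case (elim n)
        thus ?case using bds(2)[of n] pos[of n] by (intro divide_right_mono) auto
      qed
    qed
    thus "y \<in> E_lim \<psi>" using y by (simp add: E_lim_def)
  qed
  finally show ?thesis .
qed

section \<open>Fast growth: the set of upper limits\<close>

text \<open>
  If the logarithm of the partial quotient with index \<open>k + 1\<close> were eventually below
  \<open>b - 1\<close> times the sum \<open>L k\<close> of the preceding logarithms, then \<open>L (k
  + 1) \<le> b * L k\<close>, so \<open>ln a\<^sub>n\<close> would be at most a multiple of \<open>b ^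
  n\<close>. This is negligible against \<open>B ^ n\<close>, and the upper limit would be 0.
\<close>

lemma E_sup_large_quotients:
  assumes pos: "\<And>n. n \<ge> 1 \<Longrightarrow> \<psi> n > 0" and x: "x \<in> E_sup \<psi>"
    and b: "1 \<le> b" "b < B" and growth: "\<forall>\<^sub>F n in sequentially. B ^ n \<le> \<psi> n"
  shows "\<exists>\<^sub>F k in sequentially. (b - 1) * (\<Sum>i=1..k. ln (real (partial_quotient x i))) \<le> ln (real (partial_quotient x (k + 1)))"
proof (rule ccontr)
  let ?a = "\<lambda>n. ln (real (partial_quotient x n))"
  let ?L = "\<lambda>k. \<Sum>i=1..k. ?a i"
  assume "\<not> ?thesis"
  then obtain N where N: "\<And>k. N \<le> k \<Longrightarrow> ?a (k + 1) < (b - 1) * ?L k"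
    unfolding not_frequently eventually_sequentially not_le by blast
  have L_nn: "0 \<le> ?L k" for k by (intro sum_nonneg ln_partial_quotient_nonneg)
  have "?L k \<le> b ^ k * ?L N" if "N \<le> k" for k
    using that
  proof (induction k rule: dec_induct)
    case base
    have "1 * ?L N \<le> b ^ N * ?L N" using b L_nn by (intro mult_right_mono one_le_power) auto
    thus ?case by simp
  next
    case (step k)
    have "?L (Suc k) \<le> b * ?L k" using N[OF step(1)] by (simp add: algebra_simps)
    also have "\<dots> \<le> b * (b ^ k * ?L N)" using step b by (intro mult_left_mono) auto
    finally show ?case by simp
  qed note L_le = this
  have "(\<lambda>n. ?a n / \<psi> n) \<longlonglongrightarrow> 0"
  proof (rule Lim_null_comparison)
    show "(\<lambda>n. ?L N * (b / B) ^ n) \<longlonglongrightarrow> 0"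
      using b by (intro tendsto_mult_right_zero LIMSEQ_realpow_zero) auto
    show "\<forall>\<^sub>F n in sequentially. norm (?a n / \<psi> n) \<le> ?L N * (b / B) ^ n"
      using growth eventually_ge_at_top[of "max 1 N"]
    proof eventually_elim
      case (elim n)
      have "?a n \<le> ?L n" using elim by (intro member_le_sum ln_partial_quotient_nonneg) auto
      also have "\<dots> \<le> b ^ n * ?L N" using L_le elim by simp
      finally have "?a n / \<psi> n \<le> (b ^ n * ?L N) / B ^ n"
        using elim b L_nn ln_partial_quotient_nonneg by (intro frac_le) auto
      moreover have "0 < \<psi> n" using pos elim by simp
      ultimately show ?case using ln_partial_quotient_nonneg[of x n] by (simp add: power_divide mult.commute)
    qed
  qed
  thus False using E_sup_not_tendsto_0[OF x] by contradiction
qed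

lemma hausdorff_dim_E_sup_le_fast_growth:
  assumes pos: "\<And>n. n \<ge> 1 \<Longrightarrow> \<psi> n > 0" and \<psi>: "filterlim \<psi> at_top sequentially"
    and b: "1 \<le> b" and L: "b = 1 \<or> ereal (ln b) < liminf (\<lambda>n. ereal (ln (\<psi> n) / real n))"
  shows "hausdorff_dim (E_sup \<psi>) \<le> ereal (1 / (b + 1))"
proof (rule hausdorff_dim_le_of_large_quotients[OF b])
  show "E_sup \<psi> \<subseteq> irrational_unit" using Lambda_irrational_unit by (auto simp: E_sup_def)
  fix x assume x: "x \<in> E_sup \<psi>"
  show "filterlim (partial_quotient x) at_top sequentially" using x \<psi> by (rule E_sup_partial_quotient_at_top)
  show "\<exists>\<^sub>F k in sequentially. (b - 1) * (\<Sum>i=1..k. ln (real (partial_quotient x i))) \<le> ln (real (partial_quotient x (k + 1)))"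
  proof (cases "b = 1")
    case True
    thus ?thesis using ln_partial_quotient_nonneg by (intro frequently_True_sequentially) simp
  next
    case False
    then obtain z where z: "ereal (ln b) < z" "z < liminf (\<lambda>n. ereal (ln (\<psi> n) / real n))"
      using L dense by blast
    then obtain y where y: "z = ereal y" by (cases z) auto
    have "\<forall>\<^sub>F n in sequentially. ereal y < ereal (ln (\<psi> n) / real n)"
      using z(2) y by (intro less_LiminfD) simp
    hence growth: "\<forall>\<^sub>F n in sequentially. exp y ^ n \<le> \<psi> n"
      using eventually_ge_at_top[of 1]
    proof eventually_elim
      case (elim n)
      hence "y * real n \<le> ln (\<psi> n)" by (simp add: pos_less_divide_eq)
      hence "exp (y * real n) \<le> exp (ln (\<psi> n))" by simp
      thus ?case using pos[of n] elim by (simp add: exp_of_nat2_mult)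
    qed
    have "ln b < y" using z(1) y by simp
    hence "exp (ln b) < exp y" by simp
    hence "b < exp y" using b by simp
    with pos x b show ?thesis using growth by (rule E_sup_large_quotients)
  qed
qed

text \<open>
  The hypothesis makes \<open>\<psi> k / B ^ k\<close> arbitrarily small. Choose \<open>n1\<close> as
  the first index at which \<open>\<psi> k / B ^ k\<close> drops below its minimum over a long initial
  segment, and then \<open>n\<close> as a minimum point of \<open>\<psi>\<close> on the indices from
  \<open>n1\<close> on. The first choice handles the \<open>k < n1\<close> and the second one the
  \<open>k \<ge> n1\<close>; there \<open>n - k\<close> is truncated to 0 when \<open>k > n\<close>.
\<close>

lemma frequently_running_minimum:
  fixes \<psi> :: "nat \<Rightarrow> real"
  assumes pos: "\<And>n. n \<ge> 1 \<Longrightarrow> \<psi> n > 0" and \<psi>: "filterlim \<psi> at_top sequentially"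
    and B: "1 < B0" "B0 < B" and freq: "\<exists>\<^sub>F n in sequentially. \<psi> n < B0 ^ n"
  shows "\<exists>\<^sub>F n in sequentially. \<forall>k\<ge>1. \<psi> n \<le> \<psi> k * B ^ (n - k)"
  unfolding frequently_sequentially
proof
  fix N :: nat
  define g where "g k = \<psi> k / B ^ k" for k
  define e where "e = Min (g ` {1..Suc N})"
  have g_pos: "0 < g k" if "1 \<le> k" for k using pos[OF that] B by (simp add: g_def)
  have "0 < e" unfolding e_def using g_pos by (subst Min_gr_iff) auto
  have e_le: "e \<le> g k" if "1 \<le> k" "k \<le> Suc N" for k unfolding e_def using that by (intro Min_le) auto
  have "(\<lambda>n. (B0 / B) ^ n) \<longlonglongrightarrow> 0" using B by (intro LIMSEQ_realpow_zero) auto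
  hence "\<forall>\<^sub>F n in sequentially. (B0 / B) ^ n < e" using \<open>0 < e\<close> by (rule order_tendstoD)
  hence "\<forall>\<^sub>F n in sequentially. (B0 / B) ^ n < e \<and> 1 \<le> n"
    by (intro eventually_conj eventually_ge_at_top)
  with freq have "\<exists>\<^sub>F n in sequentially. \<psi> n < B0 ^ n \<and> (B0 / B) ^ n < e \<and> 1 \<le> n"
    by (rule frequently_conj_eventually)
  then obtain n0 where n0: "\<psi> n0 < B0 ^ n0" "(B0 / B) ^ n0 < e" "1 \<le> n0"
    using frequently_ex by blast
  have "g n0 < e"
  proof -
    have "g n0 < B0 ^ n0 / B ^ n0" unfolding g_def using n0(1) B by (intro divide_strict_right_mono) auto
    thus ?thesis using n0(2) by (simp add: power_divide)
  qed
  define n1 where "n1 = (LEAST n. 1 \<le> n \<and> g n < e)"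
  have n1: "1 \<le> n1" "g n1 < e"
    using LeastI[of "\<lambda>n. 1 \<le> n \<and> g n < e" n0] n0 \<open>g n0 < e\<close> by (auto simp: n1_def)
  have least: "e \<le> g k" if "1 \<le> k" "k < n1" for k
    using not_less_Least[of k "\<lambda>n. 1 \<le> n \<and> g n < e"] that by (auto simp: n1_def)
  have "N < n1" using e_le[of n1] n1 by (cases "N < n1") auto
  define S where "S = {k. n1 \<le> k \<and> \<psi> k \<le> \<psi> n1}"
  have "\<forall>\<^sub>F k in sequentially. \<psi> n1 < \<psi> k" using \<psi> by (simp add: filterlim_at_top_dense)
  then obtain M where M: "\<And>k. M \<le> k \<Longrightarrow> \<psi> n1 < \<psi> k" unfolding eventually_sequentially by blast
  have "S \<subseteq> {..M}"
  proof
    fix k assume "k \<in> S"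
    thus "k \<in> {..M}" using M[of k] by (cases "M \<le> k") (auto simp: S_def)
  qed
  hence "finite S" by (rule finite_subset) simp
  moreover have "n1 \<in> S" by (simp add: S_def)
  ultimately have "\<exists>n\<in>S. \<forall>k\<in>S. \<psi> n \<le> \<psi> k"
    using ex_min_if_finite[of "\<psi> ` S"] by (fastforce simp: not_less)
  then obtain n where n: "n \<in> S" "\<And>k. k \<in> S \<Longrightarrow> \<psi> n \<le> \<psi> k" by blast
  have n_le: "\<psi> n \<le> \<psi> n1" "n1 \<le> n" using n(1) by (auto simp: S_def)
  have "\<psi> n \<le> \<psi> k * B ^ (n - k)" if k: "1 \<le> k" for k
  proof (cases "n1 \<le> k")
    case True
    have "\<psi> n \<le> \<psi> k" using n(2)[of k] n_le True by (cases "k \<in> S") (auto simp: S_def)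
    also have "\<psi> k * 1 \<le> \<psi> k * B ^ (n - k)" using B pos[OF k] by (intro mult_left_mono one_le_power) auto
    finally show ?thesis by simp
  next
    case False
    have "g n1 < g k" using least[OF k] n1 False by simp
    hence "\<psi> n1 < \<psi> k / B ^ k * B ^ n1" using B by (simp add: g_def divide_simps)
    also have "\<dots> = \<psi> k * B ^ (n1 - k)" using B False by (simp add: power_diff)
    also have "\<dots> \<le> \<psi> k * B ^ (n - k)" using B pos[OF k] n_le by (intro mult_left_mono power_increasing) auto
    finally show ?thesis using n_le by simp
  qed
  moreover have "N \<le> n" using \<open>N < n1\<close> n_le by simp
  ultimately show "\<exists>n\<ge>N. \<forall>k\<ge>1. \<psi> n \<le> \<psi> k * B ^ (n - k)" by blast
qed

text \<open>
  The largest nondecreasing minorant of \<open>\<psi>\<close> that grows at most by the factor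
  \<open>B\<close> in each step. The truncated difference \<open>n - k\<close> makes the terms with
  \<open>k \<ge> n\<close> equal to \<open>\<psi> k\<close>, which enforces monotonicity, and the
  terms with \<open>k < n\<close> limit the growth.
\<close>

definition regularised :: "real \<Rightarrow> (nat \<Rightarrow> real) \<Rightarrow> nat \<Rightarrow> real" where
  "regularised B \<psi> n = (INF k\<in>{1..}. \<psi> k * B ^ (n - k))"

context
  fixes \<psi> :: "nat \<Rightarrow> real" and B :: real
  assumes pos: "\<And>n. n \<ge> 1 \<Longrightarrow> \<psi> n > 0" and B: "1 < B"
begin

lemma regularised_lower: "1 \<le> k \<Longrightarrow> regularised B \<psi> n \<le> \<psi> k * B ^ (n - k)"
  unfolding regularised_def using pos B
  by (intro cINF_lower bdd_belowI2[of _ 0]) (auto intro!: mult_nonneg_nonneg less_imp_le)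

lemma regularised_greatest: "(\<And>k. 1 \<le> k \<Longrightarrow> y \<le> \<psi> k * B ^ (n - k)) \<Longrightarrow> y \<le> regularised B \<psi> n"
  unfolding regularised_def by (intro cINF_greatest) auto

lemma regularised_le: "1 \<le> n \<Longrightarrow> regularised B \<psi> n \<le> \<psi> n"
  using regularised_lower[of n n] by simp

lemma regularised_nonneg: "0 \<le> regularised B \<psi> n"
  using pos B by (intro regularised_greatest mult_nonneg_nonneg) (auto intro: less_imp_le)

lemma regularised_mono: "regularised B \<psi> n \<le> regularised B \<psi> (n + 1)"
proof (rule regularised_greatest)
  fix k :: nat assume k: "1 \<le> k"
  have "regularised B \<psi> n \<le> \<psi> k * B ^ (n - k)" by (rule regularised_lower[OF k])
  also have "\<dots> \<le> \<psi> k * B ^ (n + 1 - k)"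
    using pos[OF k] B by (intro mult_left_mono power_increasing) auto
  finally show "regularised B \<psi> n \<le> \<psi> k * B ^ (n + 1 - k)" .
qed

lemma regularised_Suc_le: "regularised B \<psi> (n + 1) \<le> B * regularised B \<psi> n"
proof -
  have "regularised B \<psi> (n + 1) / B \<le> regularised B \<psi> n"
  proof (rule regularised_greatest)
    fix k :: nat assume k: "1 \<le> k"
    have "regularised B \<psi> (n + 1) \<le> \<psi> k * B ^ (n + 1 - k)" by (rule regularised_lower[OF k])
    also have "\<dots> \<le> \<psi> k * B ^ (Suc (n - k))"
      using pos[OF k] B by (intro mult_left_mono power_increasing) auto
    finally show "regularised B \<psi> (n + 1) / B \<le> \<psi> k * B ^ (n - k)" using B by (simp add: pos_divide_le_eq mult_ac)
  qed
  thus ?thesis using B by (simp add: pos_divide_le_eq mult.commute)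
qed

text \<open>
  Summing \<open>\<phi> (i + 1) - \<phi> i \<le> (B - 1) * \<phi> i\<close> for the regularised
  function \<open>\<phi>\<close>. This is the growth condition of the block construction with the
  constant \<open>B - 1\<close>.
\<close>

lemma regularised_Suc_le_sum:
  "regularised B \<psi> (n + 1) \<le> (B - 1) * (\<Sum>i=1..n. regularised B \<psi> i) + regularised B \<psi> 1"
proof (induction n)
  case (Suc n)
  thus ?case using regularised_Suc_le[of "Suc n"] by (simp add: algebra_simps)
qed simp

text \<open>
  Terms with \<open>k\<^sup>2 \<ge> n\<close> are large since \<open>ln k\<close> is then at least
  half of \<open>ln n\<close>. Terms with \<open>k\<^sup>2 < n\<close> have \<open>n - k \<ge> n /
  2\<close> and are exponentially large.
\<close>

lemma regularised_fast:
  assumes \<psi>: "filterlim \<psi> at_top sequentially"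
    and fast: "filterlim (\<lambda>n. \<psi> n / ln (real n)) at_top sequentially"
  shows "filterlim (\<lambda>n. regularised B \<psi> n / ln (real n)) at_top sequentially"
  unfolding filterlim_at_top
proof
  fix M0 :: real
  define M where "M = max M0 0"
  obtain \<mu> where \<mu>: "0 < \<mu>" "\<And>k. 1 \<le> k \<Longrightarrow> \<mu> \<le> \<psi> k"
  proof -
    have "\<forall>\<^sub>F n in sequentially. 1 \<le> \<psi> n" using \<psi> by (simp add: filterlim_at_top)
    then obtain K where K: "\<And>k. K \<le> k \<Longrightarrow> 1 \<le> \<psi> k" unfolding eventually_sequentially by blast
    let ?m = "Min (insert 1 (\<psi> ` {1..K}))"
    have "0 < ?m" using pos by (subst Min_gr_iff) auto
    moreover have "?m \<le> \<psi> k" if "1 \<le> k" for k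
    proof (cases "k \<le> K")
      case True
      thus ?thesis using that by (intro Min_le) auto
    next
      case False
      have "?m \<le> 1" by (intro Min_le) auto
      thus ?thesis using K[of k] False by linarith
    qed
    ultimately show thesis by (rule that)
  qed
  have "\<forall>\<^sub>F k in sequentially. 2 * M \<le> \<psi> k / ln (real k)" using fast by (simp add: filterlim_at_top)
  moreover have "\<forall>\<^sub>F k::nat in sequentially. 0 < ln (real k)" by real_asymp
  ultimately have "\<forall>\<^sub>F k in sequentially. 2 * M * ln (real k) \<le> \<psi> k"
    by eventually_elim (simp add: pos_le_divide_eq)
  then obtain N where N: "\<And>k. N \<le> k \<Longrightarrow> 2 * M * ln (real k) \<le> \<psi> k" unfolding eventually_sequentially by blast
  have "\<forall>\<^sub>F n::nat in sequentially. M * ln (real n) \<le> \<mu> * B powr (real n / 2)"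
  proof -
    have "(\<lambda>n::nat. M * ln (real n) / (\<mu> * B powr (real n / 2))) \<longlonglongrightarrow> 0" using \<mu>(1) B by real_asymp
    hence "\<forall>\<^sub>F n in sequentially. M * ln (real n) / (\<mu> * B powr (real n / 2)) < 1" by (rule order_tendstoD) simp
    thus ?thesis by eventually_elim (use \<mu>(1) B in \<open>simp add: divide_simps split: if_splits\<close>)
  qed
  moreover have "\<forall>\<^sub>F n::nat in sequentially. 0 < ln (real n)" by real_asymp
  ultimately show "\<forall>\<^sub>F n in sequentially. M0 \<le> regularised B \<psi> n / ln (real n)"
    using eventually_ge_at_top[of "max 4 (N\<^sup>2)"]
  proof eventually_elim
    case (elim n)
    have "M * ln (real n) \<le> regularised B \<psi> n"
    proof (rule regularised_greatest)
      fix k :: nat assume k: "1 \<le> k"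
      show "M * ln (real n) \<le> \<psi> k * B ^ (n - k)"
      proof (cases "n \<le> k\<^sup>2")
        case True
        have "N\<^sup>2 \<le> n" using elim by simp
        hence "N\<^sup>2 \<le> k\<^sup>2" using True by (rule order_trans)
        hence "N \<le> k" by (rule power2_le_imp_le) simp
        have "real n \<le> (real k)\<^sup>2" using True by (metis of_nat_le_iff of_nat_power)
        hence "ln (real n) \<le> ln ((real k)\<^sup>2)" using elim by (intro ln_mono) auto
        also have "\<dots> = 2 * ln (real k)" using k by (simp add: ln_realpow)
        finally have "M * ln (real n) \<le> M * (2 * ln (real k))" by (intro mult_left_mono) (auto simp: M_def)
        also have "\<dots> \<le> \<psi> k" using N[OF \<open>N \<le> k\<close>] by simp
        also have "\<psi> k * 1 \<le> \<psi> k * B ^ (n - k)" using B pos[OF k] by (intro mult_left_mono one_le_power) auto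
        finally show ?thesis by simp
      next
        case False
        have "2 * k \<le> n"
        proof (rule ccontr)
          assume "\<not> 2 * k \<le> n"
          hence "2 * k > n" by simp
          hence "4 * k\<^sup>2 > n * n" using mult_strict_mono[of n "2 * k" n "2 * k"] elim by (simp add: power2_eq_square)
          moreover have "4 * n \<le> n * n" using elim by simp
          ultimately show False using False by linarith
        qed
        hence "real n / 2 \<le> real (n - k)" by linarith
        hence "B powr (real n / 2) \<le> B powr (real (n - k))" using B by (intro powr_mono) auto
        also have "\<dots> = B ^ (n - k)" using B by (simp add: powr_realpow)
        finally have "\<mu> * B powr (real n / 2) \<le> \<psi> k * B ^ (n - k)"
          using \<mu>(1) \<mu>(2)[OF k] by (intro mult_mono) auto
        thus ?thesis using elim by linarith
      qed
    qed
    moreover have "M0 * ln (real n) \<le> M * ln (real n)" using elim by (intro mult_right_mono) (auto simp: M_def)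
    ultimately have "M0 * ln (real n) \<le> regularised B \<psi> n" by linarith
    thus ?case using elim by (simp add: pos_le_divide_eq)
  qed
qed

end

lemma liminf_ln_over_index_nonneg:
  fixes \<psi> :: "nat \<Rightarrow> real"
  assumes \<psi>: "filterlim \<psi> at_top sequentially"
  shows "0 \<le> liminf (\<lambda>n. ereal (ln (\<psi> n) / real n))"
proof (rule Liminf_bounded)
  have "\<forall>\<^sub>F n in sequentially. 1 \<le> \<psi> n" using \<psi> by (simp add: filterlim_at_top)
  thus "\<forall>\<^sub>F n in sequentially. 0 \<le> ereal (ln (\<psi> n) / real n)" by eventually_elim simp
qed

text \<open>
  Only an upper limit is prescribed, so the partial quotients may follow the regularised function
  \<open>\<phi>\<close> in place of \<open>\<psi>\<close>: it stays below \<open>\<psi>\<close> and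
  touches it infinitely often. Its growth rate \<open>B\<close> can be taken between the exponential
  of the lower limit and \<open>D + 1\<close>; the lower limit lying below \<open>ln B\<close> is what
  makes \<open>\<phi>\<close> touch \<open>\<psi>\<close>.
\<close>

lemma hausdorff_dim_E_sup_ge_fast_growth:
  assumes pos: "\<And>n. n \<ge> 1 \<Longrightarrow> \<psi> n > 0" and \<psi>: "filterlim \<psi> at_top sequentially"
    and fast: "filterlim (\<lambda>n. \<psi> n / ln (real n)) at_top sequentially"
    and D: "0 < D" and L: "liminf (\<lambda>n. ereal (ln (\<psi> n) / real n)) < ereal (ln (D + 1))"
  shows "ereal (1 / (D + 2)) \<le> hausdorff_dim (E_sup \<psi>)"
proof -
  have L0: "0 \<le> liminf (\<lambda>n. ereal (ln (\<psi> n) / real n))"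
    using \<psi> by (rule liminf_ln_over_index_nonneg)
  obtain z where z: "liminf (\<lambda>n. ereal (ln (\<psi> n) / real n)) < z" "z < ereal (ln (D + 1))"
    using L dense by blast
  then obtain y where y: "z = ereal y" using L0 by (cases z) auto
  have y': "0 < y" "y < ln (D + 1)" using z L0 y by (auto dest: le_less_trans)
  obtain y2 where y2: "y < y2" "y2 < ln (D + 1)" using dense[OF y'(2)] by blast
  define B0 where "B0 = exp y"
  define B where "B = exp y2"
  have B: "1 < B0" "B0 < B" using y' y2 by (auto simp: B0_def B_def)
  have "exp y2 < exp (ln (D + 1))" using y2 by simp
  hence BD: "B < D + 1" using D by (simp add: B_def)
  have B1: "1 < B" using B by simp
  have "\<exists>\<^sub>F n in sequentially. ereal (ln (\<psi> n) / real n) < ereal y"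
    using z(1) unfolding y by (rule frequently_Liminf_less)
  hence "\<exists>\<^sub>F n in sequentially. ereal (ln (\<psi> n) / real n) < ereal y \<and> 1 \<le> n"
    by (rule frequently_conj_eventually) (rule eventually_ge_at_top)
  hence "\<exists>\<^sub>F n in sequentially. \<psi> n < B0 ^ n"
  proof (rule frequently_elim1)
    fix n assume n: "ereal (ln (\<psi> n) / real n) < ereal y \<and> 1 \<le> n"
    hence "0 < real n" "ln (\<psi> n) / real n < y" by auto
    hence "ln (\<psi> n) < y * real n" by (simp add: pos_divide_less_eq)
    hence "exp (ln (\<psi> n)) < exp (y * real n)" by simp
    thus "\<psi> n < B0 ^ n" using pos[of n] n by (simp add: B0_def exp_of_nat2_mult)
  qed
  hence freq: "\<exists>\<^sub>F n in sequentially. \<forall>k\<ge>1. \<psi> n \<le> \<psi> k * B ^ (n - k)"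
    using pos \<psi> B by (intro frequently_running_minimum) auto
  define \<phi> where "\<phi> = regularised B \<psi>"
  have \<phi>_le: "\<phi> n \<le> \<psi> n" if "1 \<le> n" for n
    unfolding \<phi>_def using pos B1 that by (rule regularised_le)
  have \<phi>_nn: "0 \<le> \<phi> n" for n unfolding \<phi>_def using pos B1 by (rule regularised_nonneg)
  have \<phi>_fast: "filterlim (\<lambda>n. \<phi> n / ln (real n)) at_top sequentially"
    unfolding \<phi>_def using pos B1 \<psi> fast by (rule regularised_fast)
  have \<phi>_lim: "filterlim \<phi> at_top sequentially"
  proof -
    have "filterlim (\<lambda>n. \<phi> n / ln (real n) * ln (real n)) at_top sequentially"
      by (intro filterlim_at_top_mult_at_top \<phi>_fast) real_asymp
    moreover have "\<forall>\<^sub>F n in sequentially. \<phi> n / ln (real n) * ln (real n) = \<phi> n"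
    proof -
      have "\<forall>\<^sub>F n::nat in sequentially. 0 < ln (real n)" by real_asymp
      thus ?thesis by eventually_elim simp
    qed
    ultimately show ?thesis using filterlim_cong[OF refl refl] by fast
  qed
  have \<phi>_freq: "\<exists>\<^sub>F n in sequentially. \<phi> n = \<psi> n"
  proof -
    have "\<exists>\<^sub>F n in sequentially. (\<forall>k\<ge>1. \<psi> n \<le> \<psi> k * B ^ (n - k)) \<and> 1 \<le> n"
      using freq by (rule frequently_conj_eventually) (rule eventually_ge_at_top)
    thus ?thesis
    proof (rule frequently_elim1)
      fix n assume n: "(\<forall>k\<ge>1. \<psi> n \<le> \<psi> k * B ^ (n - k)) \<and> 1 \<le> n"
      hence "\<psi> n \<le> \<phi> n" unfolding \<phi>_def using pos B1 by (intro regularised_greatest) auto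
      thus "\<phi> n = \<psi> n" using \<phi>_le n by (simp add: antisym)
    qed
  qed
  define c where "c n = nat \<lfloor>exp (\<phi> n)\<rfloor>" for n
  have c_bds: "1 \<le> c n" "ln (real (c n)) \<le> \<phi> n" "\<phi> n - ln 2 \<le> ln (real (c n))" for n
  proof -
    have "1 \<le> exp (\<phi> n)" using \<phi>_nn by simp
    hence "1 \<le> \<lfloor>exp (\<phi> n)\<rfloor>" by (simp only: one_le_floor)
    hence c: "real (c n) \<le> exp (\<phi> n)" "exp (\<phi> n) \<le> 2 * real (c n)" "1 \<le> c n"
      unfolding c_def by linarith+
    thus "1 \<le> c n" by simp
    have "ln (real (c n)) \<le> ln (exp (\<phi> n))" using c by (intro ln_mono) auto
    thus "ln (real (c n)) \<le> \<phi> n" by simp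
    have "ln (exp (\<phi> n)) \<le> ln (2 * real (c n))" using c by (intro ln_mono) auto
    also have "\<dots> = ln 2 + ln (real (c n))" using c by (intro ln_mult_pos) auto
    finally show "\<phi> n - ln 2 \<le> ln (real (c n))" by simp
  qed
  have c_mono: "c n \<le> c (n + 1)" for n
    unfolding c_def \<phi>_def using regularised_mono[of \<psi> B n] pos B1 by (intro nat_mono floor_mono) simp
  have c_lim: "filterlim (\<lambda>n. ln (real (c n))) at_top sequentially"
  proof (rule filterlim_at_top_mono)
    show "filterlim (\<lambda>n. - ln 2 + \<phi> n) at_top sequentially"
      by (rule filterlim_tendsto_add_at_top[OF tendsto_const \<phi>_lim])
    show "\<forall>\<^sub>F n in sequentially. - ln 2 + \<phi> n \<le> ln (real (c n))"
      using c_bds(3) by (intro always_eventually allI) (simp add: algebra_simps)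
  qed
  have ratio: "(\<lambda>n. ln (real (c n)) / \<phi> n) \<longlonglongrightarrow> 1"
  proof (rule tendsto_sandwich)
    have "(\<lambda>n. 1 - ln 2 / \<phi> n) \<longlonglongrightarrow> 1 - 0"
      by (intro tendsto_diff tendsto_const real_tendsto_divide_at_top[OF tendsto_const \<phi>_lim])
    thus "(\<lambda>n. 1 - ln 2 / \<phi> n) \<longlonglongrightarrow> 1" by simp
    have p: "\<forall>\<^sub>F n in sequentially. 0 < \<phi> n" using \<phi>_lim by (simp add: filterlim_at_top_dense)
    show "\<forall>\<^sub>F n in sequentially. 1 - ln 2 / \<phi> n \<le> ln (real (c n)) / \<phi> n"
      using p
    proof eventually_elim
      case (elim n)
      have "(\<phi> n - ln 2) / \<phi> n \<le> ln (real (c n)) / \<phi> n" using c_bds(3)[of n] elim by (intro divide_right_mono) auto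
      thus ?case using elim by (simp add: diff_divide_distrib)
    qed
    show "\<forall>\<^sub>F n in sequentially. ln (real (c n)) / \<phi> n \<le> 1"
      using p by eventually_elim (use c_bds(2) in \<open>simp add: pos_divide_le_eq\<close>)
  qed simp
  have c_fast: "filterlim (\<lambda>n. ln (real (c n)) / ln (real n)) at_top sequentially"
  proof -
    have "filterlim (\<lambda>n. (ln (real (c n)) / \<phi> n) * (\<phi> n / ln (real n))) at_top sequentially"
      by (rule filterlim_tendsto_pos_mult_at_top[OF ratio _ \<phi>_fast]) simp
    moreover have "\<forall>\<^sub>F n in sequentially. 0 < \<phi> n" using \<phi>_lim by (simp add: filterlim_at_top_dense)
    hence "\<forall>\<^sub>F n in sequentially. (ln (real (c n)) / \<phi> n) * (\<phi> n / ln (real n)) = ln (real (c n)) / ln (real n)"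
      by eventually_elim simp
    ultimately show ?thesis using filterlim_cong[OF refl refl] by fast
  qed
  obtain D1 where D1: "B - 1 < D1" "D1 < D" using dense[of "B - 1" D] BD by auto
  obtain D2 where D2: "B - 1 < D2" "D2 < D1" using dense[OF D1(1)] by blast
  \<comment> \<open>The passage from \<open>\<phi>\<close> to \<open>ln (c i)\<close> raises \<open>B - 1\<close> to \<open>D2\<close>, and the additive constant \<open>\<phi> 1\<close> raises
    \<open>D2\<close> to \<open>D1\<close>.\<close>
  define q where "q = D2 / (B - 1)"
  have q: "1 < q" "(B - 1) * q = D2" using D2 B1 by (auto simp: q_def)
  have q': "1 < sqrt q" "sqrt q < q" using q real_sqrt_less_mono[of q "q * q"] by auto
  have sum_c: "filterlim (\<lambda>n. \<Sum>i=1..n. ln (real (c i))) at_top sequentially"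
    by (rule filterlim_sum_at_top[OF c_lim])
  have "1 / sqrt q < 1" using q' by simp
  with ratio have "\<forall>\<^sub>F n in sequentially. 1 / sqrt q < ln (real (c n)) / \<phi> n" by (rule order_tendstoD)
  moreover have "\<forall>\<^sub>F n in sequentially. 0 < \<phi> n" using \<phi>_lim by (simp add: filterlim_at_top_dense)
  ultimately have "\<forall>\<^sub>F n in sequentially. \<phi> n \<le> sqrt q * ln (real (c n))"
  proof eventually_elim
    case (elim n)
    hence "1 / sqrt q * \<phi> n < ln (real (c n))" by (simp only: pos_less_divide_eq)
    thus ?case using q' by (simp add: field_simps)
  qed
  hence e1: "\<forall>\<^sub>F n in sequentially. (\<Sum>i=1..n. \<phi> i) \<le> q * (\<Sum>i=1..n. ln (real (c i)))"
    using sum_c q'(2) by (rule eventually_sum_le)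
  have e2: "\<forall>\<^sub>F n in sequentially. \<phi> 1 / (D1 - D2) \<le> (\<Sum>i=1..n. ln (real (c i)))"
    using sum_c by (simp add: filterlim_at_top)
  have "\<forall>\<^sub>F n in sequentially. ln (real (c (n + 1))) \<le> D1 * (\<Sum>i=1..n. ln (real (c i)))"
    using e1 e2
  proof eventually_elim
    case (elim n)
    let ?S = "\<Sum>i=1..n. ln (real (c i))"
    have "ln (real (c (n + 1))) \<le> \<phi> (n + 1)" by (rule c_bds)
    also have "\<dots> \<le> (B - 1) * (\<Sum>i=1..n. \<phi> i) + \<phi> 1"
      unfolding \<phi>_def using pos B1 by (rule regularised_Suc_le_sum)
    also have "\<dots> \<le> (B - 1) * (q * ?S) + (D1 - D2) * ?S"
      using elim B1 D2 by (intro add_mono mult_left_mono) (auto simp: pos_divide_le_eq mult.commute)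
    also have "(B - 1) * (q * ?S) = D2 * ?S" unfolding q(2)[symmetric] by (simp only: mult.assoc)
    finally show ?case by (simp add: algebra_simps)
  qed
  hence "ereal (1 / (D + 2)) \<le> hausdorff_dim {x \<in> Lambda. \<forall>n\<ge>1.
     (n + 1) * c n \<le> partial_quotient x n \<and> partial_quotient x n < (n + 2) * c n}"
    using c_bds(1) c_mono c_fast D1 B1 by (intro hausdorff_dim_wide_blocks_ge[where D = D1]) auto
  also have "\<dots> \<le> hausdorff_dim (E_sup \<psi>)"
  proof (rule hausdorff_dim_mono, rule subsetI)
    fix x assume x: "x \<in> {x \<in> Lambda. \<forall>n\<ge>1.
     (n + 1) * c n \<le> partial_quotient x n \<and> partial_quotient x n < (n + 2) * c n}"
    let ?a = "\<lambda>n. ln (real (partial_quotient x n))"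
    have bds: "ln (real (c n)) \<le> ?a n" "?a n \<le> ln (real (c n)) + ln (real n + 2)" if "1 \<le> n" for n
      using ln_wide_block_bounds[OF c_bds(1)] x that by auto
    have p: "\<forall>\<^sub>F n in sequentially. 0 < \<phi> n" using \<phi>_lim by (simp add: filterlim_at_top_dense)
    have "limsup (\<lambda>n. ereal (?a n / \<psi> n)) \<le> 1"
    proof -
      have "(\<lambda>n. ln (real (c n)) / \<phi> n + ln (real n + 2) / \<phi> n) \<longlonglongrightarrow> 1 + 0"
        by (intro tendsto_add ratio ln_shift_over_fast_tendsto_0 \<phi>_fast)
      hence "limsup (\<lambda>n. ereal (ln (real (c n)) / \<phi> n + ln (real n + 2) / \<phi> n)) = ereal (1 + 0)"
        by (intro lim_imp_Limsup tendsto_ereal) auto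
      moreover have "limsup (\<lambda>n. ereal (?a n / \<psi> n)) \<le> limsup (\<lambda>n. ereal (ln (real (c n)) / \<phi> n + ln (real n + 2) / \<phi> n))"
      proof (rule Limsup_mono)
        show "\<forall>\<^sub>F n in sequentially. ereal (?a n / \<psi> n) \<le> ereal (ln (real (c n)) / \<phi> n + ln (real n + 2) / \<phi> n)"
          using p eventually_ge_at_top[of 1]
        proof eventually_elim
          case (elim n)
          have "?a n / \<psi> n \<le> ?a n / \<phi> n"
            using elim \<phi>_le ln_partial_quotient_nonneg[of x n] by (intro divide_left_mono mult_pos_pos pos) auto
          also have "\<dots> \<le> (ln (real (c n)) + ln (real n + 2)) / \<phi> n"
            using elim bds(2) by (intro divide_right_mono) auto
          finally show ?case by (simp add: add_divide_distrib)
        qed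
      qed
      ultimately show ?thesis by (simp add: one_ereal_def)
    qed
    moreover have "1 \<le> limsup (\<lambda>n. ereal (?a n / \<psi> n))"
    proof (rule le_Limsup_of_frequently)
      fix r :: ereal assume r: "r < 1"
      have "(\<lambda>n. ereal (ln (real (c n)) / \<phi> n)) \<longlonglongrightarrow> ereal 1" using ratio by (rule tendsto_ereal)
      hence "\<forall>\<^sub>F n in sequentially. r < ereal (ln (real (c n)) / \<phi> n)"
        using r by (intro order_tendstoD) (auto simp: one_ereal_def)
      with p eventually_ge_at_top[of 1]
      have "\<forall>\<^sub>F n in sequentially. 0 < \<phi> n \<and> 1 \<le> n \<and> r < ereal (ln (real (c n)) / \<phi> n)"
        by eventually_elim simp
      with \<phi>_freq have "\<exists>\<^sub>F n in sequentially. \<phi> n = \<psi> n \<and> (0 < \<phi> n \<and> 1 \<le> n \<and> r < ereal (ln (real (c n)) / \<phi> n))"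
        by (rule frequently_conj_eventually)
      thus "\<exists>\<^sub>F n in sequentially. r < ereal (?a n / \<psi> n)"
      proof (rule frequently_elim1)
        fix n assume n: "\<phi> n = \<psi> n \<and> (0 < \<phi> n \<and> 1 \<le> n \<and> r < ereal (ln (real (c n)) / \<phi> n))"
        hence "ln (real (c n)) / \<phi> n \<le> ?a n / \<psi> n" using bds(1)[of n] by (simp add: divide_right_mono)
        hence "ereal (ln (real (c n)) / \<phi> n) \<le> ereal (?a n / \<psi> n)" by simp
        thus "r < ereal (?a n / \<psi> n)" using n by (meson less_le_trans)
      qed
    qed
    ultimately have "limsup (\<lambda>n. ereal (?a n / \<psi> n)) = 1" by (rule antisym)
    thus "x \<in> E_sup \<psi>" using x by (simp add: E_sup_def)
  qed
  finally show ?thesis .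
qed

section \<open>The dimension formulas\<close>

lemma hausdorff_dim_log_growth:
  assumes pos: "\<And>n. n \<ge> 1 \<Longrightarrow> \<psi> n > 0" and \<psi>: "filterlim \<psi> at_top sequentially"
    and \<alpha>: "0 \<le> \<alpha>" "(\<lambda>n. \<psi> n / ln (real n)) \<longlonglongrightarrow> \<alpha>"
  shows "hausdorff_dim (E_sup \<psi>) = ereal (if \<alpha> < 1 then 0 else (\<alpha> - 1) / (2 * \<alpha>))"
    and "hausdorff_dim (E_lim \<psi>) = ereal (if \<alpha> < 1 then 0 else (\<alpha> - 1) / (2 * \<alpha>))"
proof -
  let ?d = "if \<alpha> < 1 then 0 else (\<alpha> - 1) / (2 * \<alpha>)"
  have upper: "hausdorff_dim (E_sup \<psi>) \<le> ereal ?d"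
    using pos \<psi> \<alpha> by (rule hausdorff_dim_E_sup_le_log_growth)
  have between: "hausdorff_dim (E_lim \<psi>) \<le> hausdorff_dim (E_sup \<psi>)"
    by (rule hausdorff_dim_mono[OF E_lim_subset_E_sup])
  have lower: "ereal ?d \<le> hausdorff_dim (E_lim \<psi>)"
  proof (rule dense_le)
    fix z assume z: "z < ereal ?d"
    show "z \<le> hausdorff_dim (E_lim \<psi>)"
    proof (cases "z \<le> 0")
      case True
      thus ?thesis using hausdorff_dim_nonneg by (rule order_trans)
    next
      case False
      then obtain s where s: "z = ereal s" using z by (cases z) auto
      hence "0 < s" "s < ?d" using z False by auto
      hence "1 < \<alpha>" by (cases "\<alpha> = 1") (auto split: if_splits)
      hence "ereal s \<le> hausdorff_dim (E_lim \<psi>)"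
        using \<alpha> \<open>0 < s\<close> \<open>s < ?d\<close> by (intro hausdorff_dim_E_lim_ge_log_growth) auto
      thus ?thesis using s by simp
    qed
  qed
  show "hausdorff_dim (E_sup \<psi>) = ereal ?d" "hausdorff_dim (E_lim \<psi>) = ereal ?d"
    using upper between lower by (meson antisym order_trans)+
qed

lemma hausdorff_dim_E_sup_fast_growth:
  assumes pos: "\<And>n. n \<ge> 1 \<Longrightarrow> \<psi> n > 0" and \<psi>: "filterlim \<psi> at_top sequentially"
    and fast: "filterlim (\<lambda>n. \<psi> n / ln (real n)) at_top sequentially"
  shows "\<exists>A::ereal. A \<ge> 1 \<and> ln_ereal A = liminf (\<lambda>n. ereal (ln (\<psi> n) / real n)) \<and>
           hausdorff_dim (E_sup \<psi>) = 1 / (A + 1)"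
proof -
  define L where "L = liminf (\<lambda>n. ereal (ln (\<psi> n) / real n))"
  define A where "A = (if L = \<infinity> then \<infinity> else ereal (exp (real_of_ereal L)))"
  have L0: "0 \<le> L"
    unfolding L_def using \<psi> by (rule liminf_ln_over_index_nonneg)
  have A1: "1 \<le> A" using L0 by (cases L) (auto simp: A_def one_ereal_def)
  have ln_A: "ln_ereal A = L" using L0 by (cases L) (auto simp: A_def ln_ereal_def)
  have less_A: "ereal b < A \<longleftrightarrow> ereal (ln b) < L" if "0 < b" for b
  proof (cases L)
    case (real l)
    have "b < exp l \<longleftrightarrow> ln b < l" using that by (metis exp_less_cancel_iff exp_ln)
    thus ?thesis using real by (simp add: A_def)
  qed (use L0 in \<open>auto simp: A_def\<close>)
  have A_less: "A < ereal b \<longleftrightarrow> L < ereal (ln b)" if "0 < b" for b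
  proof (cases L)
    case (real l)
    have "exp l < b \<longleftrightarrow> l < ln b" using that by (metis exp_less_cancel_iff exp_ln)
    thus ?thesis using real by (simp add: A_def)
  qed (use L0 in \<open>auto simp: A_def\<close>)
  have "hausdorff_dim (E_sup \<psi>) \<le> 1 / (A + 1)"
  proof (rule hausdorff_dim_le_of_exponents[OF A1])
    fix b :: real assume "1 \<le> b" "b = 1 \<or> ereal b < A"
    thus "hausdorff_dim (E_sup \<psi>) \<le> ereal (1 / (b + 1))"
      using pos \<psi> less_A[of b] by (intro hausdorff_dim_E_sup_le_fast_growth) (auto simp: L_def)
  qed
  moreover have "1 / (A + 1) \<le> hausdorff_dim (E_sup \<psi>)"
  proof (rule hausdorff_dim_ge_of_exponents[OF A1])
    fix D :: real assume D: "0 \<le> D" "A < ereal (D + 1)"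
    have "1 < ereal (D + 1)" using A1 D(2) by (rule le_less_trans)
    hence "0 < D" by (simp add: one_ereal_def)
    thus "ereal (1 / (D + 2)) \<le> hausdorff_dim (E_sup \<psi>)"
      using pos \<psi> fast D A_less[of "D + 1"] by (intro hausdorff_dim_E_sup_ge_fast_growth) (auto simp: L_def)
  qed
  ultimately show ?thesis using A1 ln_A L_def by (intro exI[of _ A]) auto
qed

lemma hausdorff_dim_E_lim_fast_growth:
  fixes C :: ereal
  assumes pos: "\<And>n. n \<ge> 1 \<Longrightarrow> \<psi> n > 0" and \<psi>: "filterlim \<psi> at_top sequentially"
    and fast: "filterlim (\<lambda>n. \<psi> n / ln (real n)) at_top sequentially"
    and C: "C = 1 + limsup (\<lambda>n. ereal (\<psi> (n + 1) / (\<Sum>k=1..n. \<psi> k)))"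
  shows "1 \<le> C" and "E_lim \<psi> = {} \<or> hausdorff_dim (E_lim \<psi>) = 1 / (C + 1)"
proof -
  define L where "L = limsup (\<lambda>n. ereal (\<psi> (n + 1) / (\<Sum>k=1..n. \<psi> k)))"
  have L0: "0 \<le> L"
    unfolding L_def using pos by (rule limsup_ratio_nonneg)
  have CL: "C = 1 + L" by (simp add: C L_def)
  show C1: "1 \<le> C" unfolding CL using L0 by (cases L) (auto simp: one_ereal_def)
  have less_C: "ereal b < C \<longleftrightarrow> ereal (b - 1) < L" for b
    unfolding CL using L0 by (cases L) (auto simp: one_ereal_def)
  have C_less: "C < ereal (D + 1) \<longleftrightarrow> L < ereal D" for D
    unfolding CL using L0 by (cases L) (auto simp: one_ereal_def)
  show "E_lim \<psi> = {} \<or> hausdorff_dim (E_lim \<psi>) = 1 / (C + 1)"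
  proof (cases "E_lim \<psi> = {}")
    case False
    then obtain x where x: "x \<in> E_lim \<psi>" by blast
    have "hausdorff_dim (E_lim \<psi>) \<le> 1 / (C + 1)"
    proof (rule hausdorff_dim_le_of_exponents[OF C1])
      fix b :: real assume "1 \<le> b" "b = 1 \<or> ereal b < C"
      thus "hausdorff_dim (E_lim \<psi>) \<le> ereal (1 / (b + 1))"
        using pos \<psi> less_C[of b] by (intro hausdorff_dim_E_lim_le_fast_growth) (auto simp: L_def)
    qed
    moreover have "1 / (C + 1) \<le> hausdorff_dim (E_lim \<psi>)"
    proof (rule hausdorff_dim_ge_of_exponents[OF C1])
      fix D :: real assume "0 \<le> D" "C < ereal (D + 1)"
      thus "ereal (1 / (D + 2)) \<le> hausdorff_dim (E_lim \<psi>)"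
        using pos \<psi> fast x C_less[of D] by (intro hausdorff_dim_E_lim_ge_fast_growth) (auto simp: L_def)
    qed
    ultimately show ?thesis by simp
  qed simp
qed

theorem theorem1p3:
  fixes \<psi> :: "nat \<Rightarrow> real"
  assumes "\<And>n. n \<ge> 1 \<Longrightarrow> \<psi> n > 0"
    and "filterlim \<psi> at_top sequentially"
  shows "(\<forall>\<alpha>::real. \<alpha> \<ge> 0 \<longrightarrow> (\<lambda>n. \<psi> n / ln (real n)) \<longlonglongrightarrow> \<alpha> \<longrightarrow>
            hausdorff_dim (E_sup \<psi>) = ereal (if \<alpha> < 1 then 0 else (\<alpha> - 1) / (2 * \<alpha>)) \<and>
            hausdorff_dim (E_lim \<psi>) = ereal (if \<alpha> < 1 then 0 else (\<alpha> - 1) / (2 * \<alpha>)))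
       \<and> (filterlim (\<lambda>n. \<psi> n / ln (real n)) at_top sequentially \<longrightarrow>
            (\<exists>A::ereal. A \<ge> 1 \<and> ln_ereal A = liminf (\<lambda>n. ereal (ln (\<psi> n) / real n)) \<and>
               hausdorff_dim (E_sup \<psi>) = 1 / (A + 1)) \<and>
            (let C = 1 + limsup (\<lambda>n. ereal (\<psi> (n + 1) / (\<Sum>k=1..n. \<psi> k)))
             in C \<ge> 1 \<and> (E_lim \<psi> = {} \<or> hausdorff_dim (E_lim \<psi>) = 1 / (C + 1))))"
  unfolding Let_def
proof (intro conjI allI impI)
  fix \<alpha> :: real
  assume \<alpha>: "\<alpha> \<ge> 0" "(\<lambda>n. \<psi> n / ln (real n)) \<longlonglongrightarrow> \<alpha>"
  show "hausdorff_dim (E_sup \<psi>) = ereal (if \<alpha> < 1 then 0 else (\<alpha> - 1) / (2 * \<alpha>))"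
    using assms \<alpha> by (rule hausdorff_dim_log_growth)
  show "hausdorff_dim (E_lim \<psi>) = ereal (if \<alpha> < 1 then 0 else (\<alpha> - 1) / (2 * \<alpha>))"
    using assms \<alpha> by (rule hausdorff_dim_log_growth)
next
  assume fast: "filterlim (\<lambda>n. \<psi> n / ln (real n)) at_top sequentially"
  show "\<exists>A::ereal. A \<ge> 1 \<and> ln_ereal A = liminf (\<lambda>n. ereal (ln (\<psi> n) / real n)) \<and>
          hausdorff_dim (E_sup \<psi>) = 1 / (A + 1)"
    using assms fast by (rule hausdorff_dim_E_sup_fast_growth)
  show "1 \<le> 1 + limsup (\<lambda>n. ereal (\<psi> (n + 1) / (\<Sum>k=1..n. \<psi> k)))"
    using assms fast refl by (rule hausdorff_dim_E_lim_fast_growth)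
  show "E_lim \<psi> = {} \<or> hausdorff_dim (E_lim \<psi>) =
      1 / (1 + limsup (\<lambda>n. ereal (\<psi> (n + 1) / (\<Sum>k=1..n. \<psi> k))) + 1)"
    using assms fast refl by (rule hausdorff_dim_E_lim_fast_growth)
qed

end
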